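(* Let $n\ge1$ and let $Z\colon\mathrm{Conv}_{\rm sc}(\mathbb{R}^n)\to\mathbb{R}$ be a continuous and epi-translation invariant valuation that is epi-homogeneous of degree $m\in\{1,\dots,n\}$. There exists a symmetric function $\bar Z\colon(\mathrm{Conv}_{\rm sc}(\mathbb{R}^n))^m\to\mathbb{R}$ such that for $k\in\mathbb{N}$, $u_1,\dots,u_k\in\mathrm{Conv}_{\rm sc}(\mathbb{R}^n)$ and $\lambda_1,\dots,\lambda_k\ge0$, $$Z(\lambda_1\cdot_{\rm epi}u_1\,\Box\cdots\Box\,\lambda_k\cdot_{\rm epi}u_k)=\sum_{\substack{i_1,\dots,i_k\in\{0,\dots,m\}\\ i_1+\cdots+i_k=m}}\binom{m}{i_1\cdots i_k}\lambda_1^{i_1}\cdots\lambda_k^{i_k}\,\bar Z(u_1[i_1],\dots,u_k[i_k]),$$ where $u_j[i_j]$ means that the argument $u_j$ is repeated $i_j$ times. Moreover, the function $\bar Z$ is epi-additive in each variable. For $i\in\{1,\dots,m\}$ and $u_{i+1},\dots,u_m\in\mathrm{Conv}_{\rm sc}(\mathbb{R}^n)$, the map $u\mapsto\bar Z(u[i],u_{i+1},\dots,u_m)$ is a continuous, epi-translation invariant valuation on $\mathrm{Conv}_{\rm sc}(\mathbb{R}^n)$ that is epi-homogeneous of degree $i$.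
   Context: $\mathrm{Conv}(\mathbb{R}^n)$ is the set of convex, lower semicontinuous functions $u\colon\mathbb{R}^n\to\mathbb{R}\cup\{+\infty\}$ with $u\not\equiv+\infty$. $\mathrm{Conv}_{\rm sc}(\mathbb{R}^n)$ is the subset of super-coercive functions, i.e. those with $\lim_{|x|\to+\infty}u(x)/|x|=+\infty$. Topology: continuity is with respect to epi-convergence. A sequence $u_k$ epi-converges to $u$ if for every $x\in\mathbb{R}^n$: (i) $u(x)\le\liminf_{k\to\infty}u_k(x_k)$ for every sequence $x_k\to x$, and (ii) there is a sequence $x_k\to x$ with $u(x)=\lim_{k\to\infty}u_k(x_k)$. A functional $Z\colon X\to\mathbb{R}$ on a set $X$ of functions is a valuation if $Z(u\vee v)+Z(u\wedge v)=Z(u)+Z(v)$ for all $u,v\in X$ with $u\vee v\in X$ and $u\wedge v\in X$, where $\vee$ and $\wedge$ denote pointwise maximum and minimum. $Z$ is epi-translation invariant if $Z(u\circ\tau^{-1})=Z(u)$ for all $u$ and all translations $\tau$ of $\mathbb{R}^n$, and $Z(u+\alpha)=Z(u)$ for all $u$ and all constants $\alpha\in\mathbb{R}$. Epi-multiplication: $(\lambda\cdot_{\rm epi}u)(x)=\lambda\,u(x/\lambda)$ for $\lambda>0$, and $(0\cdot_{\rm epi}u)(x)=0$ if $x=0$, $=+\infty$ if $x\ne0$. $Z$ is epi-homogeneous of degree $\alpha$ if $Z(\lambda\cdot_{\rm epi}u)=\lambda^\alpha Z(u)$ for all $u$ and $\lambda>0$. Inf-convolution: $(u\,\Box\,v)(z)=\inf\{u(x)+v(y):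 x,y\in\mathbb{R}^n,\ x+y=z\}$, extended to finitely many functions; $\mathrm{Conv}_{\rm sc}(\mathbb{R}^n)$ is closed under it. In expressions such as $\lambda_1\cdot_{\rm epi}u_1\Box\lambda_2\cdot_{\rm epi}u_2$, epi-multiplication is performed first. A functional $Z$ on $\mathrm{Conv}_{\rm sc}(\mathbb{R}^n)$ is epi-additive if $Z(\alpha\cdot_{\rm epi}u\,\Box\,\beta\cdot_{\rm epi}v)=\alpha Z(u)+\beta Z(v)$ for all $\alpha,\beta>0$ and $u,v\in\mathrm{Conv}_{\rm sc}(\mathbb{R}^n)$. $\binom{m}{i_1\cdots i_k}=\frac{m!}{i_1!\cdots i_k!}$ is the multinomial coefficient, and $0^0=1$. *)

theory Defs
  imports "HOL-Analysis.Analysis"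
begin

text \<open>
  Functions with values in the reals extended by plus infinity are rendered as
  \<^typ>\<open>ereal\<close>-valued functions that never take the value minus infinity. In particular, for
  such functions no sum of opposite infinities occurs in any of the formulas below.
  Functionals are total HOL functions; every notion refers only to their values on the
  given set of functions.
\<close>

definition convex_ereal :: "('a::real_vector \<Rightarrow> ereal) \<Rightarrow> bool" where
  "convex_ereal u \<longleftrightarrow>
     (\<forall>x y t. 0 < t \<and> t < 1 \<longrightarrow>
        u ((1 - t) *\<^sub>R x + t *\<^sub>R y) \<le> ereal (1 - t) * u x + ereal t * u y)"

definition lower_semicontinuous :: "('a::topological_space \<Rightarrow> ereal) \<Rightarrow> bool" where
  "lower_semicontinuous u \<longleftrightarrow> (\<forall>x. u x \<le> Liminf (at x) u)"

definition Conv :: "('a::euclidean_space \<Rightarrow> ereal) set" where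
  "Conv = {u. (\<forall>x. u x \<noteq> - \<infinity>) \<and> convex_ereal u \<and> lower_semicontinuous u \<and> (\<exists>x. u x \<noteq> \<infinity>)}"

definition super_coercive :: "('a::real_normed_vector \<Rightarrow> ereal) \<Rightarrow> bool" where
  "super_coercive u \<longleftrightarrow> ((\<lambda>x. u x / ereal (norm x)) \<longlongrightarrow> \<infinity>) at_infinity"

definition Conv_sc :: "('a::euclidean_space \<Rightarrow> ereal) set" where
  "Conv_sc = {u \<in> Conv. super_coercive u}"

definition epi_converges ::
    "(nat \<Rightarrow> 'a::topological_space \<Rightarrow> ereal) \<Rightarrow> ('a \<Rightarrow> ereal) \<Rightarrow> bool" where
  "epi_converges us u \<longleftrightarrow>
     (\<forall>x. (\<forall>xs. xs \<longlonglongrightarrow> x \<longrightarrow> u x \<le> liminf (\<lambda>k. us k (xs k))) \<and>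
          (\<exists>xs. xs \<longlonglongrightarrow> x \<and> (\<lambda>k. us k (xs k)) \<longlonglongrightarrow> u x))"

definition epi_continuous_on ::
    "('a::topological_space \<Rightarrow> ereal) set \<Rightarrow> (('a \<Rightarrow> ereal) \<Rightarrow> real) \<Rightarrow> bool" where
  "epi_continuous_on X Z \<longleftrightarrow>
     (\<forall>us u. (\<forall>k. us k \<in> X) \<and> u \<in> X \<and> epi_converges us u \<longrightarrow> (\<lambda>k. Z (us k)) \<longlonglongrightarrow> Z u)"

definition valuation_on :: "('a \<Rightarrow> ereal) set \<Rightarrow> (('a \<Rightarrow> ereal) \<Rightarrow> real) \<Rightarrow> bool" where
  "valuation_on X Z \<longleftrightarrow>
     (\<forall>u\<in>X. \<forall>v\<in>X. (\<lambda>x. max (u x) (v x)) \<in> X \<and> (\<lambda>x. min (u x) (v x)) \<in> X \<longrightarrow>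
        Z (\<lambda>x. max (u x) (v x)) + Z (\<lambda>x. min (u x) (v x)) = Z u + Z v)"

definition epi_translation_invariant_on ::
    "('a::real_vector \<Rightarrow> ereal) set \<Rightarrow> (('a \<Rightarrow> ereal) \<Rightarrow> real) \<Rightarrow> bool" where
  "epi_translation_invariant_on X Z \<longleftrightarrow>
     (\<forall>u\<in>X. (\<forall>y. Z (\<lambda>x. u (x - y)) = Z u) \<and> (\<forall>\<alpha>. Z (\<lambda>x. u x + ereal \<alpha>) = Z u))"

text \<open>Only nonnegative factors are meaningful.\<close>

definition epi_mult :: "real \<Rightarrow> ('a::real_vector \<Rightarrow> ereal) \<Rightarrow> 'a \<Rightarrow> ereal" where
  "epi_mult c u x =
     (if c = 0 then (if x = 0 then 0 else \<infinity>) else ereal c * u (x /\<^sub>R c))"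

definition epi_homogeneous_on ::
    "('a::real_vector \<Rightarrow> ereal) set \<Rightarrow> real \<Rightarrow> (('a \<Rightarrow> ereal) \<Rightarrow> real) \<Rightarrow> bool" where
  "epi_homogeneous_on X \<alpha> Z \<longleftrightarrow> (\<forall>u\<in>X. \<forall>c>0. Z (epi_mult c u) = c powr \<alpha> * Z u)"

definition inf_conv ::
    "('a::real_vector \<Rightarrow> ereal) \<Rightarrow> ('a \<Rightarrow> ereal) \<Rightarrow> 'a \<Rightarrow> ereal" where
  "inf_conv u v z = Inf {u x + v y | x y. x + y = z}"

text \<open>
  Inf-convolution of the functions \<open>us 1, \<dots>, us k\<close>. For \<open>k = 0\<close> this is the function that is 0 at
  the origin and infinite elsewhere, the neutral element of inf-convolution.
\<close>

definition inf_conv_fam :: "nat \<Rightarrow> (nat \<Rightarrow> 'a::real_vector \<Rightarrow> ereal) \<Rightarrow> 'a \<Rightarrow> ereal" where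
  "inf_conv_fam k us z = Inf {(\<Sum>j=1..k. us j (xs j)) | xs. (\<Sum>j=1..k. xs j) = z}"

lemma inf_conv_fam_1: "inf_conv_fam 1 us = us 1"
proof
  fix z
  have "{(\<Sum>j=1..1. us j (xs j)) | xs. (\<Sum>j=1..1. xs j) = z} = {us 1 z}"
    by (auto intro: exI[of _ "\<lambda>_. z"])
  then show "inf_conv_fam 1 us z = us 1 z"
    unfolding inf_conv_fam_def by simp
qed

lemma inf_conv_fam_2: "inf_conv_fam 2 us = inf_conv (us 1) (us 2)"
proof
  fix z
  have I: "{1..2::nat} = {1, 2}"
    by auto
  have "{(\<Sum>j=1..2. us j (xs j)) | xs. (\<Sum>j=1..2. xs j) = z} =
        {us 1 x + us 2 y | x y. x + y = z}" (is "?L = ?R")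
  proof
    show "?L \<subseteq> ?R"
      unfolding I by auto
    show "?R \<subseteq> ?L"
    proof
      fix r assume "r \<in> ?R"
      then obtain x y where "r = us 1 x + us 2 y" "x + y = z"
        by auto
      then show "r \<in> ?L"
        unfolding I by (auto intro!: exI[of _ "\<lambda>j::nat. if j = 1 then x else y"])
    qed
  qed
  then show "inf_conv_fam 2 us z = inf_conv (us 1) (us 2) z"
    unfolding inf_conv_fam_def inf_conv_def by simp
qed

definition epi_additive :: "(('a::euclidean_space \<Rightarrow> ereal) \<Rightarrow> real) \<Rightarrow> bool" where
  "epi_additive Z \<longleftrightarrow>
     (\<forall>a>0. \<forall>b>0. \<forall>u\<in>Conv_sc. \<forall>v\<in>Conv_sc.
        Z (inf_conv (epi_mult a u) (epi_mult b v)) = a * Z u + b * Z v)"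

text \<open>
  Functionals of \<open>m\<close> variables in a set \<open>X\<close> are rendered as functionals on lists; only the
  values on lists of length \<open>m\<close> with entries in \<open>X\<close> matter.
\<close>

definition symmetric_on :: "'b set \<Rightarrow> nat \<Rightarrow> ('b list \<Rightarrow> real) \<Rightarrow> bool" where
  "symmetric_on X m F \<longleftrightarrow>
     (\<forall>us vs. length us = m \<and> set us \<subseteq> X \<and> mset us = mset vs \<longrightarrow> F us = F vs)"

definition epi_additive_each :: "nat \<Rightarrow> (('a::euclidean_space \<Rightarrow> ereal) list \<Rightarrow> real) \<Rightarrow> bool" where
  "epi_additive_each m F \<longleftrightarrow>
     (\<forall>us. length us = m \<and> set us \<subseteq> Conv_sc \<longrightarrow> (\<forall>j<m. epi_additive (\<lambda>u. F (us[j := u]))))"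

definition multi_indices :: "nat \<Rightarrow> nat \<Rightarrow> (nat \<Rightarrow> nat) set" where
  "multi_indices k m = {i \<in> {1..k} \<rightarrow>\<^sub>E {0..m}. (\<Sum>j=1..k. i j) = m}"

definition multinomial :: "nat \<Rightarrow> nat \<Rightarrow> (nat \<Rightarrow> nat) \<Rightarrow> real" where
  "multinomial m k i = fact m / (\<Prod>j=1..k. fact (i j))"

text \<open>The argument list consisting of \<open>i 1\<close> copies of \<open>us 1\<close>, ..., \<open>i k\<close> copies of \<open>us k\<close>.\<close>

definition repeat_args :: "nat \<Rightarrow> (nat \<Rightarrow> nat) \<Rightarrow> (nat \<Rightarrow> 'b) \<Rightarrow> 'b list" where
  "repeat_args k i us = concat (map (\<lambda>j. replicate (i j) (us j)) [1..<Suc k])"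

end

theory Submission
  imports Defs "HOL-Library.Function_Algebras"
begin

text \<open>
  Passing to convex conjugates turns super-coercive functions into finite convex functions,
  inf-convolution into addition and epi-multiplication into multiplication by scalars; the dual
  functional \<open>Y f = Z (f\<^sup>*)\<close> is again a continuous valuation and ignores affine summands.

  The point is that \<open>Y\<close> is a polynomial of degree at most \<open>n + 1\<close>: its iterated differences in
  \<open>n + 2\<close> directions vanish. If \<open>v\<close> is affine near a point, the valuation property and affine
  invariance make the difference of \<open>Y\<close> in direction \<open>v\<close> blind to changes of the base function
  near that point. Approximate \<open>n + 1\<close> of the directions by piecewise affine functions and
  translate these into general position; then every point has a neighbourhood on which one of
  them is affine, so the iterated difference in these directions ignores all local changes of
  the base function, hence does not depend on it at all.

  Homogeneity lowers the degree to \<open>m\<close>, since a nonzero top-degree difference would scale with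
  the wrong power of 2. The \<open>m\<close>-th difference divided by \<open>m!\<close> is then additive in every argument,
  and it is the required polarization.
\<close>

section \<open>Difference operators and polarization\<close>

text \<open>Directions are only ever added to the base function: differences of convex functions
  need not be convex, and \<open>Y\<close> is controlled on convex functions alone. Its continuity
  has to cross conjugation both ways; the finite counterpart of epi-convergence is continuous
  convergence.

  The obstacle is the passage from local to global changes of the base. The valuation identity
  concerns pairs whose minimum is convex, so the base can be raised only near points where a
  direction is affine. A tangent of a strongly convex function rises above a slightly smaller
  function only near its point of contact, which makes small changes over a compact set accessible.
  Strong convexity comes from a small quadratic term that is removed by continuity, and a change on
  all of space is cut down to a compact sublevel set.

  The number n + 1 counts dimensions: the points where a piecewise affine function is not locally
  affine lie in finitely many hyperplanes, and n + 1 such families in general position have no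
  common point. The last of the n + 2 directions is the change of base.\<close>

fun diff_op :: "('b::comm_monoid_add \<Rightarrow> real) \<Rightarrow> 'b list \<Rightarrow> 'b \<Rightarrow> real" where
  "diff_op Z [] w = Z w"
| "diff_op Z (f # fs) w = diff_op Z fs (w + f) - diff_op Z fs w"

lemma diff_op_append_Cons: "diff_op Z (xs @ f # ys) w = diff_op Z (f # xs @ ys) w"
proof (induction xs arbitrary: w)
  case (Cons a xs)
  have "diff_op Z ((a # xs) @ f # ys) w = diff_op Z (xs @ f # ys) (w + a) - diff_op Z (xs @ f # ys) w"
    by simp
  also have "\<dots> = diff_op Z (f # xs @ ys) (w + a) - diff_op Z (f # xs @ ys) w"
    by (simp only: Cons.IH)
  also have "\<dots> = diff_op Z (f # (a # xs) @ ys) w"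
    by (simp add: ac_simps)
  finally show ?case .
qed simp

lemma diff_op_mset: "mset us = mset vs \<Longrightarrow> diff_op Z us w = diff_op Z vs w"
proof (induction us arbitrary: vs w)
  case (Cons u us)
  have "u \<in> set vs"
    using Cons.prems by (metis list.set_intros(1) mset_eq_setD)
  then obtain as bs where vs: "vs = as @ u # bs"
    by (meson split_list)
  have "mset us = mset (as @ bs)"
    using Cons.prems vs by simp
  then show ?case
    unfolding vs diff_op_append_Cons by (simp only: diff_op.simps Cons.IH)
qed simp

text \<open>A cocycle identity: additivity in a direction fails only through the shift of the base
  by \<open>g\<close>, that is, by a difference of one order higher.\<close>

lemma diff_op_add:
  "diff_op Z ((f + g) # fs) w = diff_op Z (f # fs) (w + g) + diff_op Z (g # fs) w"
  by (simp add: ac_simps)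

section \<open>Vanishing differences and homogeneity\<close>

lemma diff_op_doubled:
  assumes "\<And>w. w \<in> C \<Longrightarrow> Z (w + w) = 2 ^ m * Z w"
    and "\<And>f g. f \<in> C \<Longrightarrow> g \<in> C \<Longrightarrow> f + g \<in> C"
    and "set fs \<subseteq> C" "w \<in> C"
  shows "diff_op Z (map (\<lambda>f. f + f) fs) (w + w) = 2 ^ m * diff_op Z fs w"
  using assms(3,4)
proof (induction fs arbitrary: w)
  case (Cons f fs)
  have "w + w + (f + f) = (w + f) + (w + f)"
    by (simp add: ac_simps)
  then show ?case
    using Cons assms(2) by (simp add: right_diff_distrib)
qed (simp add: assms(1))

text \<open>When differences of order d + 1 vanish, those of order d do not depend on the base and
  are therefore additive in every direction. Doubling all d directions multiplies them by 2^d, while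
  homogeneity gives the factor 2^m.\<close>

lemma diff_op_degree_reduction:
  assumes hom: "\<And>w. w \<in> C \<Longrightarrow> Z (w + w) = 2 ^ m * Z w"
    and C0: "0 \<in> C"
    and Cadd: "\<And>f g. f \<in> C \<Longrightarrow> g \<in> C \<Longrightarrow> f + g \<in> C"
    and van: "\<And>fs w. length fs = Suc d \<Longrightarrow> set fs \<subseteq> C \<Longrightarrow> w \<in> C \<Longrightarrow> diff_op Z fs w = 0"
    and "m < d" and fs: "length fs = d" "set fs \<subseteq> C" and w: "w \<in> C"
  shows "diff_op Z fs w = 0"
proof -
  have indep: "diff_op Z gs w = diff_op Z gs 0"
    if "length gs = d" "set gs \<subseteq> C" "w \<in> C" for gs w
    using van[of "w # gs" 0] that C0 by simp
  \<comment> \<open>The list \<open>ys\<close> collects the directions whose doubling is still to be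
    undone or has been undone, so that the doublings in \<open>xs\<close> can be removed one at a
    time.\<close>
  have add: "diff_op Z (map (\<lambda>f. f + f) xs @ ys) 0 = 2 ^ length xs * diff_op Z (xs @ ys) 0"
    if "length xs + length ys = d" "set xs \<subseteq> C" "set ys \<subseteq> C" for xs ys
    using that
  proof (induction xs arbitrary: ys)
    case (Cons x xs)
    have in_C: "set (x # xs @ ys) \<subseteq> C"
      using Cons.prems by auto
    have "diff_op Z (map (\<lambda>f. f + f) (x # xs) @ ys) 0
        = diff_op Z (map (\<lambda>f. f + f) xs @ (x + x) # ys) 0"
      by (simp add: diff_op_append_Cons)
    also have "\<dots> = 2 ^ length xs * diff_op Z (xs @ (x + x) # ys) 0"
      by (rule Cons.IH) (use Cons.prems Cadd in auto)
    also have "diff_op Z (xs @ (x + x) # ys) 0 = diff_op Z ((x + x) # xs @ ys) 0"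
      by (rule diff_op_append_Cons)
    also have "\<dots> = diff_op Z (x # xs @ ys) x + diff_op Z (x # xs @ ys) 0"
      unfolding diff_op_add by simp
    also have "diff_op Z (x # xs @ ys) x = diff_op Z (x # xs @ ys) 0"
      by (rule indep) (use Cons.prems in_C in auto)
    finally show ?case
      by simp
  qed simp
  have "2 ^ d * diff_op Z fs 0 = diff_op Z (map (\<lambda>f. f + f) fs) 0"
    using add[of fs "[]"] fs by simp
  also have "\<dots> = 2 ^ m * diff_op Z fs 0"
    using diff_op_doubled[of C Z m fs 0] hom Cadd fs C0 by simp
  finally have "(2 ^ d - 2 ^ m) * diff_op Z fs 0 = 0"
    by (simp add: algebra_simps)
  moreover have "(2::real) ^ m < 2 ^ d"
    using \<open>m < d\<close> by simp
  ultimately have "diff_op Z fs 0 = 0"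
    by simp
  then show ?thesis
    using indep[OF fs w] by simp
qed

text \<open>The degree reduction is applied d times, from order m + d + 1 down to order m + 1; there
  it stops, because it needs an order above m.\<close>

lemma diff_op_degree_le_homogeneity:
  assumes hom: "\<And>w. w \<in> C \<Longrightarrow> Z (w + w) = 2 ^ m * Z w"
    and C0: "0 \<in> C"
    and Cadd: "\<And>f g. f \<in> C \<Longrightarrow> g \<in> C \<Longrightarrow> f + g \<in> C"
    and van: "\<And>fs w. length fs = Suc (m + d) \<Longrightarrow> set fs \<subseteq> C \<Longrightarrow> w \<in> C \<Longrightarrow> diff_op Z fs w = 0"
    and "length fs = Suc m" "set fs \<subseteq> C" "w \<in> C"
  shows "diff_op Z fs w = 0"
proof -
  have "diff_op Z fs w = 0" if "k \<le> d" "length fs = Suc (m + (d - k))" "set fs \<subseteq> C" "w \<in> C" for k fs w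
    using that
  proof (induction k arbitrary: fs w)
    case 0
    then show ?case
      using van by simp
  next
    case (Suc k)
    show ?case
    proof (rule diff_op_degree_reduction[where C = C and m = m and d = "Suc (m + (d - Suc k))"])
      fix fs w assume "length fs = Suc (Suc (m + (d - Suc k)))" "set fs \<subseteq> C" "w \<in> C"
      then show "diff_op Z fs w = 0"
        using Suc.prems(1) by (intro Suc.IH) auto
    qed (use Suc.prems assms(1-3) in auto)
  qed
  from this[of d fs w] assms(5-7) show ?thesis
    by simp
qed

text \<open>Expands the k-th difference in one direction; the inner sum is the j-fold multiple of
  \<open>f\<close>, written without scalars. Besides the diagonal value of the polarization, it
  yields the properties of a repeated argument, which are checked on each multiple
  separately.\<close>

lemma diff_op_replicate:
  "diff_op Z (replicate k f @ fs) w
     = (\<Sum>j\<le>k. (- 1) ^ (k - j) * real (k choose j) * diff_op Z fs (w + (\<Sum>l<j. f)))"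
proof (induction k arbitrary: w)
  case (Suc k)
  let ?G = "\<lambda>j::nat. diff_op Z fs (w + (\<Sum>l<j. f))"
  have "diff_op Z (replicate (Suc k) f @ fs) w
      = (\<Sum>j\<le>k. (- 1) ^ (k - j) * real (k choose j) * ?G (Suc j))
        - (\<Sum>j\<le>k. (- 1) ^ (k - j) * real (k choose j) * ?G j)"
    by (simp add: Suc.IH ac_simps)
  \<comment> \<open>The second sum is shifted by one index, so that Pascal's rule merges it with the
    first.\<close>
  also have "(\<Sum>j\<le>k. (- 1) ^ (k - j) * real (k choose j) * ?G j)
      = ?G 0 * (-1) ^ k + (\<Sum>j<k. (- 1) ^ (k - Suc j) * real (k choose Suc j) * ?G (Suc j))"
    by (subst sum.atMost_shift) (simp add: ac_simps)
  also have "(\<Sum>j<k. (- 1) ^ (k - Suc j) * real (k choose Suc j) * ?G (Suc j))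
      = - (\<Sum>j\<le>k. (- 1) ^ (k - j) * real (k choose Suc j) * ?G (Suc j))"
  proof -
    have "(- 1::real) ^ (k - j) = - ((-1) ^ (k - Suc j))" if "j < k" for j
      using that by (metis Suc_diff_Suc mult_minus1 power_Suc)
    then show ?thesis
      by (simp add: lessThan_Suc_atMost[symmetric] sum_negf[symmetric])
  qed
  also have "(\<Sum>j\<le>k. (- 1) ^ (k - j) * real (k choose j) * ?G (Suc j))
       - (?G 0 * (-1) ^ k + - (\<Sum>j\<le>k. (- 1) ^ (k - j) * real (k choose Suc j) * ?G (Suc j)))
      = (-1) ^ Suc k * ?G 0
        + (\<Sum>j\<le>k. (- 1) ^ (Suc k - Suc j) * real (Suc k choose Suc j) * ?G (Suc j))"
    by (simp add: sum.distrib[symmetric] algebra_simps)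
  also have "\<dots> = (\<Sum>j\<le>Suc k. (- 1) ^ (Suc k - j) * real (Suc k choose j) * ?G j)"
    by (subst sum.atMost_Suc_shift) simp
  finally show ?case .
qed simp

lemma sum_binomial_Suc:
  fixes G :: "nat \<Rightarrow> real"
  shows "(\<Sum>l\<le>a. real (a choose l) * G (Suc l)) + (\<Sum>l\<le>a. real (a choose l) * G l)
    = (\<Sum>l\<le>Suc a. real (Suc a choose l) * G l)"
proof -
  have "(\<Sum>l\<le>a. real (a choose l) * G l) = G 0 + (\<Sum>l\<le>a. real (a choose Suc l) * G (Suc l))"
    by (subst sum.atMost_shift) (simp add: lessThan_Suc_atMost[symmetric])
  then show ?thesis
    by (subst sum.atMost_Suc_shift) (simp add: sum.distrib[symmetric] algebra_simps)
qed

text \<open>The sum is the k-th difference with step 1 of the monomial of degree i, and each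
  difference lowers the degree of a polynomial by one. The offset \<open>x\<close> is arbitrary
  because the induction passes from \<open>x\<close> to \<open>x + 1\<close>.\<close>

lemma alternating_binomial_power_sum:
  assumes "i \<le> k"
  shows "(\<Sum>j\<le>k. (- 1) ^ (k - j) * real (k choose j) * (x + real j) ^ i) = (if i = k then fact k else 0)"
  using assms
proof (induction k arbitrary: i x)
  case (Suc k)
  let ?S = "\<lambda>k i x. \<Sum>j\<le>k. (- 1) ^ (k - j) * real (k choose j) * (x + real j) ^ i"
  \<comment> \<open>The sum is read as \<open>diff_op\<close> of a monomial over the additive monoid
    of reals, where one more difference is a subtraction by definition.\<close>
  have step: "?S (Suc k) i x = ?S k i (x + 1) - ?S k i x" for i x
    using diff_op_replicate[of "\<lambda>t::real. t ^ i" k 1 "[]" x]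
      diff_op_replicate[of "\<lambda>t::real. t ^ i" k 1 "[]" "x + 1"]
      diff_op_replicate[of "\<lambda>t::real. t ^ i" "Suc k" 1 "[]" x]
    by simp
  have "?S k i (x + 1) - ?S k i x
     = (\<Sum>j\<le>k. (- 1) ^ (k - j) * real (k choose j) * ((x + real j + 1) ^ i - (x + real j) ^ i))"
    by (simp add: sum_subtractf[symmetric] algebra_simps)
  also have "\<dots> = (\<Sum>j\<le>k. (- 1) ^ (k - j) * real (k choose j) * (\<Sum>l<i. real (i choose l) * (x + real j) ^ l))"
  proof -
    have "(y + 1) ^ i - y ^ i = (\<Sum>l<i. real (i choose l) * y ^ l)" for y :: real
      by (simp add: binomial_ring lessThan_Suc_atMost[symmetric])
    then show ?thesis
      by simp
  qed
  also have "\<dots> = (\<Sum>l<i. real (i choose l) * ?S k l x)"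
    unfolding sum_distrib_left by (subst sum.swap) (simp add: ac_simps)
  also have "\<dots> = (\<Sum>l<i. real (i choose l) * (if l = k then fact k else 0))"
    using Suc.prems by (intro sum.cong refl) (subst Suc.IH, auto)
  also have "\<dots> = (if i = Suc k then fact (Suc k) else 0)"
  proof (cases "i = Suc k")
    case False
    then show ?thesis
      using Suc.prems by simp
  qed simp
  finally show ?case
    using step by simp
qed simp

text \<open>Homogeneity is stated for sums of copies of \<open>f\<close>, which make sense in any
  commutative monoid; real factors enter later through continuity. For positive \<open>m\<close> the
  case of zero copies says that \<open>Z\<close> vanishes at 0.\<close>

locale homogeneous_polynomial_map =
  fixes C :: "'b::comm_monoid_add set" and Z :: "'b \<Rightarrow> real" and m :: nat
  assumes zero_in: "0 \<in> C"
    and add_in: "f \<in> C \<Longrightarrow> g \<in> C \<Longrightarrow> f + g \<in> C"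
    and multiples: "f \<in> C \<Longrightarrow> Z (\<Sum>l<j. f) = real j ^ m * Z f"
    and diff_op_zero: "length fs = Suc m \<Longrightarrow> set fs \<subseteq> C \<Longrightarrow> w \<in> C \<Longrightarrow> diff_op Z fs w = 0"
begin

definition polar :: "'b list \<Rightarrow> real" where
  "polar fs = diff_op Z fs 0 / fact m"

lemma polar_mset: "mset us = mset vs \<Longrightarrow> polar us = polar vs"
  unfolding polar_def by (metis diff_op_mset)

text \<open>A vanishing difference of order m + 1 with the extra direction \<open>g\<close> moves
  the base from \<open>g\<close> back to 0, which removes the defect in the cocycle
  identity.\<close>

lemma polar_add:
  assumes "length xs + length ys + 1 = m" "f \<in> C" "g \<in> C" "set xs \<subseteq> C" "set ys \<subseteq> C"
  shows "polar (xs @ (f + g) # ys) = polar (xs @ f # ys) + polar (xs @ g # ys)"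
proof -
  have "diff_op Z (g # f # xs @ ys) 0 = 0"
    using assms by (intro diff_op_zero[OF _ _ zero_in]) auto
  then have "diff_op Z (f # xs @ ys) g = diff_op Z (f # xs @ ys) 0"
    by (simp only: diff_op.simps(2)[of Z g] add_0_left right_minus_eq)
  then show ?thesis
    unfolding polar_def diff_op_append_Cons diff_op_add by (simp only: add_divide_distrib add_0_left)
qed

lemma polar_zero:
  assumes "length xs + length ys + 1 = m" "set xs \<subseteq> C" "set ys \<subseteq> C"
  shows "polar (xs @ 0 # ys) = 0"
proof -
  have "polar (xs @ (0 + 0) # ys) = polar (xs @ 0 # ys) + polar (xs @ 0 # ys)"
    using assms zero_in by (intro polar_add) auto
  then show ?thesis
    unfolding add_0_left by linarith
qed

text \<open>On multiples of \<open>f\<close> the map is a monomial of degree m, whose m-th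
  difference is m!; this is where the normalizing factor of \<open>polar\<close> comes from.\<close>

lemma polar_diagonal:
  assumes "f \<in> C"
  shows "polar (replicate m f) = Z f"
proof -
  have "diff_op Z (replicate m f) 0
      = (\<Sum>j\<le>m. (- 1) ^ (m - j) * real (m choose j) * Z (\<Sum>l<j. f))"
    using diff_op_replicate[of Z m f "[]" 0] by simp
  also have "\<dots> = (\<Sum>j\<le>m. (- 1) ^ (m - j) * real (m choose j) * (0 + real j) ^ m) * Z f"
    unfolding multiples[OF assms] sum_distrib_right by (simp add: ac_simps)
  also have "\<dots> = fact m * Z f"
    by (subst alternating_binomial_power_sum) auto
  finally show ?thesis
    unfolding polar_def by simp
qed

text \<open>The binomial theorem for a symmetric multiadditive form. The list \<open>ys\<close> of
  passive arguments is arbitrary, since each step of the induction stores one expanded summand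
  there.\<close>

lemma polar_binomial:
  assumes "a + length ys = m" "s \<in> C" "y \<in> C" "set ys \<subseteq> C"
  shows "polar (replicate a (s + y) @ ys)
    = (\<Sum>l\<le>a. real (a choose l) * polar (replicate l s @ replicate (a - l) y @ ys))"
  using assms
proof (induction a arbitrary: ys)
  case (Suc a)
  let ?G = "\<lambda>l. polar (replicate l s @ replicate (Suc a - l) y @ ys)"
  have C: "s + y \<in> C"
    using Suc.prems add_in by simp
  have move: "polar (replicate a (s + y) @ z # ys)
      = (\<Sum>l\<le>a. real (a choose l) * polar (replicate l s @ replicate (a - l) y @ z # ys))"
    if "z \<in> C" for z
    using Suc.prems that by (intro Suc.IH) auto
  have "polar (replicate (Suc a) (s + y) @ ys) = polar (replicate a (s + y) @ (s + y) # ys)"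
    by (rule polar_mset) simp
  also have "\<dots> = polar (replicate a (s + y) @ s # ys) + polar (replicate a (s + y) @ y # ys)"
    using Suc.prems C by (intro polar_add) auto
  also have "\<dots> = (\<Sum>l\<le>a. real (a choose l) * ?G (Suc l)) + (\<Sum>l\<le>a. real (a choose l) * ?G l)"
  proof -
    have "polar (replicate l s @ replicate (a - l) y @ s # ys) = ?G (Suc l)" if "l \<le> a" for l
      by (rule polar_mset) simp
    moreover have "polar (replicate l s @ replicate (a - l) y @ y # ys) = ?G l" if "l \<le> a" for l
      using that by (intro polar_mset) (simp add: Suc_diff_le)
    ultimately show ?thesis
      unfolding move[OF Suc.prems(2)] move[OF Suc.prems(3)] by simp
  qed
  also have "\<dots> = (\<Sum>l\<le>Suc a. real (Suc a choose l) * ?G l)"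
    by (rule sum_binomial_Suc)
  finally show ?case .
next
  case 0
  show ?case
    by simp
qed

end

section \<open>Multi-indices and the multinomial expansion\<close>

lemma mem_multi_indices_iff:
  "i \<in> multi_indices k a \<longleftrightarrow> (\<forall>j. j \<notin> {1..k} \<longrightarrow> i j = undefined) \<and> (\<Sum>j=1..k. i j) = a"
proof
  assume *: "(\<forall>j. j \<notin> {1..k} \<longrightarrow> i j = undefined) \<and> (\<Sum>j=1..k. i j) = a"
  have "i j \<le> a" if "j \<in> {1..k}" for j
    using * that member_le_sum[of j "{1..k}" i] by simp
  with * show "i \<in> multi_indices k a"
    unfolding multi_indices_def PiE_iff extensional_def by simp
qed (auto simp: multi_indices_def PiE_iff extensional_def)

text \<open>Here \<open>l\<close> is the total of the first k entries, so the last entry must be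
  \<open>a - l\<close>. The inverse resets position k + 1 to \<open>undefined\<close> because
  multi-indices are extensional functions.\<close>

lemma multi_indices_Suc_bij:
  "bij_betw (\<lambda>(l, i). i(Suc k := a - l)) (SIGMA l:{..a}. multi_indices k l) (multi_indices (Suc k) a)"
proof (rule bij_betw_byWitness[where f' = "\<lambda>i. (a - i (Suc k), i(Suc k := undefined))"])
  have sum_upd: "(\<Sum>j=1..k. (i(Suc k := x)) j) = (\<Sum>j=1..k. i j)" for i :: "nat \<Rightarrow> nat" and x
    by (rule sum.cong) auto
  have upd_ext: "(i(Suc k := x)) j = undefined"
    if "\<forall>j. j \<notin> {1..k} \<longrightarrow> i j = undefined" "j \<notin> {1..Suc k}" for i :: "nat \<Rightarrow> nat" and j x
    using that by auto
  show "\<forall>p\<in>(SIGMA l:{..a}. multi_indices k l).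
      (\<lambda>i. (a - i (Suc k), i(Suc k := undefined))) ((\<lambda>(l, i). i(Suc k := a - l)) p) = p"
  proof
    fix p assume "p \<in> (SIGMA l:{..a}. multi_indices k l)"
    then obtain l i where p: "p = (l, i)" "l \<le> a" "i \<in> multi_indices k l"
      by blast
    then have "i (Suc k) = undefined"
      by (simp add: mem_multi_indices_iff)
    then have "i(Suc k := undefined) = i"
      by (rule fun_upd_idem)
    with p show "(\<lambda>i. (a - i (Suc k), i(Suc k := undefined))) ((\<lambda>(l, i). i(Suc k := a - l)) p) = p"
      by simp
  qed
  have le: "i (Suc k) \<le> a" and sum: "(\<Sum>j=1..k. i j) = a - i (Suc k)"
    if "i \<in> multi_indices (Suc k) a" for i
    using that by (auto simp: mem_multi_indices_iff)
  show "\<forall>i\<in>multi_indices (Suc k) a.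
      (\<lambda>(l, i). i(Suc k := a - l)) ((\<lambda>i. (a - i (Suc k), i(Suc k := undefined))) i) = i"
    using le by (simp add: fun_upd_idem)
  show "(\<lambda>(l, i). i(Suc k := a - l)) ` (SIGMA l:{..a}. multi_indices k l) \<subseteq> multi_indices (Suc k) a"
  proof
    fix x assume "x \<in> (\<lambda>(l, i). i(Suc k := a - l)) ` (SIGMA l:{..a}. multi_indices k l)"
    then obtain l i where x: "x = i(Suc k := a - l)" and l: "l \<le> a" and i: "i \<in> multi_indices k l"
      by auto
    have "(\<Sum>j=1..Suc k. x j) = a"
      using l i sum_upd[of i "a - l"] unfolding x mem_multi_indices_iff by simp
    moreover have "\<forall>j. j \<notin> {1..Suc k} \<longrightarrow> x j = undefined"
      using upd_ext[of i] i unfolding x mem_multi_indices_iff by blast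
    ultimately show "x \<in> multi_indices (Suc k) a"
      unfolding mem_multi_indices_iff by blast
  qed
  show "(\<lambda>i. (a - i (Suc k), i(Suc k := undefined))) ` multi_indices (Suc k) a
      \<subseteq> (SIGMA l:{..a}. multi_indices k l)"
  proof
    fix x assume "x \<in> (\<lambda>i. (a - i (Suc k), i(Suc k := undefined))) ` multi_indices (Suc k) a"
    then obtain i where x: "x = (a - i (Suc k), i(Suc k := undefined))" and i: "i \<in> multi_indices (Suc k) a"
      by auto
    have "(i(Suc k := undefined)) j = undefined" if "j \<notin> {1..k}" for j
    proof (cases "j = Suc k")
      case False
      then have "j \<notin> {1..Suc k}"
        using that by auto
      then show ?thesis
        using i False unfolding mem_multi_indices_iff by simp
    qed simp
    then have "i(Suc k := undefined) \<in> multi_indices k (a - i (Suc k))"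
      using sum[OF i] sum_upd[of i undefined] unfolding mem_multi_indices_iff by simp
    then show "x \<in> (SIGMA l:{..a}. multi_indices k l)"
      unfolding x by simp
  qed
qed

lemma finite_multi_indices: "finite (multi_indices k a)"
  unfolding multi_indices_def
  by (rule finite_subset[of _ "{1..k} \<rightarrow>\<^sub>E {0..a}"]) (auto intro: finite_PiE)

lemma repeat_args_Suc: "repeat_args (Suc k) i us = repeat_args k i us @ replicate (i (Suc k)) (us (Suc k))"
  unfolding repeat_args_def by simp

lemma repeat_args_cong:
  "(\<And>j. j \<in> {1..k} \<Longrightarrow> i j = i' j) \<Longrightarrow> (\<And>j. j \<in> {1..k} \<Longrightarrow> us j = us' j)
     \<Longrightarrow> repeat_args k i us = repeat_args k i' us'"
  unfolding repeat_args_def by (rule arg_cong[of _ _ concat], rule map_cong) auto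

lemma set_repeat_args: "set (repeat_args k i us) \<subseteq> us ` {1..k}"
  unfolding repeat_args_def by auto

lemma length_repeat_args: "length (repeat_args k i us) = (\<Sum>j=1..k. i j)"
  by (induction k) (simp_all add: repeat_args_Suc, simp add: repeat_args_def)

lemma map_repeat_args: "map h (repeat_args k i us) = repeat_args k i (\<lambda>j. h (us j))"
  unfolding repeat_args_def by (simp add: map_concat comp_def)

lemma multinomial_Suc:
  assumes "i \<in> multi_indices k l" "l \<le> a"
  shows "multinomial a (Suc k) (i(Suc k := a - l)) = real (a choose l) * multinomial l k i"
proof -
  have "(\<Prod>j=1..k. fact ((i(Suc k := a - l)) j) :: real) = (\<Prod>j=1..k. fact (i j))"
    by (rule prod.cong) auto
  then show ?thesis
    using assms(2) unfolding multinomial_def by (simp add: binomial_fact)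
qed

context homogeneous_polynomial_map
begin

text \<open>The last summand is split off by the binomial expansion; its copies become passive
  arguments, and the product of binomial and multinomial coefficients is the next multinomial
  coefficient.\<close>

lemma polar_multinomial:
  assumes "a + length ys = m" "\<And>j. j \<in> {1..k} \<Longrightarrow> x j \<in> C" "set ys \<subseteq> C"
  shows "polar (replicate a (\<Sum>j=1..k. x j) @ ys)
    = (\<Sum>i\<in>multi_indices k a. multinomial a k i * polar (repeat_args k i x @ ys))"
  using assms
proof (induction k arbitrary: a ys)
  case 0
  show ?case
  proof (cases a)
    case 0
    \<comment> \<open>For k = 0 there is one empty multi-index when a = 0 and none when a > 0; in
      the latter case an argument 0 makes the left side vanish.\<close>
    have "multi_indices 0 0 = {\<lambda>_. undefined}"
      unfolding multi_indices_def by (auto simp: PiE_iff extensional_def)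
    then show ?thesis
      using 0 by (simp add: multinomial_def repeat_args_def)
  next
    case (Suc b)
    have "multi_indices 0 a = {}"
      unfolding multi_indices_def using Suc by simp
    then show ?thesis
      using Suc 0 polar_zero[of "[]" "replicate b 0 @ ys"] zero_in
      by (auto simp: set_replicate_conv_if)
  qed
next
  case (Suc k)
  let ?s = "\<Sum>j=1..k. x j" and ?y = "x (Suc k)"
  have sC: "?s \<in> C"
  proof -
    have "(\<Sum>j\<in>A. x j) \<in> C" if "finite A" "A \<subseteq> {1..k}" for A
      using that by (induction A rule: finite_induct) (use Suc.prems(2) zero_in add_in in auto)
    then show ?thesis
      by simp
  qed
  have "polar (replicate a (\<Sum>j=1..Suc k. x j) @ ys)
      = (\<Sum>l\<le>a. real (a choose l) * polar (replicate l ?s @ replicate (a - l) ?y @ ys))"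
    using polar_binomial[OF Suc.prems(1) sC Suc.prems(2) Suc.prems(3), of "Suc k"] by simp
  also have "\<dots> = (\<Sum>l\<le>a. real (a choose l) *
      (\<Sum>i\<in>multi_indices k l. multinomial l k i * polar (repeat_args k i x @ replicate (a - l) ?y @ ys)))"
    using Suc.prems by (intro sum.cong refl arg_cong2[of _ _ _ _ "(*)"] Suc.IH) auto
  also have "\<dots> = (\<Sum>l\<le>a. \<Sum>i\<in>multi_indices k l.
      multinomial a (Suc k) (i(Suc k := a - l)) * polar (repeat_args (Suc k) (i(Suc k := a - l)) x @ ys))"
    unfolding sum_distrib_left
  proof (intro sum.cong refl)
    fix l i assume l: "l \<in> {..a}" and i: "i \<in> multi_indices k l"
    have "repeat_args k (i(Suc k := a - l)) x = repeat_args k i x"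
      by (rule repeat_args_cong) auto
    then show "real (a choose l) * (multinomial l k i * polar (repeat_args k i x @ replicate (a - l) ?y @ ys))
      = multinomial a (Suc k) (i(Suc k := a - l)) * polar (repeat_args (Suc k) (i(Suc k := a - l)) x @ ys)"
      using l multinomial_Suc[OF i] by (simp add: repeat_args_Suc)
  qed
  also have "\<dots> = (\<Sum>(l, i)\<in>(SIGMA l:{..a}. multi_indices k l).
      multinomial a (Suc k) (i(Suc k := a - l)) * polar (repeat_args (Suc k) (i(Suc k := a - l)) x @ ys))"
    by (rule sum.Sigma) (auto simp: finite_multi_indices)
  also have "\<dots> = (\<Sum>i\<in>multi_indices (Suc k) a. multinomial a (Suc k) i * polar (repeat_args (Suc k) i x @ ys))"
    by (rule trans[OF sum.cong[OF refl] sum.reindex_bij_betw[OF multi_indices_Suc_bij]]) (simp only: split_beta)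
  finally show ?case .
qed

end

section \<open>Convex conjugates\<close>

text \<open>The Legendre transform has two versions, \<open>dual\<close> from finite to extended
  functions and \<open>rdual\<close> back, so that addition takes place among real-valued
  functions.\<close>

definition dual :: "('a::euclidean_space \<Rightarrow> real) \<Rightarrow> 'a \<Rightarrow> ereal" where
  "dual f y = (SUP x. ereal (x \<bullet> y - f x))"

text \<open>The supremum is finite for \<open>u \<in> Conv_sc\<close>; otherwise \<open>rdual\<close> may be a junk value.\<close>

definition rdual :: "('a::euclidean_space \<Rightarrow> ereal) \<Rightarrow> 'a \<Rightarrow> real" where
  "rdual u y = real_of_ereal (SUP x. ereal (x \<bullet> y) - u x)"

text \<open>Continuous convergence, the notion for finite convex functions that conjugation
  exchanges with epi-convergence.\<close>

definition cont_converges :: "(nat \<Rightarrow> 'a::topological_space \<Rightarrow> real) \<Rightarrow> ('a \<Rightarrow> real) \<Rightarrow> bool" where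
  "cont_converges fs f \<longleftrightarrow> (\<forall>x xs. xs \<longlonglongrightarrow> x \<longrightarrow> (\<lambda>k. fs k (xs k)) \<longlonglongrightarrow> f x)"

text \<open>Real upper bounds determine an extended real. For a conjugate such bounds mean affine
  minorants of the function, which makes this the convenient way to compare conjugates.\<close>

lemma eq_ereal_by_real_bounds:
  assumes "\<And>s. a \<le> ereal s \<longleftrightarrow> b \<le> ereal s"
  shows "a = b"
proof (rule antisym)
  show "a \<le> b"
    by (rule ereal_le_real) (simp only: assms simp_thms)
  show "b \<le> a"
    by (rule ereal_le_real) (simp only: assms simp_thms)
qed

lemma ereal_not_le_realE:
  assumes "\<not> a \<le> ereal s"
  obtains c where "s < c" "ereal c < a"
proof -
  have "ereal s < a"
    using assms by simp
  then obtain c where "ereal s < ereal c" "ereal c < a"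
    using ereal_dense2 by blast
  then show ?thesis
    using that by simp
qed

lemma dual_le_iff: "dual f y \<le> ereal c \<longleftrightarrow> (\<forall>x. x \<bullet> y - c \<le> f x)"
  unfolding dual_def SUP_le_iff by (auto simp: algebra_simps)

lemma dual_ge: "ereal (x \<bullet> y - f x) \<le> dual f y"
  unfolding dual_def by (rule SUP_upper) simp

lemma dual_not_MInf: "dual f y \<noteq> - \<infinity>"
  using dual_ge[of 0 y f] by auto

section \<open>Lower semicontinuity and growth\<close>

lemma lower_semicontinuous_eventually:
  assumes "lower_semicontinuous u" "c < u x"
  shows "eventually (\<lambda>y. c < u y) (nhds x)"
proof -
  have "c < Liminf (at x) u"
    using assms unfolding lower_semicontinuous_def by (meson less_le_trans)
  then have "eventually (\<lambda>y. c < u y) (at x)"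
    by (rule less_LiminfD)
  then show ?thesis
    using assms(2) by (simp add: eventually_nhds_conv_at)
qed

lemma lower_semicontinuousI:
  assumes "\<And>x c. c < u x \<Longrightarrow> eventually (\<lambda>y. c < u y) (nhds x)"
  shows "lower_semicontinuous u"
  unfolding lower_semicontinuous_def le_Liminf_iff
  using assms by (auto simp: eventually_nhds_conv_at)

lemma closed_sublevel_lsc:
  fixes l :: "'a::topological_space \<Rightarrow> real"
  assumes "lower_semicontinuous u" "continuous_on UNIV l"
  shows "closed {x. u x \<le> ereal (l x)}"
proof -
  have "\<exists>T. open T \<and> x \<in> T \<and> T \<subseteq> - {x. u x \<le> ereal (l x)}" if nle: "\<not> u x \<le> ereal (l x)" for x
  proof -
    obtain c where c: "l x < c" "ereal c < u x"
      using ereal_not_le_realE[OF nle] by blast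
    have "(l \<longlongrightarrow> l x) (at x)"
      using assms(2) by (simp add: continuous_on_def)
    then have "eventually (\<lambda>y. l y < c) (at x)"
      using c(1) by (intro order_tendstoD) auto
    then have "eventually (\<lambda>y. l y < c) (nhds x)"
      using c(1) by (simp add: eventually_nhds_conv_at)
    with lower_semicontinuous_eventually[OF assms(1) c(2)]
    have "eventually (\<lambda>y. l y < c \<and> ereal c < u y) (nhds x)"
      by (rule eventually_conj[rotated])
    then obtain T where "open T" "x \<in> T" "\<forall>y\<in>T. l y < c \<and> ereal c < u y"
      unfolding eventually_nhds by blast
    moreover have "\<not> u y \<le> ereal (l y)" if "l y < c" "ereal c < u y" for y
      using that by (metis less_ereal.simps(1) not_less_iff_gr_or_eq not_le order.strict_trans)
    ultimately show ?thesis
      by (intro exI[of _ T]) auto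
  qed
  then have "open (- {x. u x \<le> ereal (l x)})"
    by (subst open_subopen) blast
  then show ?thesis
    by (simp add: closed_def)
qed

lemma lsc_bounded_below_on_compact:
  fixes u :: "'a::metric_space \<Rightarrow> ereal"
  assumes lsc: "lower_semicontinuous u" and "\<And>x. u x \<noteq> - \<infinity>" and "compact K"
  obtains M where "\<And>x. x \<in> K \<Longrightarrow> ereal (- M) \<le> u x"
proof -
  have "\<exists>M. \<forall>x\<in>K. ereal (- M) \<le> u x"
  proof (rule ccontr)
    assume "\<not> ?thesis"
    then have "\<forall>k::nat. \<exists>x\<in>K. u x < ereal (- real k)"
      by (meson not_le)
    then obtain xs where xs: "\<And>k. xs k \<in> K" "\<And>k. u (xs k) < ereal (- real k)"
      by metis
    obtain x r where xr: "x \<in> K" "strict_mono r" "(xs \<circ> r) \<longlonglongrightarrow> x"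
      using \<open>compact K\<close> xs(1) unfolding compact_def by meson
    obtain c where c: "ereal c < u x"
      using assms(2)[of x] ereal_dense2[of "-\<infinity>" "u x"] by auto
    have "eventually (\<lambda>k. ereal c < u ((xs \<circ> r) k)) sequentially"
      using lower_semicontinuous_eventually[OF lsc c] xr(3) unfolding filterlim_iff by blast
    moreover have "eventually (\<lambda>k::nat. - c \<le> real k) sequentially"
      using filterlim_real_sequentially unfolding filterlim_at_top by blast
    ultimately have "eventually (\<lambda>k::nat. False) sequentially"
    proof eventually_elim
      case (elim k)
      have "ereal c < u (xs (r k))"
        using elim(1) by simp
      then have "ereal c < ereal (- real (r k))"
        using xs(2) by (rule less_trans)
      moreover have "real k \<le> real (r k)"
        using seq_suble[OF xr(2)] by simp
      ultimately show False
        using elim(2) by simp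
    qed
    then show False
      by simp
  qed
  then show ?thesis
    using that by blast
qed

lemma Conv_scD:
  assumes "u \<in> Conv_sc"
  shows "u x \<noteq> - \<infinity>" "convex_ereal u" "lower_semicontinuous u" "\<exists>x. u x \<noteq> \<infinity>" "super_coercive u"
  using assms unfolding Conv_sc_def Conv_def by auto

text \<open>Super-coercivity gives the bound outside a ball, compactness inside. Slope
  \<open>norm y\<close> makes the conjugate finite at \<open>y\<close>; slope
  \<open>norm y + 1\<close> later rules out that mass escapes to infinity.\<close>

lemma Conv_sc_linear_growth:
  fixes u :: "'a::euclidean_space \<Rightarrow> ereal"
  assumes u: "u \<in> Conv_sc"
  obtains M where "\<And>x. ereal (C * norm x - M) \<le> u x" "M \<ge> 0"
proof -
  have "eventually (\<lambda>x. ereal C < u x / ereal (norm x)) at_infinity"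
    using Conv_scD(5)[OF u] unfolding super_coercive_def tendsto_PInfty by blast
  then obtain b where b: "\<And>x. norm x \<ge> b \<Longrightarrow> ereal C < u x / ereal (norm x)"
    unfolding eventually_at_infinity by blast
  \<comment> \<open>A radius of at least 1 keeps \<open>norm x\<close> positive outside the ball, so
    the quotient can be cleared.\<close>
  define b' where "b' = max b 1"
  obtain M0 where M0: "\<And>x. x \<in> cball 0 b' \<Longrightarrow> ereal (- M0) \<le> u x"
    using lsc_bounded_below_on_compact[OF Conv_scD(3)[OF u] Conv_scD(1)[OF u] compact_cball[of 0 b']]
    by blast
  have "ereal (C * norm x - (\<bar>C\<bar> * b' + \<bar>M0\<bar>)) \<le> u x" for x
  proof (cases "norm x \<le> b'")
    case True
    have "C * norm x \<le> \<bar>C\<bar> * norm x"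
      by (intro mult_right_mono) auto
    also have "\<dots> \<le> \<bar>C\<bar> * b'"
      using True by (intro mult_left_mono) auto
    finally have "C * norm x \<le> \<bar>C\<bar> * b'" .
    then have "ereal (C * norm x - (\<bar>C\<bar> * b' + \<bar>M0\<bar>)) \<le> ereal (- M0)"
      by simp
    also have "\<dots> \<le> u x"
      using True by (intro M0) simp
    finally show ?thesis .
  next
    case False
    then have "norm x \<ge> b" "norm x > 0"
      unfolding b'_def by auto
    then have "ereal C < u x / ereal (norm x)"
      using b by blast
    then have "ereal (C * norm x) \<le> u x"
      using \<open>norm x > 0\<close> by (cases "u x") (auto simp: field_simps)
    moreover have "\<bar>C\<bar> * b' \<ge> 0"
      unfolding b'_def by (intro mult_nonneg_nonneg) auto
    then have "C * norm x - (\<bar>C\<bar> * b' + \<bar>M0\<bar>) \<le> C * norm x"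
      by linarith
    ultimately show ?thesis
      by (meson ereal_less_eq(3) order_trans)
  qed
  moreover have "\<bar>C\<bar> * b' + \<bar>M0\<bar> \<ge> 0"
    unfolding b'_def by auto
  ultimately show ?thesis
    using that by blast
qed

text \<open>The supremum in \<open>rdual\<close> is a real number: growth with slope
  \<open>norm y\<close> and the Cauchy-Schwarz inequality bound it above, a point where
  \<open>u\<close> is finite bounds it below. Hence \<open>real_of_ereal\<close> loses
  nothing.\<close>

lemma rdual_le_iff:
  assumes u: "u \<in> Conv_sc"
  shows "rdual u y \<le> c \<longleftrightarrow> (\<forall>x. ereal (x \<bullet> y - c) \<le> u x)"
proof -
  let ?S = "SUP x. ereal (x \<bullet> y) - u x"
  have le: "?S \<le> ereal c \<longleftrightarrow> (\<forall>x. ereal (x \<bullet> y - c) \<le> u x)" for c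
  proof -
    have "ereal (x \<bullet> y) - u x \<le> ereal c \<longleftrightarrow> ereal (x \<bullet> y - c) \<le> u x" for x
      using Conv_scD(1)[OF u, of x] by (cases "u x") auto
    then show ?thesis
      by (simp add: SUP_le_iff)
  qed
  obtain M where M: "\<And>x. ereal (norm y * norm x - M) \<le> u x"
    using Conv_sc_linear_growth[OF u] by blast
  have "ereal (x \<bullet> y - M) \<le> u x" for x
  proof -
    have "ereal (x \<bullet> y - M) \<le> ereal (norm y * norm x - M)"
      using norm_cauchy_schwarz[of x y] by (simp add: mult.commute)
    then show ?thesis
      using M[of x] by (rule order_trans)
  qed
  then have "?S \<le> ereal M"
    using le by blast
  moreover obtain x where "u x \<noteq> \<infinity>"
    using Conv_scD(4)[OF u] by blast
  then have "?S \<noteq> - \<infinity>"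
    using SUP_upper[of x UNIV "\<lambda>x. ereal (x \<bullet> y) - u x"] Conv_scD(1)[OF u, of x]
    by (cases "u x") auto
  ultimately have "ereal (rdual u y) = ?S"
    unfolding rdual_def by (cases ?S) auto
  then have "rdual u y \<le> c \<longleftrightarrow> ?S \<le> ereal c"
    by (simp flip: ereal_less_eq(3))
  with le[of c] show ?thesis
    by (rule trans[rotated])
qed

lemma rdual_ge: "u \<in> Conv_sc \<Longrightarrow> ereal (x \<bullet> y - rdual u y) \<le> u x"
  using rdual_le_iff by blast

section \<open>Separation and biconjugation\<close>

lemma convex_on_rdual:
  assumes u: "u \<in> Conv_sc"
  shows "convex_on UNIV (rdual u)"
proof (rule convex_onI)
  fix t :: real and y z :: 'a assume t: "0 < t" "t < 1"
  show "rdual u ((1 - t) *\<^sub>R y + t *\<^sub>R z) \<le> (1 - t) * rdual u y + t * rdual u z"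
    unfolding rdual_le_iff[OF u]
  proof
    fix x
    show "ereal (x \<bullet> ((1 - t) *\<^sub>R y + t *\<^sub>R z) - ((1 - t) * rdual u y + t * rdual u z)) \<le> u x"
    proof (cases "u x")
      case (real r)
      have "(1 - t) * (x \<bullet> y - rdual u y) + t * (x \<bullet> z - rdual u z) \<le> (1 - t) * r + t * r"
        using rdual_ge[OF u, of x y] rdual_ge[OF u, of x z] real t
        by (intro add_mono mult_left_mono) auto
      then show ?thesis
        using real by (simp add: inner_right_distrib algebra_simps)
    qed (use Conv_scD(1)[OF u, of x] in auto)
  qed
qed auto

text \<open>A hyperplane separates the strict epigraph of \<open>f\<close> from \<open>T\<close>. It
  is the graph of an affine function because \<open>f\<close> is finite on the whole space, which
  excludes vertical hyperplanes. Subgradients, biconjugation and the splitting of conjugates of sums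
  all arise from suitable sets \<open>T\<close>.\<close>

lemma convex_affine_separation:
  fixes f :: "'a::euclidean_space \<Rightarrow> real"
  assumes f: "convex_on UNIV f" and T: "convex T" "T \<noteq> {}"
    and below: "\<And>y t. (y, t) \<in> T \<Longrightarrow> t \<le> f y"
  obtains a b where "\<And>y. a \<bullet> y + b \<le> f y" "\<And>y t. (y, t) \<in> T \<Longrightarrow> t \<le> a \<bullet> y + b"
proof -
  let ?S = "{p. f (fst p) < snd p}"
  have conv: "convex ?S"
  proof (rule convexI)
    fix p q :: "'a \<times> real" and c d :: real
    assume pq: "p \<in> ?S" "q \<in> ?S" and cd: "0 \<le> c" "0 \<le> d" "c + d = 1"
    have "f (c *\<^sub>R fst p + d *\<^sub>R fst q) \<le> c * f (fst p) + d * f (fst q)"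
      using convex_onD[OF f, of d "fst p" "fst q"] cd by (simp add: eq_diff_eq[symmetric])
    also have "\<dots> < c * snd p + d * snd q"
    proof (cases "c = 0")
      case False
      then have "c * f (fst p) < c * snd p" "d * f (fst q) \<le> d * snd q"
        using cd pq by (auto intro: mult_left_mono)
      then show ?thesis
        by linarith
    qed (use cd pq in auto)
    finally show "c *\<^sub>R p + d *\<^sub>R q \<in> ?S"
      by simp
  qed
  have "(0, f 0 + 1) \<in> ?S"
    by simp
  then have ne: "?S \<noteq> {}"
    by blast
  have disj: "?S \<inter> T = {}"
    using below by force
  obtain n d where n: "n \<noteq> 0" "\<forall>p\<in>?S. n \<bullet> p \<le> d" "\<forall>p\<in>T. d \<le> n \<bullet> p"
    using separating_hyperplane_sets[OF conv T(1) ne T(2) disj] by blast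
  obtain p q where pq: "n = (p, q)"
    by (cases n)
  have S: "p \<bullet> y + q * t \<le> d" if "f y < t" for y t
    using bspec[OF n(2), of "(y, t)"] that by (simp add: pq)
  \<comment> \<open>If \<open>q\<close> were nonnegative, \<open>p\<close> would be a linear form
    bounded above and hence 0; then \<open>q\<close> would be positive and the strict epigraph
    unbounded in the direction of the normal.\<close>
  have "q < 0"
  proof (rule ccontr)
    assume "\<not> q < 0"
    have "p \<bullet> y \<le> d - q * (\<bar>f y\<bar> + 1)" for y
    proof -
      have "f y < \<bar>f y\<bar> + 1"
        by linarith
      from S[OF this] show ?thesis
        by linarith
    qed
    then have le: "p \<bullet> y \<le> d" for y
      using \<open>\<not> q < 0\<close> by (smt (verit) mult_nonneg_nonneg abs_ge_zero)
    have "p = 0"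
    proof (rule ccontr)
      assume "p \<noteq> 0"
      then have "p \<bullet> p > 0"
        by simp
      then have "p \<bullet> (((\<bar>d\<bar> + 1) / (p \<bullet> p)) *\<^sub>R p) = \<bar>d\<bar> + 1"
        by simp
      then show False
        using le[of "((\<bar>d\<bar> + 1) / (p \<bullet> p)) *\<^sub>R p"] by linarith
    qed
    then have "q > 0"
      using n(1) pq \<open>\<not> q < 0\<close> by (simp add: zero_prod_def)
    then show False
      \<comment> \<open>A height above \<open>f 0\<close> at which \<open>q\<close> times the height
        is at least \<open>\<bar>d\<bar> + q\<close>, hence larger than \<open>d\<close>.\<close>
      using S[of 0 "max (f 0 + 1) (\<bar>d\<bar> / q + 1)"] \<open>p = 0\<close>
      by (smt (verit) inner_zero_left max.cobounded1 max.cobounded2 mult_left_mono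
          nonzero_mult_div_cancel_left times_divide_eq_right distrib_left mult_cancel_left1)
  qed
  \<comment> \<open>The equation of the hyperplane is solved for the vertical coordinate.\<close>
  show ?thesis
  proof (rule that[of "(- 1 / q) *\<^sub>R p" "d / q"])
    fix y
    have "(d - p \<bullet> y) / q \<le> t" if "f y < t" for t
      using S[OF that] \<open>q < 0\<close> by (simp add: divide_simps algebra_simps)
    then have "(d - p \<bullet> y) / q \<le> f y"
      by (rule dense_ge)
    then show "((- 1 / q) *\<^sub>R p) \<bullet> y + d / q \<le> f y"
      by (simp add: diff_divide_distrib)
  next
    fix y t assume "(y, t) \<in> T"
    then have "d \<le> p \<bullet> y + q * t"
      using bspec[OF n(3), of "(y, t)"] pq by simp
    then have "t \<le> (d - p \<bullet> y) / q"
      using \<open>q < 0\<close> by (simp add: divide_simps algebra_simps)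
    then show "t \<le> ((- 1 / q) *\<^sub>R p) \<bullet> y + d / q"
      by (simp add: diff_divide_distrib)
  qed
qed

lemma convex_subgradient:
  fixes f :: "'a::euclidean_space \<Rightarrow> real"
  assumes "convex_on UNIV f"
  obtains a where "\<And>y. f x + a \<bullet> (y - x) \<le> f y"
proof -
  obtain a b where ab: "\<And>y. a \<bullet> y + b \<le> f y" "f x \<le> a \<bullet> x + b"
    using convex_affine_separation[OF assms, of "{(x, f x)}"] by auto
  have "f x + a \<bullet> (y - x) \<le> f y" for y
    using ab(1)[of y] ab(2) by (simp add: inner_diff_right)
  then show ?thesis
    by (rule that)
qed

lemma convex_continuous: "convex_on UNIV f \<Longrightarrow> continuous_on UNIV f"
  for f :: "'a::euclidean_space \<Rightarrow> real"
  by (rule convex_on_continuous) auto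

text \<open>Finiteness of \<open>f\<close> is what makes the conjugate super-coercive:
  \<open>f\<close> is bounded on every ball, and testing with a vector of length R in the direction
  of \<open>y\<close> gives growth of slope R. A subgradient at 0 is a point where the conjugate is
  finite.\<close>

lemma dual_in_Conv_sc:
  fixes f :: "'a::euclidean_space \<Rightarrow> real"
  assumes f: "convex_on UNIV f"
  shows "dual f \<in> Conv_sc"
proof -
  have "convex_ereal (dual f)"
    unfolding convex_ereal_def
  proof (intro allI impI)
    fix x y :: 'a and t :: real assume t: "0 < t \<and> t < 1"
    show "dual f ((1 - t) *\<^sub>R x + t *\<^sub>R y) \<le> ereal (1 - t) * dual f x + ereal t * dual f y"
    proof (cases "dual f x = \<infinity> \<or> dual f y = \<infinity>")
      case True
      have "ereal (1 - t) * dual f x \<noteq> - \<infinity>" "ereal t * dual f y \<noteq> - \<infinity>"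
        using t dual_not_MInf[of f x] dual_not_MInf[of f y]
        by (cases "dual f x"; cases "dual f y"; simp)+
      moreover have "ereal (1 - t) * dual f x = \<infinity> \<or> ereal t * dual f y = \<infinity>"
        using True t by auto
      ultimately have "ereal (1 - t) * dual f x + ereal t * dual f y = \<infinity>"
        by auto
      then show ?thesis
        by (metis ereal_less_eq(1))
    next
      case False
      then obtain a b where ab: "dual f x = ereal a" "dual f y = ereal b"
        using dual_not_MInf by (metis ereal_cases)
      have "z \<bullet> ((1 - t) *\<^sub>R x + t *\<^sub>R y) - ((1 - t) * a + t * b) \<le> f z" for z
      proof -
        have "(1 - t) * (z \<bullet> x - a) + t * (z \<bullet> y - b) \<le> (1 - t) * f z + t * f z"
          using ab t dual_le_iff[of f x a] dual_le_iff[of f y b]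
          by (intro add_mono mult_left_mono) auto
        then show ?thesis
          by (simp add: inner_right_distrib algebra_simps)
      qed
      then have "dual f ((1 - t) *\<^sub>R x + t *\<^sub>R y) \<le> ereal ((1 - t) * a + t * b)"
        by (simp add: dual_le_iff)
      then show ?thesis
        by (simp add: ab)
    qed
  qed
  moreover have "lower_semicontinuous (dual f)"
  proof (rule lower_semicontinuousI)
    fix y c assume "c < dual f y"
    then obtain x where x: "c < ereal (x \<bullet> y - f x)"
      unfolding dual_def less_SUP_iff by blast
    have "((\<lambda>z. ereal (x \<bullet> z - f x)) \<longlongrightarrow> ereal (x \<bullet> y - f x)) (nhds y)"
      by (intro tendsto_intros filterlim_ident)
    then have "eventually (\<lambda>z. c < ereal (x \<bullet> z - f x)) (nhds y)"
      using x by (rule order_tendstoD)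
    then show "eventually (\<lambda>z. c < dual f z) (nhds y)"
      by (rule eventually_mono) (meson dual_ge less_le_trans)
  qed
  moreover have "\<exists>y. dual f y \<noteq> \<infinity>"
  proof -
    obtain a where "\<And>y. f 0 + a \<bullet> (y - 0) \<le> f y"
      using convex_subgradient[OF f] by blast
    then have "dual f a \<le> ereal (- f 0)"
      by (simp add: dual_le_iff inner_commute add.commute)
    then have "dual f a \<noteq> \<infinity>"
      by auto
    then show ?thesis
      by blast
  qed
  moreover have "super_coercive (dual f)"
    unfolding super_coercive_def tendsto_PInfty
  proof
    fix r :: real
    \<comment> \<open>The surplus slope 1 over \<open>r\<close> absorbs the bound \<open>M\<close>
      of \<open>f\<close> on the ball as soon as \<open>norm y\<close> exceeds
      \<open>\<bar>M\<bar>\<close>.\<close>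
    define R where "R = \<bar>r\<bar> + 1"
    have "compact (f ` cball 0 R)"
      by (intro compact_continuous_image continuous_on_subset[OF convex_continuous[OF f]]) auto
    then obtain M where M: "\<And>x. norm x \<le> R \<Longrightarrow> f x \<le> M"
      using compact_imp_bounded[THEN bounded_imp_bdd_above] unfolding bdd_above_def by force
    show "eventually (\<lambda>y. ereal r < dual f y / ereal (norm y)) at_infinity"
      unfolding eventually_at_infinity
    proof (intro exI allI impI)
      fix y :: 'a assume y: "\<bar>M\<bar> + 1 \<le> norm y"
      then have pos: "norm y > 0"
        by linarith
      have "ereal (((R / norm y) *\<^sub>R y) \<bullet> y - f ((R / norm y) *\<^sub>R y)) \<le> dual f y"
        by (rule dual_ge)
      moreover have "f ((R / norm y) *\<^sub>R y) \<le> M"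
        using pos by (intro M) (simp add: R_def)
      moreover have "((R / norm y) *\<^sub>R y) \<bullet> y = R * norm y"
        using pos by (simp add: power2_norm_eq_inner[symmetric] power2_eq_square)
      ultimately have "ereal (R * norm y - M) \<le> dual f y"
        by (smt (verit) ereal_less_eq(3) order_trans)
      moreover have "r * norm y < R * norm y - M"
      proof -
        have "r * norm y \<le> (R - 1) * norm y"
          using pos by (intro mult_right_mono) (auto simp: R_def)
        then show ?thesis
          using y by (simp add: algebra_simps)
      qed
      ultimately have "ereal (r * norm y) < dual f y"
        by (meson ereal_less(2) less_ereal.simps(1) less_le_trans)
      then show "ereal r < dual f y / ereal (norm y)"
        using pos by (cases "dual f y") (auto simp: field_simps)
    qed
  qed
  ultimately show ?thesis
    unfolding Conv_sc_def Conv_def using dual_not_MInf by blast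
qed

text \<open>Biconjugation on the finite side: at a subgradient of \<open>f\<close> at
  \<open>y\<close> the inequality of Fenchel is an equality.\<close>

lemma rdual_dual:
  fixes f :: "'a::euclidean_space \<Rightarrow> real"
  assumes f: "convex_on UNIV f"
  shows "rdual (dual f) = f"
proof
  fix y
  note sc = dual_in_Conv_sc[OF f]
  show "rdual (dual f) y = f y"
  proof (rule antisym)
    show "rdual (dual f) y \<le> f y"
      unfolding rdual_le_iff[OF sc] using dual_ge[of y _ f] by (simp add: inner_commute)
    obtain a where "\<And>x. f y + a \<bullet> (x - y) \<le> f x"
      using convex_subgradient[OF f] by blast
    then have "dual f a \<le> ereal (a \<bullet> y - f y)"
      by (simp add: dual_le_iff inner_diff_right inner_commute algebra_simps)
    with rdual_ge[OF sc, of a y] have "ereal (a \<bullet> y - rdual (dual f) y) \<le> ereal (a \<bullet> y - f y)"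
      by (rule order_trans)
    then show "f y \<le> rdual (dual f) y"
      by simp
  qed
qed

lemma convex_on_quadratic:
  fixes x0 :: "'a::real_inner"
  assumes "l \<ge> 0"
  shows "convex_on UNIV (\<lambda>x. l * ((x - x0) \<bullet> (x - x0)) + b)"
proof (rule convex_onI)
  fix t :: real and x y :: 'a assume t: "0 < t" "t < 1"
  have "(1 - t) * ((x - x0) \<bullet> (x - x0)) + t * ((y - x0) \<bullet> (y - x0))
      - ((1 - t) *\<^sub>R x + t *\<^sub>R y - x0) \<bullet> ((1 - t) *\<^sub>R x + t *\<^sub>R y - x0)
      = t * (1 - t) * ((x - y) \<bullet> (x - y))"
    by (simp add: inner_diff_left inner_diff_right inner_add_left inner_add_right inner_commute algebra_simps)
  also have "\<dots> \<ge> 0"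
    using t by (intro mult_nonneg_nonneg) auto
  finally have "l * (((1 - t) *\<^sub>R x + t *\<^sub>R y - x0) \<bullet> ((1 - t) *\<^sub>R x + t *\<^sub>R y - x0))
      \<le> l * ((1 - t) * ((x - x0) \<bullet> (x - x0)) + t * ((y - x0) \<bullet> (y - x0)))"
    using assms by (intro mult_left_mono) auto
  then show "l * (((1 - t) *\<^sub>R x + t *\<^sub>R y - x0) \<bullet> ((1 - t) *\<^sub>R x + t *\<^sub>R y - x0)) + b
      \<le> (1 - t) * (l * ((x - x0) \<bullet> (x - x0)) + b) + t * (l * ((y - x0) \<bullet> (y - x0)) + b)"
    by (simp add: algebra_simps)
qed auto

text \<open>Biconjugation on the extended side. The separation lemma needs a finite convex function
  and \<open>u\<close> may be infinite, so the epigraph of \<open>u\<close> is separated from a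
  downward paraboloid that lies below \<open>u\<close> and has height \<open>c\<close> at
  \<open>x0\<close>; the separating affine function minorizes \<open>u\<close> and is at least
  \<open>c\<close> at \<open>x0\<close>.\<close>

lemma dual_rdual:
  fixes u :: "'a::euclidean_space \<Rightarrow> ereal"
  assumes u: "u \<in> Conv_sc"
  shows "dual (rdual u) = u"
proof
  fix x0
  show "dual (rdual u) x0 = u x0"
  proof (rule antisym)
    show "dual (rdual u) x0 \<le> u x0"
      unfolding dual_def using rdual_ge[OF u, of x0] by (intro SUP_least) (simp add: inner_commute)
    show "u x0 \<le> dual (rdual u) x0"
    proof (rule ereal_le_real)
      fix s assume s: "dual (rdual u) x0 \<le> ereal s"
      show "u x0 \<le> ereal s"
      proof (rule ccontr)
        assume "\<not> u x0 \<le> ereal s"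
        then obtain c where c: "s < c" "ereal c < u x0"
          by (rule ereal_not_le_realE)
        obtain d where d: "d > 0" "\<And>x. dist x x0 < d \<Longrightarrow> ereal c < u x"
          using lower_semicontinuous_eventually[OF Conv_scD(3)[OF u] c(2)]
          unfolding eventually_nhds_metric by blast
        obtain M where M: "\<And>x. ereal (0 * norm x - M) \<le> u x"
          using Conv_sc_linear_growth[OF u] by blast
        \<comment> \<open>With this curvature the paraboloid has dropped to at most
          \<open>- M\<close>, the global lower bound of \<open>u\<close>, at distance
          \<open>d\<close> from \<open>x0\<close>.\<close>
        define l where "l = (\<bar>c\<bar> + \<bar>M\<bar>) / d\<^sup>2"
        have "l \<ge> 0"
          by (simp add: l_def)
        have below: "ereal (c - l * ((x - x0) \<bullet> (x - x0))) \<le> u x" for x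
        proof (cases "dist x x0 < d")
          case True
          have "ereal (c - l * ((x - x0) \<bullet> (x - x0))) \<le> ereal c"
            using \<open>l \<ge> 0\<close> by simp
          also have "\<dots> \<le> u x"
            using d(2)[OF True] by simp
          finally show ?thesis .
        next
          case False
          then have "d\<^sup>2 \<le> (x - x0) \<bullet> (x - x0)"
            using d(1) by (simp add: power2_norm_eq_inner[symmetric] dist_norm power_mono)
          then have "l * d\<^sup>2 \<le> l * ((x - x0) \<bullet> (x - x0))"
            using \<open>l \<ge> 0\<close> by (rule mult_left_mono)
          moreover have "l * d\<^sup>2 = \<bar>c\<bar> + \<bar>M\<bar>"
            using d(1) by (simp add: l_def)
          ultimately have "c - l * ((x - x0) \<bullet> (x - x0)) \<le> - M"
            by linarith
          then show ?thesis
            using M[of x] by (metis ereal_less_eq(3) order_trans mult_zero_left diff_0)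
        qed
        \<comment> \<open>Everything is reflected vertically: the separation lemma puts
          \<open>T\<close> below the convex function, so \<open>T\<close> is the reflected epigraph.
          The sign of the slope \<open>a\<close> is reversed below for the same reason.\<close>
        define T where "T = {(x, t). u x \<le> ereal (- t)}"
        have "convex T"
        proof (rule convexI)
          fix p q :: "'a \<times> real" and \<alpha> \<beta> :: real
          assume pq: "p \<in> T" "q \<in> T" and ab: "0 \<le> \<alpha>" "0 \<le> \<beta>" "\<alpha> + \<beta> = 1"
          obtain x t y r where xy: "p = (x, t)" "q = (y, r)"
            by (metis surj_pair)
          have le: "u x \<le> ereal (- t)" "u y \<le> ereal (- r)"
            using pq xy unfolding T_def by auto
          show "\<alpha> *\<^sub>R p + \<beta> *\<^sub>R q \<in> T"
          proof (cases "\<alpha> = 0 \<or> \<beta> = 0")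
            case False
            then have b: "\<alpha> = 1 - \<beta>" "0 < \<beta>" "\<beta> < 1"
              using ab by auto
            have "u (\<alpha> *\<^sub>R x + \<beta> *\<^sub>R y) \<le> ereal \<alpha> * u x + ereal \<beta> * u y"
              using Conv_scD(2)[OF u] b unfolding convex_ereal_def by auto
            also have "\<dots> \<le> ereal \<alpha> * ereal (- t) + ereal \<beta> * ereal (- r)"
              using le ab by (intro add_mono ereal_mult_left_mono) auto
            finally show ?thesis
              unfolding T_def xy by simp
          qed (use ab pq in auto)
        qed
        moreover have "T \<noteq> {}"
        proof -
          obtain x where "u x \<noteq> \<infinity>"
            using Conv_scD(4)[OF u] by blast
          then obtain r where "u x = ereal r"
            using Conv_scD(1)[OF u, of x] by (cases "u x") auto
          then have "(x, - r) \<in> T"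
            unfolding T_def by simp
          then show ?thesis
            by blast
        qed
        moreover have "t \<le> l * ((x - x0) \<bullet> (x - x0)) + - c" if "(x, t) \<in> T" for x t
        proof -
          have "u x \<le> ereal (- t)"
            using that unfolding T_def by simp
          with below[of x] have "ereal (c - l * ((x - x0) \<bullet> (x - x0))) \<le> ereal (- t)"
            by (rule order_trans)
          then show ?thesis
            by simp
        qed
        ultimately obtain a b where
          ab: "\<And>x. a \<bullet> x + b \<le> l * ((x - x0) \<bullet> (x - x0)) + - c" "\<And>x t. (x, t) \<in> T \<Longrightarrow> t \<le> a \<bullet> x + b"
          using convex_affine_separation[OF convex_on_quadratic[OF \<open>l \<ge> 0\<close>]] by blast
        have "ereal (x \<bullet> (- a) - b) \<le> u x" for x
        proof (cases "u x")
          case (real r)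
          then have "(x, - r) \<in> T"
            unfolding T_def by simp
          then have "- r \<le> a \<bullet> x + b"
            by (rule ab(2))
          then show ?thesis
            using real by (simp add: inner_commute)
        qed (use Conv_scD(1)[OF u, of x] in auto)
        then have "rdual u (- a) \<le> b"
          unfolding rdual_le_iff[OF u] by blast
        moreover have "(- a) \<bullet> x0 - s \<le> rdual u (- a)"
          using s unfolding dual_le_iff by (metis inner_commute)
        ultimately show False
          using ab(1)[of x0] c(1) by (simp add: inner_minus_left)
      qed
    qed
  qed
qed

section \<open>Maximum and minimum under conjugation\<close>

lemma convex_ereal_of_convex_on: "convex_on UNIV f \<Longrightarrow> convex_ereal (\<lambda>x. ereal (f x))"
  unfolding convex_ereal_def using convex_onD[of UNIV f] by auto

lemma lsc_of_continuous:
  fixes f :: "'a::t2_space \<Rightarrow> real"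
  assumes "continuous_on UNIV f"
  shows "lower_semicontinuous (\<lambda>x. ereal (f x))"
proof (rule lower_semicontinuousI)
  fix x c assume "c < ereal (f x)"
  moreover have "((\<lambda>x. ereal (f x)) \<longlongrightarrow> ereal (f x)) (at x)"
    using assms by (auto simp: continuous_on_def intro: tendsto_ereal)
  ultimately show "eventually (\<lambda>y. c < ereal (f y)) (nhds x)"
    unfolding eventually_nhds_conv_at using order_tendstoD(1) by blast
qed

text \<open>
  The sublevel sets of \<open>u\<close> and \<open>v\<close> relative to the affine function are closed and cover the segment
  from \<open>x1\<close> to \<open>x2\<close>, so they meet there by connectedness.
\<close>

lemma convex_min_common_sublevel:
  fixes u v :: "'a::euclidean_space \<Rightarrow> ereal"
  assumes lsc: "lower_semicontinuous u" "lower_semicontinuous v"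
    and conv: "convex_ereal (\<lambda>x. min (u x) (v x))"
    and x1: "u x1 \<le> ereal (x1 \<bullet> y - c)" and x2: "v x2 \<le> ereal (x2 \<bullet> y - c)"
  obtains x where "max (u x) (v x) \<le> ereal (x \<bullet> y - c)"
proof -
  let ?A = "\<lambda>u. {x. u x \<le> ereal (x \<bullet> y - c)}"
  have closed: "closed (?A u)" "closed (?A v)"
    using lsc by (auto intro!: closed_sublevel_lsc continuous_intros)
  have cover: "closed_segment x1 x2 \<subseteq> ?A u \<union> ?A v"
  proof
    fix x assume "x \<in> closed_segment x1 x2"
    then obtain t where t: "0 \<le> t" "t \<le> 1" "x = (1 - t) *\<^sub>R x1 + t *\<^sub>R x2"
      unfolding in_segment by blast
    show "x \<in> ?A u \<union> ?A v"
    proof (cases "t = 0 \<or> t = 1")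
      case False
      then have "min (u x) (v x) \<le> ereal (1 - t) * min (u x1) (v x1) + ereal t * min (u x2) (v x2)"
        using conv t unfolding convex_ereal_def by auto
      also have "\<dots> \<le> ereal (1 - t) * ereal (x1 \<bullet> y - c) + ereal t * ereal (x2 \<bullet> y - c)"
        using t x1 x2 by (intro add_mono ereal_mult_left_mono) (auto simp: min_le_iff_disj)
      also have "\<dots> = ereal (x \<bullet> y - c)"
        unfolding t(3) by (simp add: inner_add_left algebra_simps)
      finally show ?thesis
        by (auto simp: min_le_iff_disj)
    qed (use t x1 x2 in auto)
  qed
  have "connected (closed_segment x1 x2)"
    by (rule connected_segment)
  then have "?A u \<inter> ?A v \<inter> closed_segment x1 x2 \<noteq> {}"
    using closed cover x1 x2 unfolding connected_closed by blast
  then show ?thesis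
    using that by auto
qed

lemma rdual_min:
  assumes "u \<in> Conv_sc" "v \<in> Conv_sc" "(\<lambda>x. min (u x) (v x)) \<in> Conv_sc"
  shows "rdual (\<lambda>x. min (u x) (v x)) y = max (rdual u y) (rdual v y)"
proof -
  have "rdual (\<lambda>x. min (u x) (v x)) y \<le> c \<longleftrightarrow> max (rdual u y) (rdual v y) \<le> c" for c
    unfolding rdual_le_iff[OF assms(3)] using rdual_le_iff[OF assms(1)] rdual_le_iff[OF assms(2)] by auto
  then show ?thesis
    by (meson antisym order_refl)
qed

text \<open>The nontrivial inequality: if both conjugates exceed \<open>c\<close>, then
  \<open>u\<close> and \<open>v\<close> each fall to the level of one affine function somewhere.
  Convexity of the minimum yields a point where both do, so the conjugate of the maximum is at least
  \<open>c\<close> too.\<close>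

lemma rdual_max:
  fixes u v :: "'a::euclidean_space \<Rightarrow> ereal"
  assumes uv: "u \<in> Conv_sc" "v \<in> Conv_sc"
    and mn: "(\<lambda>x. min (u x) (v x)) \<in> Conv_sc" and mx: "(\<lambda>x. max (u x) (v x)) \<in> Conv_sc"
  shows "rdual (\<lambda>x. max (u x) (v x)) y = min (rdual u y) (rdual v y)"
proof (rule antisym)
  show "rdual (\<lambda>x. max (u x) (v x)) y \<le> min (rdual u y) (rdual v y)"
    using rdual_ge[OF uv(1)] rdual_ge[OF uv(2)] unfolding min.bounded_iff rdual_le_iff[OF mx]
    by (auto simp: le_max_iff_disj)
  show "min (rdual u y) (rdual v y) \<le> rdual (\<lambda>x. max (u x) (v x)) y"
  proof (rule ccontr)
    let ?r = "rdual (\<lambda>x. max (u x) (v x)) y"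
    assume "\<not> min (rdual u y) (rdual v y) \<le> ?r"
    then have "?r < min (rdual u y) (rdual v y)"
      by (simp only: not_le)
    then obtain c where c: "?r < c" "c < min (rdual u y) (rdual v y)"
      using dense by blast
    have "\<not> rdual u y \<le> c" "\<not> rdual v y \<le> c"
      using c(2) by auto
    then obtain x1 x2 where "\<not> ereal (x1 \<bullet> y - c) \<le> u x1" "\<not> ereal (x2 \<bullet> y - c) \<le> v x2"
      unfolding rdual_le_iff[OF uv(1)] rdual_le_iff[OF uv(2)] by blast
    then have x12: "u x1 \<le> ereal (x1 \<bullet> y - c)" "v x2 \<le> ereal (x2 \<bullet> y - c)"
      by simp_all
    obtain x where "max (u x) (v x) \<le> ereal (x \<bullet> y - c)"
      by (rule convex_min_common_sublevel[OF Conv_scD(3)[OF uv(1)] Conv_scD(3)[OF uv(2)]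
            Conv_scD(2)[OF mn] x12])
    with rdual_ge[OF mx, of x y] have "ereal (x \<bullet> y - ?r) \<le> ereal (x \<bullet> y - c)"
      by (rule order_trans)
    then show False
      using c(1) by simp
  qed
qed

lemma dual_min: "dual (\<lambda>x. min (f x) (g x)) y = max (dual f y) (dual g y)"
  by (rule eq_ereal_by_real_bounds) (auto simp: dual_le_iff)

text \<open>The same argument as for \<open>rdual_max\<close>, with \<open>f\<close> and
  \<open>g\<close> read as extended functions that are lower semicontinuous because convex finite
  functions are continuous.\<close>

lemma dual_max:
  fixes f g :: "'a::euclidean_space \<Rightarrow> real"
  assumes f: "convex_on UNIV f" and g: "convex_on UNIV g" and mn: "convex_on UNIV (\<lambda>x. min (f x) (g x))"
  shows "dual (\<lambda>x. max (f x) (g x)) y = min (dual f y) (dual g y)"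
proof (rule antisym)
  show "dual (\<lambda>x. max (f x) (g x)) y \<le> min (dual f y) (dual g y)"
  proof (rule ereal_le_real)
    fix s assume "min (dual f y) (dual g y) \<le> ereal s"
    then have "dual f y \<le> ereal s \<or> dual g y \<le> ereal s"
      by (simp add: min_le_iff_disj)
    then show "dual (\<lambda>x. max (f x) (g x)) y \<le> ereal s"
      unfolding dual_le_iff by (auto simp: le_max_iff_disj)
  qed
  show "min (dual f y) (dual g y) \<le> dual (\<lambda>x. max (f x) (g x)) y"
  proof (rule ereal_le_real, rule ccontr)
    fix s assume s: "dual (\<lambda>x. max (f x) (g x)) y \<le> ereal s" and nle: "\<not> min (dual f y) (dual g y) \<le> ereal s"
    from nle obtain c where c: "s < c" "ereal c < min (dual f y) (dual g y)"
      by (rule ereal_not_le_realE)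
    have "\<not> dual f y \<le> ereal c" "\<not> dual g y \<le> ereal c"
      using c(2) by auto
    then obtain x1 x2 where "\<not> x1 \<bullet> y - c \<le> f x1" "\<not> x2 \<bullet> y - c \<le> g x2"
      unfolding dual_le_iff by blast
    then have x12: "ereal (f x1) \<le> ereal (x1 \<bullet> y - c)" "ereal (g x2) \<le> ereal (x2 \<bullet> y - c)"
      by simp_all
    have mn': "convex_ereal (\<lambda>x. min (ereal (f x)) (ereal (g x)))"
      using convex_ereal_of_convex_on[OF mn] by (simp add: ereal_min)
    obtain x where "max (ereal (f x)) (ereal (g x)) \<le> ereal (x \<bullet> y - c)"
      by (rule convex_min_common_sublevel[OF lsc_of_continuous[OF convex_continuous[OF f]]
            lsc_of_continuous[OF convex_continuous[OF g]] mn' x12])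
    then have "max (f x) (g x) \<le> x \<bullet> y - c"
      by simp
    moreover have "x \<bullet> y - s \<le> max (f x) (g x)"
      using s unfolding dual_le_iff by blast
    ultimately show False
      using c(1) by linarith
  qed
qed

section \<open>Epi-convergence and inf-convolution under conjugation\<close>

text \<open>Both notions of convergence quantify over full sequences of points. Filling the gaps of
  a subsequence with the limit point makes them applicable along subsequences.\<close>

lemma subseq_fill:
  fixes xs :: "nat \<Rightarrow> 'a::metric_space"
  assumes s: "strict_mono s" and xs: "xs \<longlonglongrightarrow> x"
  obtains q where "q \<longlonglongrightarrow> x" "\<And>j. q (s j) = xs j"
proof -
  define q where "q k = (if k \<in> range s then xs (inv s k) else x)" for k
  have inj: "inj s"
    using s by (rule strict_mono_imp_inj_on)
  have q: "q (s j) = xs j" for j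
    unfolding q_def using inj by simp
  have "q \<longlonglongrightarrow> x"
    unfolding lim_sequentially
  proof (intro allI impI)
    fix e :: real assume "e > 0"
    then obtain N where N: "\<And>j. j \<ge> N \<Longrightarrow> dist (xs j) x < e"
      using xs unfolding lim_sequentially by blast
    show "\<exists>N. \<forall>k\<ge>N. dist (q k) x < e"
    proof (intro exI allI impI)
      fix k assume k: "s N \<le> k"
      show "dist (q k) x < e"
      proof (cases "k \<in> range s")
        case True
        then obtain j where j: "k = s j"
          by blast
        then have "N \<le> j"
          using k s by (simp add: strict_mono_less_eq)
        then show ?thesis
          using N q j by simp
      qed (use \<open>e > 0\<close> in \<open>simp add: q_def\<close>)
    qed
  qed
  then show ?thesis
    using q that by blast
qed

lemma cont_converges_subseq:
  fixes xs :: "nat \<Rightarrow> 'a::metric_space"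
  assumes "cont_converges fs f" "strict_mono s" "xs \<longlonglongrightarrow> x"
  shows "(\<lambda>j. fs (s j) (xs j)) \<longlonglongrightarrow> f x"
proof -
  obtain q where q: "q \<longlonglongrightarrow> x" "\<And>j. q (s j) = xs j"
    using subseq_fill[OF assms(2,3)] by blast
  have "(\<lambda>k. fs k (q k)) \<longlonglongrightarrow> f x"
    using assms(1) q(1) unfolding cont_converges_def by blast
  from LIMSEQ_subseq_LIMSEQ[OF this assms(2)] show ?thesis
    by (simp add: comp_def q(2))
qed

lemma epi_converges_liminf_subseq:
  fixes xs :: "nat \<Rightarrow> 'a::metric_space"
  assumes "epi_converges us u" "strict_mono s" "xs \<longlonglongrightarrow> x"
  shows "u x \<le> liminf (\<lambda>j. us (s j) (xs j))"
proof -
  obtain q where q: "q \<longlonglongrightarrow> x" "\<And>j. q (s j) = xs j"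
    using subseq_fill[OF assms(2,3)] by blast
  have "u x \<le> liminf (\<lambda>k. us k (q k))"
    using assms(1) q(1) unfolding epi_converges_def by blast
  also have "\<dots> \<le> liminf ((\<lambda>k. us k (q k)) \<circ> s)"
    using assms(2) by (rule liminf_subseq_mono)
  finally show ?thesis
    by (simp add: comp_def q(2))
qed

text \<open>Points that may escape to infinity are pulled back towards \<open>z\<close> onto a
  sphere of radius R. Convexity transfers an upper bound to the new point, and compactness becomes
  available.\<close>

lemma truncation_factor:
  fixes x z :: "'a::real_normed_vector"
  assumes "R > 0"
  obtains t where "0 < t" "t \<le> 1" "norm (t *\<^sub>R (x - z)) \<le> R" "t = 1 \<or> norm (t *\<^sub>R (x - z)) = R"
proof (cases "norm (x - z) \<le> R")
  case True
  then show ?thesis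
    using that[of 1] by simp
next
  case False
  then have "x \<noteq> z"
    using assms by auto
  then show ?thesis
    using that[of "R / norm (x - z)"] assms False by simp
qed

text \<open>The lower estimate tests with a recovery sequence. If the upper estimate fails, there
  are points where \<open>us k\<close> lies below an affine function that \<open>u\<close> avoids.
  Truncated towards the recovery points of some \<open>x0\<close> with finite \<open>u x0\<close>,
  they have a limit point: either it contradicts the choice of \<open>c1\<close>, or it lies at
  distance R from \<open>x0\<close> and contradicts the linear growth of \<open>u\<close>.\<close>

lemma cont_converges_rdual:
  fixes u :: "'a::euclidean_space \<Rightarrow> ereal"
  assumes us: "\<And>k. us k \<in> Conv_sc" and u: "u \<in> Conv_sc" and epi: "epi_converges us u"
  shows "cont_converges (\<lambda>k. rdual (us k)) (rdual u)"
  unfolding cont_converges_def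
proof (intro allI impI)
  fix y :: 'a and ys assume ys: "ys \<longlonglongrightarrow> y"
  have recovery: "\<exists>zs. zs \<longlonglongrightarrow> x \<and> (\<lambda>k. us k (zs k)) \<longlonglongrightarrow> u x" for x
    using epi unfolding epi_converges_def by blast
  show "(\<lambda>k. rdual (us k) (ys k)) \<longlonglongrightarrow> rdual u y"
  proof (rule order_tendstoI)
    fix a assume "a < rdual u y"
    then have "\<not> rdual u y \<le> a"
      by simp
    then obtain x where "\<not> ereal (x \<bullet> y - a) \<le> u x"
      unfolding rdual_le_iff[OF u] by blast
    then have x: "u x < ereal (x \<bullet> y - a)"
      by simp
    then obtain e where e: "u x < ereal e" "ereal e < ereal (x \<bullet> y - a)"
      using ereal_dense2 by blast
    obtain zs where zs: "zs \<longlonglongrightarrow> x" "(\<lambda>k. us k (zs k)) \<longlonglongrightarrow> u x"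
      using recovery by blast
    have "eventually (\<lambda>k. us k (zs k) < ereal e) sequentially"
      using order_tendstoD(2)[OF zs(2) e(1)] .
    moreover have "(\<lambda>k. zs k \<bullet> ys k - a) \<longlonglongrightarrow> x \<bullet> y - a"
      using zs(1) ys by (intro tendsto_intros)
    then have "eventually (\<lambda>k. e < zs k \<bullet> ys k - a) sequentially"
      using e(2) by (intro order_tendstoD(1)) auto
    ultimately show "eventually (\<lambda>k. a < rdual (us k) (ys k)) sequentially"
    proof eventually_elim
      case (elim k)
      show ?case
      proof (rule ccontr)
        assume "\<not> a < rdual (us k) (ys k)"
        then have "ereal (zs k \<bullet> ys k - a) \<le> us k (zs k)"
          using rdual_le_iff[OF us, of k "ys k" a] by simp
        then have "ereal (zs k \<bullet> ys k - a) < ereal e"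
          using elim(1) by (rule le_less_trans)
        then show False
          using elim(2) by simp
      qed
    qed
  next
    fix c assume "rdual u y < c"
    then obtain c1 where c1: "rdual u y < c1" "c1 < c"
      using dense by blast
    show "eventually (\<lambda>k. rdual (us k) (ys k) < c) sequentially"
    proof (rule ccontr)
      assume "\<not> ?thesis"
      then obtain s :: "nat \<Rightarrow> nat" where s: "strict_mono s" "\<And>j. \<not> rdual (us (s j)) (ys (s j)) < c"
        using not_eventually_sequentiallyD by blast
      have "\<exists>x. us (s j) x < ereal (x \<bullet> ys (s j) - c1)" for j
      proof -
        have "\<not> rdual (us (s j)) (ys (s j)) \<le> c1"
          using s(2)[of j] c1(2) by linarith
        then show ?thesis
          unfolding rdual_le_iff[OF us] by (auto simp: not_le)
      qed
      then obtain xs where xs: "\<And>j. us (s j) (xs j) < ereal (xs j \<bullet> ys (s j) - c1)"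
        by metis
      obtain x0 where "u x0 \<noteq> \<infinity>"
        using Conv_scD(4)[OF u] by blast
      then obtain b where b: "u x0 = ereal b"
        using Conv_scD(1)[OF u, of x0] by (cases "u x0") auto
      obtain zs where zs: "zs \<longlonglongrightarrow> x0" "(\<lambda>k. us k (zs k)) \<longlonglongrightarrow> u x0"
        using recovery by blast
      have "eventually (\<lambda>k. us k (zs k) < ereal (b + 1)) sequentially"
        using b by (intro order_tendstoD(2)[OF zs(2)]) auto
      then obtain K where K: "\<And>k. k \<ge> K \<Longrightarrow> us k (zs k) < ereal (b + 1)"
        unfolding eventually_sequentially by blast
      obtain M where M: "\<And>x. ereal ((norm y + 1) * norm x - M) \<le> u x" "M \<ge> 0"
        using Conv_sc_linear_growth[OF u, of "norm y + 1"] by blast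
      \<comment> \<open>At a point \<open>p\<close> at distance R from \<open>x0\<close> the surplus
        slope 1 contributes at least \<open>R - norm x0\<close>, which exceeds all other terms in
        the final estimate by 1.\<close>
      define R where "R = norm x0 + M + \<bar>b + 1 - x0 \<bullet> y\<bar> + \<bar>c1\<bar> + 1"
      have "R > 0"
        unfolding R_def using M(2) by (smt (verit) norm_ge_zero)
      have "\<exists>t. 0 < t \<and> t \<le> 1 \<and> norm (t *\<^sub>R (xs j - zs (s j))) \<le> R
          \<and> (t = 1 \<or> norm (t *\<^sub>R (xs j - zs (s j))) = R)" for j
        using truncation_factor[OF \<open>R > 0\<close>, of "xs j" "zs (s j)"] by metis
      then obtain t where t: "\<And>j. 0 < t j" "\<And>j. t j \<le> (1::real)"
        "\<And>j. norm (t j *\<^sub>R (xs j - zs (s j))) \<le> R"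
        "\<And>j. t j = 1 \<or> norm (t j *\<^sub>R (xs j - zs (s j))) = R"
        by metis
      define d where "d j = t j *\<^sub>R (xs j - zs (s j))" for j
      have "compact ({0..1::real} \<times> cball (0::'a) R)"
        by (intro compact_Times) auto
      moreover have "(t j, d j) \<in> {0..1} \<times> cball 0 R" for j
        using t(1)[of j] t(2)[of j] t(3)[of j] unfolding d_def by auto
      ultimately obtain td r where r: "strict_mono r" "((\<lambda>j. (t j, d j)) \<circ> r) \<longlonglongrightarrow> td"
        unfolding compact_def by meson
      obtain t' d' where td: "td = (t', d')"
        by (cases td)
      have lim: "(\<lambda>j. t (r j)) \<longlonglongrightarrow> t'" "(\<lambda>j. d (r j)) \<longlonglongrightarrow> d'"
        using tendsto_fst[OF r(2)] tendsto_snd[OF r(2)] by (simp_all add: td comp_def)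
      let ?s = "\<lambda>j. s (r j)"
      have sr: "strict_mono ?s"
        using s(1) r(1) by (simp add: strict_mono_def)
      have limz: "(\<lambda>j. zs (?s j)) \<longlonglongrightarrow> x0" and limy: "(\<lambda>j. ys (?s j)) \<longlonglongrightarrow> y"
        using LIMSEQ_subseq_LIMSEQ[OF zs(1) sr] LIMSEQ_subseq_LIMSEQ[OF ys sr] by (simp_all add: comp_def)
      \<comment> \<open>The convex combination of the bounds at the recovery point and at
        \<open>xs\<close>, rewritten in the truncated displacement \<open>d\<close>, so that only
        convergent quantities occur.\<close>
      define h where "h j = (1 - t (r j)) * (b + 1 - zs (?s j) \<bullet> ys (?s j))
          + (zs (?s j) + d (r j)) \<bullet> ys (?s j) - t (r j) * c1" for j
      have le_h: "us (?s j) (zs (?s j) + d (r j)) \<le> ereal (h j)" if "?s j \<ge> K" for j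
      proof -
        let ?t = "t (r j)" and ?z = "zs (?s j)" and ?x = "xs (r j)" and ?y = "ys (?s j)"
        have zd: "?z + d (r j) = (1 - ?t) *\<^sub>R ?z + ?t *\<^sub>R ?x"
          unfolding d_def by (simp add: algebra_simps)
        have h: "h j = (1 - ?t) * (b + 1) + ?t * (?x \<bullet> ?y - c1)"
          unfolding h_def zd by (simp add: inner_add_left algebra_simps)
        have x: "us (?s j) ?x \<le> ereal (?x \<bullet> ?y - c1)" and z: "us (?s j) ?z \<le> ereal (b + 1)"
          using xs[of "r j"] K[OF that] by simp_all
        show ?thesis
        proof (cases "?t = 1")
          case True
          then show ?thesis
            using x unfolding h zd by simp
        next
          case False
          then have "0 < ?t" "?t < 1"
            using t(1)[of "r j"] t(2)[of "r j"] by auto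
          then have "us (?s j) (?z + d (r j)) \<le> ereal (1 - ?t) * us (?s j) ?z + ereal ?t * us (?s j) ?x"
            using Conv_scD(2)[OF us, of "?s j"] unfolding zd convex_ereal_def by auto
          also have "\<dots> \<le> ereal (1 - ?t) * ereal (b + 1) + ereal ?t * ereal (?x \<bullet> ?y - c1)"
            using x z \<open>0 < ?t\<close> \<open>?t < 1\<close> by (intro add_mono ereal_mult_left_mono) auto
          finally show ?thesis
            unfolding h by simp
        qed
      qed
      define p where "p = x0 + d'"
      define h' where "h' = (1 - t') * (b + 1 - x0 \<bullet> y) + p \<bullet> y - t' * c1"
      have "h \<longlonglongrightarrow> h'"
        unfolding h_def h'_def p_def by (intro tendsto_intros lim limz limy)
      have "u p \<le> liminf (\<lambda>j. us (?s j) (zs (?s j) + d (r j)))"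
        unfolding p_def by (rule epi_converges_liminf_subseq[OF epi sr]) (intro tendsto_intros lim limz)
      also have "\<dots> \<le> liminf (\<lambda>j. ereal (h j))"
      proof (rule Liminf_mono)
        show "eventually (\<lambda>j. us (?s j) (zs (?s j) + d (r j)) \<le> ereal (h j)) sequentially"
          unfolding eventually_sequentially using le_h seq_suble[OF sr] by (meson le_trans)
      qed
      also have "\<dots> = ereal h'"
        using \<open>h \<longlonglongrightarrow> h'\<close> by (intro lim_imp_Liminf) auto
      finally have up: "u p \<le> ereal h'" .
      have t'01: "0 \<le> t'" "t' \<le> 1"
        using t(1,2) by (auto intro: LIMSEQ_le_const[OF lim(1)] LIMSEQ_le_const2[OF lim(1)] less_imp_le)
      show False
      proof (cases "t' = 1")
        case True
        then have "u p \<le> ereal (p \<bullet> y - c1)"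
          using up by (simp add: h'_def)
        with rdual_ge[OF u, of p y] have "ereal (p \<bullet> y - rdual u y) \<le> ereal (p \<bullet> y - c1)"
          by (rule order_trans)
        then show False
          using c1(1) by simp
      next
        case False
        \<comment> \<open>A limit below 1 means that the truncation is eventually active, so the
          limit displacement has length exactly R.\<close>
        then have "eventually (\<lambda>j. t (r j) < 1) sequentially"
          using t'01 by (intro order_tendstoD(2)[OF lim(1)]) auto
        then have "eventually (\<lambda>j. norm (d (r j)) = R) sequentially"
          by (rule eventually_mono) (use t(4) in \<open>force simp: d_def\<close>)
        then have "(\<lambda>j. norm (d (r j))) \<longlonglongrightarrow> R"
          by (rule tendsto_eventually)
        then have "norm d' = R"
          using tendsto_norm[OF lim(2)] LIMSEQ_unique by blast
        then have "norm p \<ge> R - norm x0"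
          unfolding p_def using norm_triangle_ineq4[of "x0 + d'" x0] by simp
        moreover have "p \<bullet> y \<le> norm y * norm p"
          using norm_cauchy_schwarz[of p y] by (simp add: mult.commute)
        moreover have "ereal ((norm y + 1) * norm p - M) \<le> ereal h'"
          using M(1) up by (rule order_trans)
        then have "(norm y + 1) * norm p - M \<le> h'"
          by simp
        moreover have "h' \<le> \<bar>b + 1 - x0 \<bullet> y\<bar> + p \<bullet> y + \<bar>c1\<bar>"
        proof -
          have "\<bar>(1 - t') * (b + 1 - x0 \<bullet> y)\<bar> \<le> 1 * \<bar>b + 1 - x0 \<bullet> y\<bar>"
            unfolding abs_mult using t'01 by (intro mult_right_mono) auto
          then have "(1 - t') * (b + 1 - x0 \<bullet> y) \<le> \<bar>b + 1 - x0 \<bullet> y\<bar>"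
            using abs_ge_self order_trans by fastforce
          moreover have "\<bar>t' * c1\<bar> \<le> 1 * \<bar>c1\<bar>"
            unfolding abs_mult using t'01 by (intro mult_right_mono) auto
          then have "- (t' * c1) \<le> \<bar>c1\<bar>"
            by (simp add: abs_le_iff)
          ultimately show ?thesis
            unfolding h'_def by linarith
        qed
        ultimately show False
          unfolding R_def by (simp add: algebra_simps)
      qed
    qed
  qed
qed

text \<open>Combines witnesses for each accuracy \<open>n\<close> into one sequence that eventually
  meets every accuracy.\<close>

lemma diagonal_eventually:
  assumes ev: "\<And>n::nat. eventually (\<lambda>k::nat. \<exists>y. Q n k y) sequentially"
    and anti: "\<And>n n' k y. n \<le> n' \<Longrightarrow> Q n' k y \<Longrightarrow> Q n k y"
  obtains ys where "\<And>n. eventually (\<lambda>k. Q n k (ys k)) sequentially"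
proof -
  \<comment> \<open>The best accuracy attainable at index \<open>k\<close>; the cap by
    \<open>k\<close> ensures that a greatest one exists.\<close>
  define N where "N k = (GREATEST n. n \<le> k \<and> (\<exists>y. Q n k y))" for k
  define ys where "ys k = (SOME y. Q (N k) k y)" for k
  have "eventually (\<lambda>k. Q n k (ys k)) sequentially" for n
    using ev[of n] eventually_ge_at_top[of n]
  proof eventually_elim
    case (elim k)
    have *: "n \<le> k \<and> (\<exists>y. Q n k y)"
      using elim by blast
    have "n \<le> N k"
      unfolding N_def by (rule Greatest_le_nat[where P = "\<lambda>n. n \<le> k \<and> (\<exists>y. Q n k y)", OF *, of k]) blast
    moreover have "N k \<le> k \<and> (\<exists>y. Q (N k) k y)"
      unfolding N_def by (rule GreatestI_nat[where P = "\<lambda>n. n \<le> k \<and> (\<exists>y. Q n k y)", OF *, of k]) blast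
    then have "Q (N k) k (ys k)"
      unfolding ys_def by (metis someI_ex)
    ultimately show ?case
      by (rule anti)
  qed
  then show ?thesis
    by (rule that)
qed

text \<open>The hypothesis says that \<open>f\<close> lies above a concave cone with axis slope
  \<open>y\<close>. An affine function between the two has a slope within \<open>e\<close> of
  \<open>y\<close>, since otherwise the cone would overtake it along a ray, and its intercept bounds
  the conjugate there.\<close>

lemma dual_bounded_nearby:
  fixes f :: "'a::euclidean_space \<Rightarrow> real"
  assumes f: "convex_on UNIV f" and e: "e > 0"
    and lb: "\<And>x. - e * norm x \<le> f x - x \<bullet> y + s + e"
  obtains a where "norm (a - y) \<le> e" "dual f a \<le> ereal (s + e)"
proof -
  define T where "T = {(x, t). t \<le> x \<bullet> y - s - e - e * norm x}"
  have "convex T"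
  proof (rule convexI)
    fix p q :: "'a \<times> real" and \<alpha> \<beta> :: real
    assume pq: "p \<in> T" "q \<in> T" and ab: "0 \<le> \<alpha>" "0 \<le> \<beta>" "\<alpha> + \<beta> = 1"
    obtain x t z r where xz: "p = (x, t)" "q = (z, r)"
      by (metis surj_pair)
    have "\<alpha> * t + \<beta> * r \<le> \<alpha> * (x \<bullet> y - s - e - e * norm x) + \<beta> * (z \<bullet> y - s - e - e * norm z)"
      using pq ab unfolding xz T_def by (intro add_mono mult_left_mono) auto
    also have "\<dots> = (\<alpha> *\<^sub>R x + \<beta> *\<^sub>R z) \<bullet> y - (\<alpha> + \<beta>) * s - (\<alpha> + \<beta>) * e - e * (\<alpha> * norm x + \<beta> * norm z)"
      by (simp add: inner_add_left algebra_simps)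
    also have "\<dots> \<le> (\<alpha> *\<^sub>R x + \<beta> *\<^sub>R z) \<bullet> y - s - e - e * norm (\<alpha> *\<^sub>R x + \<beta> *\<^sub>R z)"
    proof -
      have "norm (\<alpha> *\<^sub>R x + \<beta> *\<^sub>R z) \<le> \<alpha> * norm x + \<beta> * norm z"
        using norm_triangle_ineq[of "\<alpha> *\<^sub>R x" "\<beta> *\<^sub>R z"] ab by simp
      then show ?thesis
        using e ab(3) by (simp add: mult_left_mono)
    qed
    finally show "\<alpha> *\<^sub>R p + \<beta> *\<^sub>R q \<in> T"
      unfolding T_def xz by simp
  qed
  moreover have "(0, - s - e) \<in> T"
    unfolding T_def by simp
  then have "T \<noteq> {}"
    by blast
  moreover have "t \<le> f x" if "(x, t) \<in> T" for x t
    using that lb[of x] unfolding T_def by simp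
  ultimately obtain a b where ab: "\<And>x. a \<bullet> x + b \<le> f x" "\<And>x t. (x, t) \<in> T \<Longrightarrow> t \<le> a \<bullet> x + b"
    using convex_affine_separation[OF f] by blast
  have T: "x \<bullet> y - s - e - e * norm x \<le> a \<bullet> x + b" for x
    using ab(2)[of x "x \<bullet> y - s - e - e * norm x"] unfolding T_def by simp
  have "- b \<le> s + e"
    using T[of 0] by simp
  have "norm (a - y) \<le> e"
  proof (rule ccontr)
    assume "\<not> norm (a - y) \<le> e"
    then have gt: "norm (y - a) > e"
      by (simp add: norm_minus_commute)
    \<comment> \<open>The rate at which the cone overtakes the affine function along the ray spanned
      by \<open>y - a\<close>.\<close>
    define \<delta> where "\<delta> = norm (y - a) * (norm (y - a) - e)"
    have "\<delta> > 0"
      unfolding \<delta>_def using gt e by (intro mult_pos_pos) auto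
    have "l * \<delta> \<le> b + s + e" if "l \<ge> 0" for l
    proof -
      have "(l *\<^sub>R (y - a)) \<bullet> (y - a) = l * (norm (y - a) * norm (y - a))"
        by (simp add: power2_norm_eq_inner[symmetric] power2_eq_square)
      moreover have "(l *\<^sub>R (y - a)) \<bullet> (y - a) \<le> b + s + e + e * norm (l *\<^sub>R (y - a))"
        using T[of "l *\<^sub>R (y - a)"] by (simp only: inner_diff_right inner_commute[of a])
      moreover have "norm (l *\<^sub>R (y - a)) = l * norm (y - a)"
        using that by simp
      ultimately have "l * (norm (y - a) * norm (y - a)) \<le> b + s + e + e * (l * norm (y - a))"
        by metis
      then show ?thesis
        unfolding \<delta>_def by (simp add: algebra_simps)
    qed
    from this[of "(\<bar>b + s + e\<bar> + 1) / \<delta>"] show False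
      using \<open>\<delta> > 0\<close> by simp
  qed
  moreover have "dual f a \<le> ereal (- b)"
    unfolding dual_le_iff using ab(1) by (simp add: inner_commute)
  then have "dual f a \<le> ereal (s + e)"
    using \<open>- b \<le> s + e\<close> by (meson ereal_less_eq(3) order_trans)
  ultimately show ?thesis
    by (rule that)
qed

text \<open>The liminf inequality holds because each term of the supremum converges. For recovery at
  a finite value \<open>s\<close>, the functions \<open>fs k\<close> are eventually above a slightly
  lowered cone, so \<open>dual_bounded_nearby\<close> supplies points near \<open>y\<close>; a
  diagonal choice joins them.\<close>

lemma epi_converges_dual:
  fixes f :: "'a::euclidean_space \<Rightarrow> real"
  assumes fs: "\<And>k. convex_on UNIV (fs k)" and f: "convex_on UNIV f" and conv: "cont_converges fs f"
  shows "epi_converges (\<lambda>k. dual (fs k)) (dual f)"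
proof -
  have liminf: "dual f y \<le> liminf (\<lambda>k. dual (fs k) (ys k))" if ys: "ys \<longlonglongrightarrow> y" for y ys
    unfolding dual_def[of f y]
  proof (rule SUP_least)
    fix x
    have "(\<lambda>k. x \<bullet> ys k - fs k x) \<longlonglongrightarrow> x \<bullet> y - f x"
      using conv ys unfolding cont_converges_def by (intro tendsto_intros) auto
    then have "ereal (x \<bullet> y - f x) = liminf (\<lambda>k. ereal (x \<bullet> ys k - fs k x))"
      by (intro lim_imp_Liminf[symmetric]) auto
    also have "\<dots> \<le> liminf (\<lambda>k. dual (fs k) (ys k))"
      by (intro Liminf_mono always_eventually allI dual_ge)
    finally show "ereal (x \<bullet> y - f x) \<le> liminf (\<lambda>k. dual (fs k) (ys k))" .
  qed
  have recovery: "\<exists>ys. ys \<longlonglongrightarrow> y \<and> (\<lambda>k. dual (fs k) (ys k)) \<longlonglongrightarrow> dual f y" for y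
  proof (cases "dual f y")
    case PInf
    have "(\<lambda>k. dual (fs k) y) \<longlonglongrightarrow> \<infinity>"
      unfolding tendsto_PInfty
    proof
      fix r
      have "ereal r < liminf (\<lambda>k. dual (fs k) y)"
        using liminf[OF tendsto_const, of y] PInf by simp
      then show "eventually (\<lambda>k. ereal r < dual (fs k) y) sequentially"
        by (rule less_LiminfD)
    qed
    then show ?thesis
      unfolding PInf by (intro exI[of _ "\<lambda>_. y"] conjI tendsto_const)
  next
    case (real s)
    have claim: "eventually (\<lambda>k. \<exists>a. norm (a - y) \<le> e \<and> dual (fs k) a \<le> ereal (s + e)) sequentially"
      if e: "e > 0" for e
    proof -
      let ?F = "\<lambda>k x. fs k x - x \<bullet> y + s + e"
      have lim0: "(\<lambda>k. ?F k 0) \<longlonglongrightarrow> f 0 + s + e"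
      proof -
        have "(\<lambda>k. fs k 0) \<longlonglongrightarrow> f 0"
          using conv tendsto_const unfolding cont_converges_def by blast
        then have "(\<lambda>k. ?F k 0) \<longlonglongrightarrow> f 0 - 0 \<bullet> y + s + e"
          by (intro tendsto_intros)
        then show ?thesis
          by simp
      qed
      have f0: "f 0 + s + e \<ge> e"
        using real dual_le_iff[of f y s] by (auto dest: spec[of _ 0])
      have "eventually (\<lambda>k. \<forall>x. - e * norm x \<le> ?F k x) sequentially"
      proof (rule ccontr)
        assume "\<not> ?thesis"
        then obtain r1 :: "nat \<Rightarrow> nat" where r1: "strict_mono r1"
          "\<And>j. \<not> (\<forall>x. - e * norm x \<le> ?F (r1 j) x)"
          using not_eventually_sequentiallyD by blast
        then have "\<forall>j. \<exists>x. ?F (r1 j) x < - e * norm x"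
          by (metis not_le)
        then obtain xs where xs: "\<And>j. ?F (r1 j) (xs j) < - e * norm (xs j)"
          by metis
        \<comment> \<open>At radius R the cone term \<open>e * R\<close> exceeds
          \<open>?F k 0\<close> for all large \<open>k\<close>, so a truncated point still has a
          nonpositive value of \<open>?F\<close>.\<close>
        define R where "R = (f 0 + s + e + 1) / e"
        have "R > 0"
          unfolding R_def using f0 e by (intro divide_pos_pos) auto
        have "\<exists>t. 0 < t \<and> t \<le> 1 \<and> norm (t *\<^sub>R (xs j - 0)) \<le> R \<and> (t = 1 \<or> norm (t *\<^sub>R (xs j - 0)) = R)" for j
          using truncation_factor[OF \<open>R > 0\<close>, of "xs j" 0] by metis
        then obtain t where t: "\<And>j. 0 < t j" "\<And>j. t j \<le> (1::real)" "\<And>j. norm (t j *\<^sub>R xs j) \<le> R"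
          "\<And>j. t j = 1 \<or> norm (t j *\<^sub>R xs j) = R"
          unfolding diff_zero by metis
        have "eventually (\<lambda>k. 0 < ?F k 0 \<and> ?F k 0 < f 0 + s + e + 1) sequentially"
          using f0 e by (intro eventually_conj order_tendstoD[OF lim0]) auto
        then obtain K where K: "\<And>k. k \<ge> K \<Longrightarrow> 0 < ?F k 0 \<and> ?F k 0 < f 0 + s + e + 1"
          unfolding eventually_sequentially by blast
        have neg: "?F (r1 j) (t j *\<^sub>R xs j) \<le> 0" if "j \<ge> K" for j
        proof -
          have "r1 j \<ge> K"
            using that seq_suble[OF r1(1), of j] by linarith
          note K = K[OF this]
          have "fs (r1 j) ((1 - t j) *\<^sub>R 0 + t j *\<^sub>R xs j) \<le> (1 - t j) * fs (r1 j) 0 + t j * fs (r1 j) (xs j)"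
            using t(1)[of j] t(2)[of j] by (intro convex_onD[OF fs]) auto
          then have "?F (r1 j) (t j *\<^sub>R xs j) \<le> (1 - t j) * ?F (r1 j) 0 + t j * ?F (r1 j) (xs j)"
            by (simp add: algebra_simps)
          also have "\<dots> \<le> (1 - t j) * ?F (r1 j) 0 + t j * (- e * norm (xs j))"
            using xs[of j] t(1)[of j] by (intro add_left_mono mult_left_mono) auto
          also have "\<dots> = (1 - t j) * ?F (r1 j) 0 - e * norm (t j *\<^sub>R xs j)"
            using t(1)[of j] by simp
          also have "\<dots> \<le> 0"
          proof (cases "t j = 1")
            case True
            then show ?thesis
              using e by simp
          next
            case False
            then have "norm (t j *\<^sub>R xs j) = R"
              using t(4) by blast
            have "e * R = f 0 + s + e + 1"
              using e by (simp add: R_def)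
            moreover have "(1 - t j) * ?F (r1 j) 0 \<le> 1 * ?F (r1 j) 0"
              using K t(1)[of j] by (intro mult_right_mono) auto
            moreover have "1 * ?F (r1 j) 0 \<le> f 0 + s + e + 1"
              using K by simp
            ultimately have "(1 - t j) * ?F (r1 j) 0 \<le> e * R"
              by (metis order_trans)
            then show ?thesis
              using \<open>norm (t j *\<^sub>R xs j) = R\<close> by (metis diff_le_0_iff_le)
          qed
          finally show ?thesis .
        qed
        have "t j *\<^sub>R xs j \<in> cball 0 R" for j
          using t(3) by simp
        then obtain p r2 where r2: "strict_mono r2" "((\<lambda>j. t j *\<^sub>R xs j) \<circ> r2) \<longlonglongrightarrow> p"
          using compact_cball[of "0::'a" R] unfolding compact_def by meson
        let ?r = "\<lambda>j. r1 (r2 j)"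
        have r: "strict_mono ?r"
          using r1(1) r2(1) by (simp add: strict_mono_def)
        have limp: "(\<lambda>j. t (r2 j) *\<^sub>R xs (r2 j)) \<longlonglongrightarrow> p"
          using r2(2) by (simp add: comp_def)
        have "(\<lambda>j. ?F (?r j) (t (r2 j) *\<^sub>R xs (r2 j))) \<longlonglongrightarrow> f p - p \<bullet> y + s + e"
          by (intro tendsto_intros limp cont_converges_subseq[OF conv r limp])
        \<comment> \<open>At the limit point \<open>f\<close> falls short of its affine minorant by
          at least \<open>e\<close>.\<close>
        then have "f p - p \<bullet> y + s + e \<le> 0"
        proof (rule LIMSEQ_le_const2)
          show "\<exists>N. \<forall>j\<ge>N. ?F (?r j) (t (r2 j) *\<^sub>R xs (r2 j)) \<le> 0"
            using neg seq_suble[OF r2(1)] by (meson le_trans)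
        qed
        moreover have "p \<bullet> y - s \<le> f p"
          using real dual_le_iff[of f y s] by auto
        ultimately show False
          using e by linarith
      qed
      then show ?thesis
      proof eventually_elim
        case (elim k)
        then show ?case
          using dual_bounded_nearby[OF fs e] by metis
      qed
    qed
    obtain ys where ys: "\<And>n. eventually (\<lambda>k. norm (ys k - y) \<le> 1 / real (Suc n)
        \<and> dual (fs k) (ys k) \<le> ereal (s + 1 / real (Suc n))) sequentially"
    proof (rule diagonal_eventually[where Q = "\<lambda>n k a. norm (a - y) \<le> 1 / real (Suc n)
        \<and> dual (fs k) a \<le> ereal (s + 1 / real (Suc n))"])
      fix n show "eventually (\<lambda>k. \<exists>a. norm (a - y) \<le> 1 / real (Suc n)
        \<and> dual (fs k) a \<le> ereal (s + 1 / real (Suc n))) sequentially"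
        by (rule claim) simp
    next
      fix n n' k a assume "n \<le> n'" and a: "norm (a - y) \<le> 1 / real (Suc n')
        \<and> dual (fs k) a \<le> ereal (s + 1 / real (Suc n'))"
      then have le: "1 / real (Suc n') \<le> 1 / real (Suc n)"
        by (intro divide_left_mono) auto
      have "ereal (s + 1 / real (Suc n')) \<le> ereal (s + 1 / real (Suc n))"
        using le by simp
      with a le show "norm (a - y) \<le> 1 / real (Suc n) \<and> dual (fs k) a \<le> ereal (s + 1 / real (Suc n))"
        by (meson order_trans)
    qed blast
    have inv: "\<exists>n. 1 / real (Suc n) < e" if "e > 0" for e
      using reals_Archimedean[OF that] by (simp add: inverse_eq_divide)
    have "ys \<longlonglongrightarrow> y"
    proof (rule tendstoI)
      fix e :: real assume "e > 0"
      then obtain n where n: "1 / real (Suc n) < e"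
        using inv by blast
      from ys[of n] show "eventually (\<lambda>k. dist (ys k) y < e) sequentially"
        by (rule eventually_mono) (use n in \<open>auto simp: dist_norm\<close>)
    qed
    moreover have "(\<lambda>k. dual (fs k) (ys k)) \<longlonglongrightarrow> dual f y"
    proof (rule order_tendstoI)
      fix a assume "a < dual f y"
      then have "a < liminf (\<lambda>k. dual (fs k) (ys k))"
        using liminf[OF \<open>ys \<longlonglongrightarrow> y\<close>] by (rule less_le_trans)
      then show "eventually (\<lambda>k. a < dual (fs k) (ys k)) sequentially"
        by (rule less_LiminfD)
    next
      fix a assume "dual f y < a"
      then obtain c where c: "s < c" "ereal c < a"
        using ereal_dense2[of "ereal s" a] real by auto
      then obtain n where n: "1 / real (Suc n) < c - s"
        using inv[of "c - s"] by auto
      from ys[of n] show "eventually (\<lambda>k. dual (fs k) (ys k) < a) sequentially"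
      proof (rule eventually_mono)
        fix k assume "norm (ys k - y) \<le> 1 / real (Suc n) \<and> dual (fs k) (ys k) \<le> ereal (s + 1 / real (Suc n))"
        then have "dual (fs k) (ys k) \<le> ereal (s + 1 / real (Suc n))"
          by simp
        also have "\<dots> < ereal c"
          using n by simp
        also note c(2)
        finally show "dual (fs k) (ys k) < a" .
      qed
    qed
    ultimately show ?thesis
      by blast
  qed (use dual_not_MInf in auto)
  show ?thesis
    unfolding epi_converges_def using liminf recovery by blast
qed

text \<open>An affine function between the concave function built from \<open>g\<close> and the
  convex function \<open>f\<close> has a slope \<open>a\<close>; then \<open>a\<close> and
  \<open>z - a\<close> share \<open>z\<close> between the two conjugates. This makes the infimum in
  the inf-convolution attained whenever it is finite.\<close>

lemma dual_add_split:
  fixes f g :: "'a::euclidean_space \<Rightarrow> real"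
  assumes f: "convex_on UNIV f" and g: "convex_on UNIV g"
    and le: "dual (f + g) z \<le> ereal s"
  obtains x b where "dual f x \<le> ereal b" "dual g (z - x) \<le> ereal (s - b)"
proof -
  define T where "T = {(y, t). t \<le> y \<bullet> z - s - g y}"
  have "convex T"
  proof (rule convexI)
    fix p q :: "'a \<times> real" and \<alpha> \<beta> :: real
    assume pq: "p \<in> T" "q \<in> T" and ab: "0 \<le> \<alpha>" "0 \<le> \<beta>" "\<alpha> + \<beta> = 1"
    obtain x t y r where xy: "p = (x, t)" "q = (y, r)"
      by (metis surj_pair)
    have \<alpha>: "\<alpha> = 1 - \<beta>"
      using ab by simp
    have "\<alpha> * t + \<beta> * r \<le> \<alpha> * (x \<bullet> z - s - g x) + \<beta> * (y \<bullet> z - s - g y)"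
      using pq ab unfolding xy T_def by (intro add_mono mult_left_mono) auto
    also have "\<dots> = (\<alpha> *\<^sub>R x + \<beta> *\<^sub>R y) \<bullet> z - s - (\<alpha> * g x + \<beta> * g y)"
      unfolding \<alpha> by (simp add: inner_add_left algebra_simps)
    also have "\<dots> \<le> (\<alpha> *\<^sub>R x + \<beta> *\<^sub>R y) \<bullet> z - s - g (\<alpha> *\<^sub>R x + \<beta> *\<^sub>R y)"
      using convex_onD[OF g, of \<beta> x y] ab unfolding \<alpha> by simp
    finally show "\<alpha> *\<^sub>R p + \<beta> *\<^sub>R q \<in> T"
      unfolding T_def xy by simp
  qed
  moreover have "(0, - s - g 0) \<in> T"
    unfolding T_def by simp
  then have "T \<noteq> {}"
    by blast
  moreover have "t \<le> f y" if "(y, t) \<in> T" for y t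
  proof -
    have "y \<bullet> z - s \<le> f y + g y"
      using le unfolding dual_le_iff plus_fun_apply by blast
    then show ?thesis
      using that unfolding T_def by simp
  qed
  ultimately obtain a b where ab: "\<And>y. a \<bullet> y + b \<le> f y" "\<And>y t. (y, t) \<in> T \<Longrightarrow> t \<le> a \<bullet> y + b"
    using convex_affine_separation[OF f] by blast
  have T: "y \<bullet> z - s - g y \<le> a \<bullet> y + b" for y
    using ab(2)[of y "y \<bullet> z - s - g y"] unfolding T_def by simp
  have "dual f a \<le> ereal (- b)"
    unfolding dual_le_iff using ab(1) by (simp add: inner_commute)
  moreover have "y \<bullet> (z - a) - (s - - b) \<le> g y" for y
    using T[of y] by (simp add: inner_diff_right inner_commute)
  then have "dual g (z - a) \<le> ereal (s - - b)"
    unfolding dual_le_iff by blast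
  ultimately show ?thesis
    by (rule that)
qed

section \<open>Inf-convolution of several functions\<close>

lemma convex_on_plus: "convex_on S f \<Longrightarrow> convex_on S g \<Longrightarrow> convex_on S (f + g)"
  unfolding plus_fun_def by (rule convex_on_add)

lemma convex_on_zero: "convex_on UNIV (0 :: 'a::real_vector \<Rightarrow> real)"
  unfolding zero_fun_def by (simp add: convex_on_def)

lemma convex_on_sum_fun:
  assumes "finite A" "\<And>j. j \<in> A \<Longrightarrow> convex_on UNIV (f j :: 'a::real_vector \<Rightarrow> real)"
  shows "convex_on UNIV (sum f A)"
  using assms by (induction A rule: finite_induct) (auto intro: convex_on_plus convex_on_zero)

lemma dual_sum_split:
  fixes f :: "nat \<Rightarrow> 'a::euclidean_space \<Rightarrow> real"
  assumes "\<And>j. j \<in> {1..k} \<Longrightarrow> convex_on UNIV (f j)" "dual (\<Sum>j=1..k. f j) z \<le> ereal s"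
  shows "\<exists>xs b. (\<Sum>j=1..k. xs j) = z \<and> (\<forall>j\<in>{1..k}. dual (f j) (xs j) \<le> ereal (b j)) \<and> (\<Sum>j=1..k. b j) \<le> s"
  using assms
proof (induction k arbitrary: z s)
  \<comment> \<open>The conjugate of the zero function is 0 at the origin and infinite elsewhere, so
    the empty sum of points must be \<open>z\<close>.\<close>
  case 0
  then have *: "x \<bullet> z \<le> s" for x
    by (simp add: dual_le_iff)
  have "z = 0"
  proof (rule ccontr)
    assume "z \<noteq> 0"
    then show False
      using *[of "((\<bar>s\<bar> + 1) / (z \<bullet> z)) *\<^sub>R z"] by simp
  qed
  then show ?case
    using *[of 0] by simp
next
  case (Suc k)
  have conv: "convex_on UNIV (\<Sum>j=1..k. f j)" "convex_on UNIV (f (Suc k))"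
    using Suc.prems(1) by (auto intro: convex_on_sum_fun)
  have "(\<Sum>j=1..Suc k. f j) = (\<Sum>j=1..k. f j) + f (Suc k)"
    by simp
  with Suc.prems(2) have "dual ((\<Sum>j=1..k. f j) + f (Suc k)) z \<le> ereal s"
    by (simp only:)
  then obtain x c where x: "dual (\<Sum>j=1..k. f j) x \<le> ereal c" "dual (f (Suc k)) (z - x) \<le> ereal (s - c)"
    by (rule dual_add_split[OF conv])
  obtain xs b where xs: "(\<Sum>j=1..k. xs j) = x" "\<forall>j\<in>{1..k}. dual (f j) (xs j) \<le> ereal (b j)" "(\<Sum>j=1..k. b j) \<le> c"
    using Suc.IH[OF _ x(1)] Suc.prems(1) by auto
  let ?xs = "xs(Suc k := z - x)" and ?b = "b(Suc k := s - c)"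
  have "(\<Sum>j=1..k. ?xs j) = (\<Sum>j=1..k. xs j)" "(\<Sum>j=1..k. ?b j) = (\<Sum>j=1..k. b j)"
    by (auto intro: sum.cong)
  then have "(\<Sum>j=1..Suc k. ?xs j) = z" "(\<Sum>j=1..Suc k. ?b j) \<le> s"
    using xs by simp_all
  moreover have "\<forall>j\<in>{1..Suc k}. dual (f j) (?xs j) \<le> ereal (?b j)"
    using xs(2) x(2) by (auto simp: le_Suc_eq)
  ultimately show ?case
    by blast
qed

lemma sum_ereal_le:
  assumes "finite A" "\<And>j. j \<in> A \<Longrightarrow> F j \<le> ereal (b j)"
  shows "sum F A \<le> ereal (sum b A)"
proof -
  have "sum F A \<le> (\<Sum>j\<in>A. ereal (b j))"
    using assms by (intro sum_mono) auto
  then show ?thesis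
    by simp
qed

text \<open>One inequality sums Fenchel's inequality over the family, the other splits
  \<open>z\<close> by \<open>dual_sum_split\<close>.\<close>

lemma inf_conv_fam_dual:
  fixes f :: "nat \<Rightarrow> 'a::euclidean_space \<Rightarrow> real"
  assumes f: "\<And>j. j \<in> {1..k} \<Longrightarrow> convex_on UNIV (f j)"
  shows "inf_conv_fam k (\<lambda>j. dual (f j)) = dual (\<Sum>j=1..k. f j)"
proof
  fix z
  show "inf_conv_fam k (\<lambda>j. dual (f j)) z = dual (\<Sum>j=1..k. f j) z"
  proof (rule antisym)
    show "inf_conv_fam k (\<lambda>j. dual (f j)) z \<le> dual (\<Sum>j=1..k. f j) z"
    proof (rule ereal_le_real)
      fix s assume "dual (\<Sum>j=1..k. f j) z \<le> ereal s"
      then obtain xs b where xs: "(\<Sum>j=1..k. xs j) = z" "\<forall>j\<in>{1..k}. dual (f j) (xs j) \<le> ereal (b j)" "(\<Sum>j=1..k. b j) \<le> s"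
        using dual_sum_split f by blast
      have "inf_conv_fam k (\<lambda>j. dual (f j)) z \<le> (\<Sum>j=1..k. dual (f j) (xs j))"
        unfolding inf_conv_fam_def using xs(1) by (intro Inf_lower) auto
      also have "\<dots> \<le> ereal (\<Sum>j=1..k. b j)"
        using xs(2) by (intro sum_ereal_le) auto
      also have "\<dots> \<le> ereal s"
        using xs(3) by simp
      finally show "inf_conv_fam k (\<lambda>j. dual (f j)) z \<le> ereal s" .
    qed
    show "dual (\<Sum>j=1..k. f j) z \<le> inf_conv_fam k (\<lambda>j. dual (f j)) z"
      unfolding inf_conv_fam_def
    proof (rule Inf_greatest, clarify)
      fix xs :: "nat \<Rightarrow> 'a" assume z: "z = (\<Sum>j=1..k. xs j)"
      show "dual (\<Sum>j=1..k. f j) (\<Sum>j=1..k. xs j) \<le> (\<Sum>j=1..k. dual (f j) (xs j))"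
        unfolding dual_def[of "\<Sum>j=1..k. f j"]
      proof (rule SUP_least)
        fix x
        have app: "(\<Sum>j\<in>A. f j) x = (\<Sum>j\<in>A. f j x)" for A
          by (induction A rule: infinite_finite_induct) auto
        have "ereal (x \<bullet> (\<Sum>j=1..k. xs j) - (\<Sum>j=1..k. f j) x) = (\<Sum>j=1..k. ereal (x \<bullet> xs j - f j x))"
          by (simp add: app inner_sum_right sum_subtractf)
        also have "\<dots> \<le> (\<Sum>j=1..k. dual (f j) (xs j))"
          by (intro sum_mono dual_ge)
        finally show "ereal (x \<bullet> (\<Sum>j=1..k. xs j) - (\<Sum>j=1..k. f j) x) \<le> (\<Sum>j=1..k. dual (f j) (xs j))" .
      qed
    qed
  qed
qed

lemma inf_conv_dual:
  fixes f g :: "'a::euclidean_space \<Rightarrow> real"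
  assumes "convex_on UNIV f" "convex_on UNIV g"
  shows "inf_conv (dual f) (dual g) = dual (f + g)"
proof -
  let ?h = "\<lambda>j::nat. if j = 1 then f else g"
  have "inf_conv (dual f) (dual g) = inf_conv_fam 2 (\<lambda>j. dual (?h j))"
    by (subst inf_conv_fam_2) simp
  also have "\<dots> = dual (\<Sum>j=1..2. ?h j)"
    using assms by (intro inf_conv_fam_dual) auto
  also have "(\<Sum>j=1..2. ?h j) = f + g"
  proof -
    have "{1..2::nat} = {1, 2}"
      by auto
    then show ?thesis
      by simp
  qed
  finally show ?thesis .
qed

text \<open>For factor 0 the convention in \<open>epi_mult\<close> is exactly the conjugate of the
  zero function, which lets the expansion include zero coefficients.\<close>

lemma epi_mult_dual:
  fixes f :: "'a::euclidean_space \<Rightarrow> real"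
  assumes "c \<ge> 0"
  shows "epi_mult c (dual f) = dual (\<lambda>x. c * f x)"
proof
  fix y
  show "epi_mult c (dual f) y = dual (\<lambda>x. c * f x) y"
  proof (cases "c = 0")
    case True
    have "(\<forall>x. x \<bullet> y - s \<le> 0) \<longleftrightarrow> y = 0 \<and> 0 \<le> s" for s
    proof
      assume *: "\<forall>x. x \<bullet> y - s \<le> 0"
      have "y = 0"
      proof (rule ccontr)
        assume "y \<noteq> 0"
        then show False
          using spec[OF *, of "((\<bar>s\<bar> + 1) / (y \<bullet> y)) *\<^sub>R y"] by simp
      qed
      then show "y = 0 \<and> 0 \<le> s"
        using * by simp
    qed auto
    then show ?thesis
      using True by (intro eq_ereal_by_real_bounds) (simp add: epi_mult_def dual_le_iff)
  next
    case False
    then have c: "c > 0"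
      using assms by simp
    have "ereal c * dual f (y /\<^sub>R c) \<le> ereal s \<longleftrightarrow> dual (\<lambda>x. c * f x) y \<le> ereal s" for s
    proof -
      have "ereal c * dual f (y /\<^sub>R c) \<le> ereal s \<longleftrightarrow> dual f (y /\<^sub>R c) \<le> ereal (s / c)"
        using c by (cases "dual f (y /\<^sub>R c)") (auto simp: field_simps)
      also have "\<dots> \<longleftrightarrow> dual (\<lambda>x. c * f x) y \<le> ereal s"
        unfolding dual_le_iff using c by (simp add: field_simps)
      finally show ?thesis .
    qed
    then show ?thesis
      using c by (intro eq_ereal_by_real_bounds) (simp add: epi_mult_def)
  qed
qed

text \<open>Together with \<open>dual_add_const\<close> this turns epi-translations into affine
  summands of the conjugate.\<close>

lemma dual_translate: "dual f (x - a) = dual (\<lambda>y. f y + a \<bullet> y) x"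
  unfolding dual_def by (intro SUP_cong refl) (simp add: inner_diff_right inner_commute)

lemma dual_add_const: "dual f x + ereal b = dual (\<lambda>y. f y - b) x"
proof (rule eq_ereal_by_real_bounds)
  fix s
  have "dual f x + ereal b \<le> ereal s \<longleftrightarrow> dual f x \<le> ereal (s - b)"
    by (cases "dual f x") auto
  then show "dual f x + ereal b \<le> ereal s \<longleftrightarrow> dual (\<lambda>y. f y - b) x \<le> ereal s"
    by (simp add: dual_le_iff algebra_simps)
qed

section \<open>Localization of iterated differences\<close>

lemma cont_converges_const:
  fixes f :: "'a::euclidean_space \<Rightarrow> real"
  shows "convex_on UNIV f \<Longrightarrow> cont_converges (\<lambda>_. f) f"
  unfolding cont_converges_def
  using continuous_on_tendsto_compose[OF convex_continuous] by auto

lemma cont_converges_add: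
  "cont_converges fs f \<Longrightarrow> cont_converges gs g \<Longrightarrow> cont_converges (\<lambda>k. fs k + gs k) (f + g)"
  unfolding cont_converges_def by (auto intro: tendsto_add)

text \<open>Dini's argument: one continuous term \<open>fs N\<close> gives the lower estimate near
  \<open>x\<close>, and \<open>f\<close> itself the upper one.\<close>

lemma cont_converges_incseq:
  fixes f :: "'a::euclidean_space \<Rightarrow> real"
  assumes fs: "\<And>k. continuous_on UNIV (fs k)" and f: "continuous_on UNIV f"
    and mono: "\<And>x. incseq (\<lambda>k. fs k x)" and lim: "\<And>x. (\<lambda>k. fs k x) \<longlonglongrightarrow> f x"
  shows "cont_converges fs f"
  unfolding cont_converges_def
proof (intro allI impI)
  fix x :: 'a and xs assume xs: "xs \<longlonglongrightarrow> x"
  have le: "fs k y \<le> f y" for k y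
    using mono lim by (rule incseq_le)
  have at: "(\<lambda>k. h (xs k)) \<longlonglongrightarrow> h x" if "continuous_on UNIV h" for h :: "'a \<Rightarrow> real"
    using continuous_on_tendsto_compose[OF that xs] by simp
  show "(\<lambda>k. fs k (xs k)) \<longlonglongrightarrow> f x"
  proof (rule order_tendstoI)
    fix a assume "a < f x"
    then obtain N where N: "a < fs N x"
      using order_tendstoD(1)[OF lim[of x]] unfolding eventually_sequentially by blast
    have "eventually (\<lambda>k. a < fs N (xs k)) sequentially"
      using order_tendstoD(1)[OF at[OF fs] N] .
    then show "eventually (\<lambda>k. a < fs k (xs k)) sequentially"
      using eventually_ge_at_top[of N]
    proof eventually_elim
      case (elim k)
      then show ?case
        using incseqD[OF mono, of N k "xs k"] by linarith
    qed
  next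
    fix a assume "f x < a"
    then have "eventually (\<lambda>k. f (xs k) < a) sequentially"
      using order_tendstoD(2)[OF at[OF f]] by blast
    then show "eventually (\<lambda>k. fs k (xs k) < a) sequentially"
      by (rule eventually_mono) (use le le_less_trans in blast)
  qed
qed

lemma convex_on_pointwise_max:
  assumes "convex_on S f" "convex_on S g"
  shows "convex_on S (\<lambda>x. max (f x) (g x))"
  unfolding convex_on_def
proof (intro conjI ballI allI impI)
  show "convex S"
    using assms(1) unfolding convex_on_def by blast
  fix x y u v assume xy: "x \<in> S" "y \<in> S" and uv: "0 \<le> (u::real)" "0 \<le> v" "u + v = 1"
  have "f (u *\<^sub>R x + v *\<^sub>R y) \<le> u * f x + v * f y" "g (u *\<^sub>R x + v *\<^sub>R y) \<le> u * g x + v * g y"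
    using assms xy uv unfolding convex_on_def by blast+
  moreover have "u * f x \<le> u * max (f x) (g x)" "u * g x \<le> u * max (f x) (g x)"
    "v * f y \<le> v * max (f y) (g y)" "v * g y \<le> v * max (f y) (g y)"
    using uv by (auto intro: mult_left_mono)
  ultimately show "max (f (u *\<^sub>R x + v *\<^sub>R y)) (g (u *\<^sub>R x + v *\<^sub>R y))
      \<le> u * max (f x) (g x) + v * max (f y) (g y)"
    by (auto intro: order_trans)
qed

lemma convex_on_affine: "convex_on UNIV (\<lambda>x. a \<bullet> x + b :: real)"
proof (rule convex_onI)
  fix t :: real and x y assume "0 < t" "t < 1"
  then show "a \<bullet> ((1 - t) *\<^sub>R x + t *\<^sub>R y) + b \<le> (1 - t) * (a \<bullet> x + b) + t * (a \<bullet> y + b)"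
    by (simp add: inner_add_right algebra_simps)
qed auto

lemma convex_on_add_affine: "convex_on UNIV f \<Longrightarrow> convex_on UNIV (\<lambda>x. f x + (a \<bullet> x + b))"
  by (intro convex_on_add convex_on_affine)

lemma convex_on_sq: "e \<ge> 0 \<Longrightarrow> convex_on UNIV (\<lambda>x::'a::real_inner. e * (x \<bullet> x))"
  using convex_on_quadratic[of e 0 0] by simp

lemma convex_on_limit:
  assumes "\<And>k. convex_on UNIV (fs k)" "\<And>x. (\<lambda>k. fs k x) \<longlonglongrightarrow> (f x :: real)"
  shows "convex_on UNIV f"
proof (rule convex_onI)
  fix t :: real and x y assume t: "0 < t" "t < 1"
  show "f ((1 - t) *\<^sub>R x + t *\<^sub>R y) \<le> (1 - t) * f x + t * f y"
  proof (rule LIMSEQ_le)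
    show "(\<lambda>k. fs k ((1 - t) *\<^sub>R x + t *\<^sub>R y)) \<longlonglongrightarrow> f ((1 - t) *\<^sub>R x + t *\<^sub>R y)"
      by (rule assms(2))
    show "(\<lambda>k. (1 - t) * fs k x + t * fs k y) \<longlonglongrightarrow> (1 - t) * f x + t * f y"
      by (intro tendsto_intros assms(2))
    show "\<exists>N. \<forall>k\<ge>N. fs k ((1 - t) *\<^sub>R x + t *\<^sub>R y) \<le> (1 - t) * fs k x + t * fs k y"
      using t by (intro exI allI impI convex_onD[OF assms(1)]) auto
  qed
qed auto

text \<open>The affine piece has to stay below \<open>v\<close> everywhere, because the splitting
  into maximum and minimum in \<open>diff_op_local_Cons\<close> compares the two outside the ball as
  well.\<close>

definition supported_affinely :: "('a::euclidean_space \<Rightarrow> real) \<Rightarrow> 'a \<Rightarrow> real \<Rightarrow> bool" where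
  "supported_affinely v x r \<longleftrightarrow>
     (\<exists>a b. (\<forall>y\<in>ball x r. v y = a \<bullet> y + b) \<and> (\<forall>y. a \<bullet> y + b \<le> v y))"

locale convex_valuation =
  fixes Y :: "('a::euclidean_space \<Rightarrow> real) \<Rightarrow> real"
  assumes val: "\<lbrakk>convex_on UNIV f; convex_on UNIV g; convex_on UNIV (\<lambda>x. min (f x) (g x))\<rbrakk>
      \<Longrightarrow> Y (\<lambda>x. max (f x) (g x)) + Y (\<lambda>x. min (f x) (g x)) = Y f + Y g"
    and affine: "convex_on UNIV f \<Longrightarrow> Y (\<lambda>x. f x + (a \<bullet> x + b)) = Y f"
    and cts: "\<lbrakk>\<And>k. convex_on UNIV (fs k); convex_on UNIV f; cont_converges fs f\<rbrakk>
      \<Longrightarrow> (\<lambda>k. Y (fs k)) \<longlonglongrightarrow> Y f"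
begin

section \<open>Changing the base function of a difference\<close>

lemma diff_op_affine:
  assumes "convex_on UNIV w" "\<And>v. v \<in> set vs \<Longrightarrow> convex_on UNIV v"
  shows "diff_op Y vs (\<lambda>x. w x + (a \<bullet> x + b)) = diff_op Y vs w"
  using assms
proof (induction vs arbitrary: w)
  case (Cons v vs)
  have eq: "(\<lambda>x. w x + (a \<bullet> x + b)) + v = (\<lambda>x. (w + v) x + (a \<bullet> x + b))"
    by (auto simp: fun_eq_iff)
  have "convex_on UNIV (w + v)"
    using Cons.prems by (intro convex_on_plus) auto
  then show ?case
    using Cons.prems by (simp add: eq Cons.IH del: plus_fun_apply)
qed (simp add: affine)

lemma diff_op_cts:
  assumes "\<And>i. i \<in> set is \<Longrightarrow> cont_converges (\<lambda>k. V k i) (V' i)"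
    and "\<And>i k. i \<in> set is \<Longrightarrow> convex_on UNIV (V k i)" "\<And>i. i \<in> set is \<Longrightarrow> convex_on UNIV (V' i)"
    and "\<And>k. convex_on UNIV (ws k)" "convex_on UNIV w" "cont_converges ws w"
  shows "(\<lambda>k. diff_op Y (map (V k) is) (ws k)) \<longlonglongrightarrow> diff_op Y (map V' is) w"
  using assms
proof (induction "is" arbitrary: ws w)
  case (Cons i "is")
  have "(\<lambda>k. diff_op Y (map (V k) is) (ws k + V k i)) \<longlonglongrightarrow> diff_op Y (map V' is) (w + V' i)"
    using Cons.prems by (intro Cons.IH convex_on_plus cont_converges_add) auto
  moreover have "(\<lambda>k. diff_op Y (map (V k) is) (ws k)) \<longlonglongrightarrow> diff_op Y (map V' is) w"
    using Cons.prems by (intro Cons.IH) auto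
  ultimately show ?case
    by (simp add: tendsto_diff)
qed (simp add: cts)

lemma diff_op_cts_base:
  assumes "\<And>v. v \<in> set vs \<Longrightarrow> convex_on UNIV v"
    and "\<And>k. convex_on UNIV (ws k)" "convex_on UNIV w" "cont_converges ws w"
  shows "(\<lambda>k. diff_op Y vs (ws k)) \<longlonglongrightarrow> diff_op Y vs w"
proof -
  have "(\<lambda>k. diff_op Y (map (\<lambda>v. v) vs) (ws k)) \<longlonglongrightarrow> diff_op Y (map (\<lambda>v. v) vs) w"
    using assms by (intro diff_op_cts[where V = "\<lambda>k v. v"] cont_converges_const) auto
  then show ?thesis
    by simp
qed

text \<open>Let l be the affine piece of \<open>v\<close>. On \<open>A\<close> one has v = l and w
  <= h, off \<open>A\<close> one has h = w and l <= v; hence h + l and w + v have maximum h + v and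
  minimum w + l. The valuation identity and affine invariance then equate the differences at
  \<open>h\<close> and \<open>w\<close>. Further directions are added to \<open>h\<close> and
  \<open>w\<close> alike.\<close>

lemma diff_op_local_Cons:
  assumes "convex_on UNIV w" "convex_on UNIV h" "\<And>x. w x \<le> h x" "\<And>x. x \<notin> A \<Longrightarrow> h x = w x"
    and v: "convex_on UNIV v" "\<And>x. x \<in> A \<Longrightarrow> v x = a \<bullet> x + b" "\<And>x. a \<bullet> x + b \<le> v x"
    and "\<And>g. g \<in> set gs \<Longrightarrow> convex_on UNIV g"
  shows "diff_op Y (v # gs) h = diff_op Y (v # gs) w"
  using assms(1-4) assms(8)
proof (induction gs arbitrary: w h)
  case Nil
  let ?l = "\<lambda>x. a \<bullet> x + b"
  let ?P = "\<lambda>x. h x + ?l x" and ?Q = "w + v"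
  have v_le: "v x = ?l x \<or> h x = w x" for x
    using v(2) Nil(4) by blast
  have "max (?P x) (?Q x) = (h + v) x \<and> min (?P x) (?Q x) = w x + ?l x" for x
    using v_le[of x] v(3)[of x] Nil(3)[of x] by auto
  then have mx: "(\<lambda>x. max (?P x) (?Q x)) = h + v" and mn: "(\<lambda>x. min (?P x) (?Q x)) = (\<lambda>x. w x + ?l x)"
    by blast+
  have "Y (h + v) + Y (\<lambda>x. w x + ?l x) = Y ?P + Y ?Q"
    unfolding mx[symmetric] mn[symmetric]
    by (rule val) (use Nil(1,2) v(1) in \<open>auto simp: mn simp del: plus_fun_apply intro!: convex_on_plus convex_on_add_affine\<close>)
  then show ?case
    using affine[OF Nil(1)] affine[OF Nil(2)] by simp
next
  case (Cons g gs)
  have g: "convex_on UNIV g"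
    using Cons.prems by simp
  have "diff_op Y (v # gs) (h + g) = diff_op Y (v # gs) (w + g)"
    using Cons.prems g by (intro Cons.IH convex_on_plus) auto
  moreover have "diff_op Y (v # gs) h = diff_op Y (v # gs) w"
    using Cons.prems by (intro Cons.IH) auto
  ultimately show ?case
    by (simp add: ac_simps)
qed

lemma diff_op_local:
  assumes "convex_on UNIV w" "convex_on UNIV h" "\<And>x. w x \<le> h x" "\<And>x. x \<notin> ball z r \<Longrightarrow> h x = w x"
    and vs: "v \<in> set vs" "supported_affinely v z r" "\<And>v. v \<in> set vs \<Longrightarrow> convex_on UNIV v"
  shows "diff_op Y vs h = diff_op Y vs w"
proof -
  obtain as bs where split: "vs = as @ v # bs"
    using vs(1) by (meson split_list)
  obtain a b where ab: "\<forall>y\<in>ball z r. v y = a \<bullet> y + b" "\<forall>y. a \<bullet> y + b \<le> v y"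
    using vs(2) unfolding supported_affinely_def by blast
  show ?thesis
    unfolding split diff_op_append_Cons
    by (rule diff_op_local_Cons[where A = "ball z r" and a = a and b = b])
      (use assms(1-4) ab vs(3) split in auto)
qed

text \<open>
  \<open>g\<close> is the supremum of \<open>f\<close> and countably many tangents of \<open>g\<close>. By strong convexity of \<open>g\<close> a
  tangent exceeds \<open>f\<close> only within distance \<open>r\<close> of its point of contact, so the tangents can be
  inserted one at a time by local changes.
\<close>

lemma diff_op_small_increase:
  assumes vs: "\<And>v. v \<in> set vs \<Longrightarrow> convex_on UNIV v"
    and f: "convex_on UNIV f" and g: "convex_on UNIV (\<lambda>x. g x - e * (x \<bullet> x))" and e: "e \<ge> 0"
    and fg: "\<And>x. f x \<le> g x" "\<And>x. g x \<le> f x + e * r\<^sup>2" "\<And>x. x \<notin> C \<Longrightarrow> f x = g x"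
    and r: "r \<ge> 0" "\<And>x. x \<in> C \<Longrightarrow> \<exists>v\<in>set vs. supported_affinely v x r"
  shows "diff_op Y vs g = diff_op Y vs f"
proof (cases "C = {}")
  case True
  then have "f = g"
    using fg(3) by auto
  then show ?thesis
    by simp
next
  case False
  have g_convex: "convex_on UNIV g"
    using convex_on_add[OF g convex_on_sq[OF e]] by simp
  have "\<exists>a. \<forall>y. g x + a \<bullet> (y - x) + e * ((y - x) \<bullet> (y - x)) \<le> g y" for x
  proof -
    obtain p where p: "\<And>y. g x - e * (x \<bullet> x) + p \<bullet> (y - x) \<le> g y - e * (y \<bullet> y)"
      using convex_subgradient[OF g] by blast
    have "g x + (p + (2 * e) *\<^sub>R x) \<bullet> (y - x) + e * ((y - x) \<bullet> (y - x)) \<le> g y" for y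
      using p[of y] by (simp add: inner_add_left inner_diff_left inner_diff_right inner_commute algebra_simps)
    then show ?thesis
      by blast
  qed
  then obtain a where a: "\<And>x y. g x + a x \<bullet> (y - x) + e * ((y - x) \<bullet> (y - x)) \<le> g y"
    by metis
  define l where "l x y = a x \<bullet> y + (g x - a x \<bullet> x)" for x y
  have l_le: "l x y + e * ((y - x) \<bullet> (y - x)) \<le> g y" for x y
    using a[of x y] unfolding l_def by (simp add: inner_diff_right)
  obtain T where T: "countable T" "T \<subseteq> C" "C \<subseteq> closure T"
    using separable by blast
  have "T \<noteq> {}"
    using False T(3) by auto
  define xs where "xs = from_nat_into T"
  have xs: "range xs = T"
    unfolding xs_def using range_from_nat_into[OF \<open>T \<noteq> {}\<close> T(1)] .
  define F where "F = rec_nat f (\<lambda>j h x. max (h x) (l (xs j) x))"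
  have F0: "F 0 = f" and FS: "F (Suc j) = (\<lambda>x. max (F j x) (l (xs j) x))" for j
    unfolding F_def by simp_all
  have F_convex: "convex_on UNIV (F j)" for j
    by (induction j) (auto simp: F0 FS f l_def[abs_def] intro!: convex_on_pointwise_max convex_on_affine)
  have sq: "0 \<le> e * ((y - x) \<bullet> (y - x))" for x y :: 'a
    using e by simp
  have F_le: "F j x \<le> g x" for j x
  proof (induction j)
    case (Suc j)
    then show ?case
      using l_le[of "xs j" x] sq[of x "xs j"] unfolding FS by simp
  qed (simp add: F0 fg(1))
  have F_ge: "f x \<le> F j x" for j x
    by (induction j) (auto simp: F0 FS)
  have step: "diff_op Y vs (F (Suc j)) = diff_op Y vs (F j)" for j
  proof -
    have "xs j \<in> C"
      using xs T(2) by blast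
    then obtain v where v: "v \<in> set vs" "supported_affinely v (xs j) r"
      using r(2) by blast
    have off: "F (Suc j) x = F j x" if "x \<notin> ball (xs j) r" for x
    proof -
      have "r\<^sup>2 \<le> (norm (x - xs j))\<^sup>2"
        using that r(1) by (intro power_mono) (auto simp: dist_norm norm_minus_commute)
      then have "e * r\<^sup>2 \<le> e * ((x - xs j) \<bullet> (x - xs j))"
        using e by (intro mult_left_mono) (auto simp: power2_norm_eq_inner)
      then have "l (xs j) x \<le> F j x"
        using l_le[of "xs j" x] fg(2)[of x] F_ge[of x j] by linarith
      then show ?thesis
        by (simp add: FS)
    qed
    show ?thesis
      by (rule diff_op_local[OF F_convex F_convex _ off v vs]) (auto simp: FS)
  qed
  have "diff_op Y vs (F j) = diff_op Y vs f" for j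
    by (induction j) (simp_all add: F0 step)
  moreover have "cont_converges F g"
  proof -
    define G where "G x = (SUP j. F j x)" for x
    have mono: "incseq (\<lambda>j. F j x)" for x
      by (rule incseq_SucI) (simp add: FS)
    have bdd: "bdd_above (range (\<lambda>j. F j x))" for x
      using F_le by (intro bdd_aboveI2)
    have lim: "(\<lambda>j. F j x) \<longlonglongrightarrow> G x" for x
      unfolding G_def by (rule LIMSEQ_incseq_SUP[OF bdd mono])
    have G_convex: "convex_on UNIV G"
      using F_convex lim by (rule convex_on_limit)
    have G_le: "G x \<le> g x" for x
      using F_le by (intro LIMSEQ_le_const2[OF lim]) auto
    have F_G: "F j x \<le> G x" for j x
      using mono lim by (rule incseq_le)
    have "T \<subseteq> {x. G x = g x}"
    proof
      fix x assume "x \<in> T"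
      then obtain j where j: "x = xs j"
        using xs by blast
      have "g x = l (xs j) x"
        unfolding l_def j by simp
      also have "\<dots> \<le> F (Suc j) x"
        by (simp add: FS)
      also have "\<dots> \<le> G x"
        by (rule F_G)
      finally show "x \<in> {x. G x = g x}"
        using G_le[of x] by simp
    qed
    \<comment> \<open>\<open>G\<close> is convex, hence continuous, so agreement with
      \<open>g\<close> at the dense points of contact extends to all of \<open>C\<close>.\<close>
    moreover have "closed {x. G x = g x}"
      by (intro closed_Collect_eq convex_continuous G_convex g_convex)
    ultimately have "C \<subseteq> {x. G x = g x}"
      using T(3) closure_minimal by blast
    moreover have "G x = g x" if "x \<notin> C" for x
      using fg(3)[OF that] F_G[of 0 x] G_le[of x] by (simp add: F0)
    ultimately have "G = g"
      by auto
    then show ?thesis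
      using lim by (intro cont_converges_incseq mono convex_continuous F_convex g_convex) simp
  qed
  then have "(\<lambda>j. diff_op Y vs (F j)) \<longlonglongrightarrow> diff_op Y vs g"
    using vs by (intro diff_op_cts_base F_convex g_convex)
  ultimately show ?thesis
    by (simp add: LIMSEQ_const_iff)
qed

lemma supported_affinely_mono: "supported_affinely v x r \<Longrightarrow> ball y s \<subseteq> ball x r \<Longrightarrow> supported_affinely v y s"
  unfolding supported_affinely_def by blast

text \<open>A Lebesgue number argument: points of \<open>C\<close> without support at radii tending
  to 0 would accumulate at a point whose own supporting ball contains their balls.\<close>

lemma uniform_support_radius:
  assumes "compact C" and loc: "\<And>x. \<exists>v\<in>V. \<exists>r>0. supported_affinely v x r"
  obtains r where "r > 0" "\<And>x. x \<in> C \<Longrightarrow> \<exists>v\<in>V. supported_affinely v x r"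
proof -
  have "\<exists>r>0. \<forall>x\<in>C. \<exists>v\<in>V. supported_affinely v x r"
  proof (rule ccontr)
    assume "\<not> ?thesis"
    then have "\<exists>x\<in>C. \<forall>v\<in>V. \<not> supported_affinely v x (1 / real (Suc k))" for k
      by (metis divide_pos_pos of_nat_0_less_iff zero_less_Suc zero_less_one)
    then obtain xs where xs: "\<And>k. xs k \<in> C" "\<And>k v. v \<in> V \<Longrightarrow> \<not> supported_affinely v (xs k) (1 / real (Suc k))"
      by metis
    obtain x s where s: "strict_mono s" "(xs \<circ> s) \<longlonglongrightarrow> x"
      using \<open>compact C\<close> xs(1) unfolding compact_def by meson
    obtain v r where v: "v \<in> V" "r > 0" "supported_affinely v x r"
      using loc by blast
    have "eventually (\<lambda>k. dist ((xs \<circ> s) k) x < r / 2) sequentially"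
      using v(2) by (intro tendstoD[OF s(2)]) simp
    moreover have "(\<lambda>k. 1 / real (Suc (s k))) \<longlonglongrightarrow> 0"
      using LIMSEQ_subseq_LIMSEQ[OF LIMSEQ_inverse_real_of_nat s(1)] by (simp add: comp_def inverse_eq_divide)
    then have "eventually (\<lambda>k. 1 / real (Suc (s k)) < r / 2) sequentially"
      using v(2) by (intro order_tendstoD(2)) auto
    ultimately have "eventually (\<lambda>k. False) sequentially"
    proof eventually_elim
      case (elim k)
      have "ball (xs (s k)) (1 / real (Suc (s k))) \<subseteq> ball x r"
      proof
        fix y assume "y \<in> ball (xs (s k)) (1 / real (Suc (s k)))"
        then have "dist (xs (s k)) y < r / 2"
          using elim(2) by simp
        moreover have "dist (xs (s k)) x < r / 2"
          using elim(1) by simp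
        ultimately show "y \<in> ball x r"
          using dist_triangle[of x y "xs (s k)"] by (simp add: dist_commute)
      qed
      then show False
        using supported_affinely_mono[OF v(3)] xs(2)[OF v(1)] by blast
    qed
    then show False
      by simp
  qed
  then show ?thesis
    using that by blast
qed

text \<open>Up to a constant, \<open>v\<close> differs from its truncation \<open>H c\<close> only
  on the compact set where \<open>v\<close> is at most \<open>c\<close>, and by at most
  \<open>c\<close>. Many small steps of \<open>diff_op_small_increase\<close> bridge this gap, and
  \<open>H c\<close> tends to 0 as \<open>c\<close> grows.\<close>

lemma diff_op_add_coercive:
  assumes vs: "\<And>v. v \<in> set vs \<Longrightarrow> convex_on UNIV v"
    and loc: "\<And>x. \<exists>v\<in>set vs. \<exists>r>0. supported_affinely v x r"
    and w: "convex_on UNIV (\<lambda>x. w x - e * (x \<bullet> x))" and e: "e > 0"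
    and v: "convex_on UNIV v" "\<And>x. 0 \<le> v x" "\<And>c. bounded {x. v x \<le> c}"
  shows "diff_op Y vs (w + v) = diff_op Y vs w"
proof -
  have w_convex: "convex_on UNIV w"
    using convex_on_add[OF w convex_on_sq[of e]] e by simp
  define H where "H c x = max (v x - c) 0" for c x
  have vc: "convex_on UNIV (\<lambda>x. v x - c)" for c
    using convex_on_add_affine[OF v(1), of 0 "- c"] by simp
  have H: "convex_on UNIV (H c)" for c
    unfolding H_def using convex_on_pointwise_max[OF vc convex_on_affine[of 0 0]] by simp
  have H_ge: "v x - c \<le> H c x" for x c
    unfolding H_def by simp
  have eq: "diff_op Y vs (w + H c) = diff_op Y vs (w + v)" if "c > 0" for c
  proof -
    have "compact {x. v x \<le> c}"
      using v(3) convex_continuous[OF v(1)]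
      by (auto simp: compact_eq_bounded_closed intro!: closed_Collect_le continuous_intros)
    then obtain r where r: "r > 0" "\<And>x. v x \<le> c \<Longrightarrow> \<exists>v\<in>set vs. supported_affinely v x r"
      using uniform_support_radius[OF _ loc] by (metis mem_Collect_eq)
    have "e * r\<^sup>2 > 0"
      using e r(1) by simp
    \<comment> \<open>The total increase is at most \<open>c\<close>; cut into \<open>N\<close>
      equal parts it stays below the height \<open>e * r\<^sup>2\<close> allowed in one
      step.\<close>
    then obtain N :: nat where N: "N > 0" "c / real N < e * r\<^sup>2"
    proof -
      obtain N :: nat where "c / (e * r\<^sup>2) < real N"
        using reals_Archimedean2 by blast
      then have "c / (e * r\<^sup>2) < real (Suc N)"
        by simp
      then have "c < real (Suc N) * (e * r\<^sup>2)"
        using \<open>e * r\<^sup>2 > 0\<close> by (simp only: pos_divide_less_eq)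
      then have "c / real (Suc N) < e * r\<^sup>2"
        by (simp only: pos_divide_less_eq of_nat_0_less_iff zero_less_Suc mult.commute)
      then show ?thesis
        using that[of "Suc N"] by simp
    qed
    \<comment> \<open>Interpolates between \<open>w + v - c\<close> and \<open>w + H c\<close>; the
      constant is absorbed by affine invariance.\<close>
    define W where "W t x = w x + ((1 - t) * (v x - c) + t * H c x)" for t x
    have W_diff: "W (t + d) x = W t x + d * (H c x - (v x - c))" for t d x
      unfolding W_def by (simp add: algebra_simps)
    have mix: "convex_on UNIV (\<lambda>x. (1 - t) * (v x - c) + t * H c x)" if "0 \<le> t" "t \<le> 1" for t
      using that by (intro convex_on_add convex_on_cmul vc H) auto
    have step: "diff_op Y vs (W (real (Suc j) / real N)) = diff_op Y vs (W (real j / real N))" if "j < N" for j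
    proof (rule diff_op_small_increase[where e = e and r = r and C = "{x. v x \<le> c}"])
      let ?s = "real j / real N" and ?t = "real (Suc j) / real N"
      have st: "0 \<le> ?s" "?s \<le> 1" "0 \<le> ?t" "?t \<le> 1" "?t = ?s + 1 / real N"
      proof -
        have "real j \<le> real N" "real (Suc j) \<le> real N"
          using that by auto
        then show "?s \<le> 1" "?t \<le> 1"
          using N(1) by (simp_all only: divide_le_eq_1_pos of_nat_0_less_iff)
      qed (simp_all add: add_divide_distrib)
      show "convex_on UNIV (W ?s)"
        unfolding W_def using st by (intro convex_on_add w_convex mix)
      have "(\<lambda>x. W ?t x - e * (x \<bullet> x)) = (\<lambda>x. (w x - e * (x \<bullet> x)) + ((1 - ?t) * (v x - c) + ?t * H c x))"
        by (simp add: W_def algebra_simps)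
      moreover have "convex_on UNIV \<dots>"
        using st by (intro convex_on_add w mix)
      ultimately show "convex_on UNIV (\<lambda>x. W ?t x - e * (x \<bullet> x))"
        by simp
      have diff: "W ?t x = W ?s x + 1 / real N * (H c x - (v x - c))" for x
        unfolding st(5) by (rule W_diff)
      show "W ?s x \<le> W ?t x" for x
        unfolding diff using H_ge[of x c] by simp
      have "H c x - (v x - c) \<le> c" for x
        using v(2)[of x] \<open>c > 0\<close> unfolding H_def by auto
      then have "1 / real N * (H c x - (v x - c)) \<le> 1 / real N * c" for x
        by (intro mult_left_mono) auto
      then show "W ?t x \<le> W ?s x + e * r\<^sup>2" for x
      proof -
        have "1 / real N * c < e * r\<^sup>2"
          using N(2) by simp
        then show ?thesis
          unfolding diff using \<open>1 / real N * (H c x - (v x - c)) \<le> 1 / real N * c\<close> by linarith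
      qed
      show "W ?s x = W ?t x" if "x \<notin> {x. v x \<le> c}" for x
      proof -
        have "H c x - (v x - c) = 0"
          using that by (simp add: H_def)
        then show ?thesis
          by (simp only: diff mult_zero_right add_0_right)
      qed
    qed (use vs e r in auto)
    have "diff_op Y vs (W (real j / real N)) = diff_op Y vs (W 0)" if "j \<le> N" for j
      using that
    proof (induction j)
      case (Suc j)
      then show ?case
        using step[of j] by simp
    qed simp
    from this[of N] have "diff_op Y vs (W 1) = diff_op Y vs (W 0)"
      using N(1) by simp
    moreover have "W 1 = w + H c"
      by (simp add: W_def fun_eq_iff)
    moreover have "W 0 = (\<lambda>x. (w + v) x + (0 \<bullet> x + - c))"
      by (simp add: W_def fun_eq_iff)
    moreover have "diff_op Y vs (\<lambda>x. (w + v) x + (0 \<bullet> x + - c)) = diff_op Y vs (w + v)"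
      using vs by (intro diff_op_affine convex_on_plus w_convex v(1))
    ultimately show ?thesis
      by metis
  qed
  \<comment> \<open>Along a convergent sequence \<open>v\<close> is bounded, so the truncation is
    eventually zero there.\<close>
  have "cont_converges (\<lambda>k. w + H (real (Suc k))) w"
    unfolding cont_converges_def
  proof (intro allI impI)
    fix x xs assume xs: "xs \<longlonglongrightarrow> (x::'a)"
    have cont: "(\<lambda>k. h (xs k)) \<longlonglongrightarrow> h x" if "convex_on UNIV h" for h :: "'a \<Rightarrow> real"
      using continuous_on_tendsto_compose[OF convex_continuous[OF that] xs] by simp
    have ev: "eventually (\<lambda>k. v (xs k) < v x + 1) sequentially"
      by (rule order_tendstoD(2)[OF cont[OF v(1)]]) simp
    obtain K where K: "v x + 1 \<le> real K"
      using real_arch_simple by blast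
    from ev eventually_ge_at_top[of K]
    have "eventually (\<lambda>k. w (xs k) = (w + H (real (Suc k))) (xs k)) sequentially"
    proof eventually_elim
      case (elim k)
      then have "real K \<le> real k"
        by simp
      then have "v (xs k) \<le> real (Suc k)"
        using elim(1) K by simp
      then show ?case
        unfolding H_def by simp
    qed
    then show "(\<lambda>k. (w + H (real (Suc k))) (xs k)) \<longlonglongrightarrow> w x"
      by (rule Lim_transform_eventually[OF cont[OF w_convex]])
  qed
  then have "(\<lambda>k. diff_op Y vs (w + H (real (Suc k)))) \<longlonglongrightarrow> diff_op Y vs w"
    using vs by (intro diff_op_cts_base convex_on_plus w_convex H)
  then show ?thesis
    by (simp add: eq LIMSEQ_const_iff)
qed

text \<open>Adding the squared norm and an affine term makes \<open>v\<close> coercive, and the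
  squared norm is coercive itself; comparing both additions eliminates it. Strong convexity of the
  base is supplied by multiples of the squared norm that tend to 0.\<close>

lemma diff_op_base_independent:
  assumes vs: "\<And>v. v \<in> set vs \<Longrightarrow> convex_on UNIV v"
    and loc: "\<And>x. \<exists>v\<in>set vs. \<exists>r>0. supported_affinely v x r"
    and w: "convex_on UNIV w" and v: "convex_on UNIV v"
  shows "diff_op Y vs (w + v) = diff_op Y vs w"
proof -
  let ?q = "\<lambda>x::'a. x \<bullet> x"
  have q: "convex_on UNIV ?q"
    using convex_on_sq[of 1] by simp
  have q_bounded: "bounded {x::'a. x \<bullet> x \<le> c}" for c
  proof (rule boundedI)
    fix x :: 'a assume "x \<in> {x. x \<bullet> x \<le> c}"
    then have "(norm x)\<^sup>2 \<le> c"
      by (simp add: power2_norm_eq_inner)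
    then show "norm x \<le> sqrt c"
      by (rule real_le_rsqrt)
  qed
  obtain a where a: "\<And>x. v 0 + a \<bullet> (x - 0) \<le> v x"
    using convex_subgradient[OF v] by blast
  \<comment> \<open>Chosen to complete the square after \<open>v\<close> is bounded below by its
    tangent at 0; half of the squared norm is left over for coercivity.\<close>
  define M where "M = a \<bullet> a - v 0"
  have lower: "(1 / 2) * (x \<bullet> x) \<le> (v + ?q) x + (0 \<bullet> x + M)" for x
  proof -
    have "0 \<le> (1/2) * ((x + a) \<bullet> (x + a)) + (1/2) * (a \<bullet> a)"
      by simp
    also have "\<dots> = (1/2) * (x \<bullet> x) + a \<bullet> x + a \<bullet> a"
      by (simp add: inner_add_left inner_add_right inner_commute algebra_simps)
    finally show ?thesis
      using a[of x] unfolding M_def by simp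
  qed
  have eq: "diff_op Y vs (w' + v) = diff_op Y vs w'" if w': "convex_on UNIV (\<lambda>x. w' x - e * (x \<bullet> x))" and e: "e > 0" for w' e
  proof -
    have w'_convex: "convex_on UNIV w'"
      using convex_on_add[OF w' convex_on_sq[of e]] e by simp
    have "diff_op Y vs w' = diff_op Y vs (w' + (\<lambda>x. (v + ?q) x + (0 \<bullet> x + M)))"
    proof (rule diff_op_add_coercive[OF vs loc w' e, symmetric])
      show "convex_on UNIV (\<lambda>x. (v + ?q) x + (0 \<bullet> x + M))"
        by (intro convex_on_add_affine convex_on_plus v q)
      show "0 \<le> (v + ?q) x + (0 \<bullet> x + M)" for x
        using lower[of x] inner_ge_zero[of x] by linarith
      show "bounded {x. (v + ?q) x + (0 \<bullet> x + M) \<le> c}" for c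
      proof (rule bounded_subset[OF q_bounded[of "2 * c"]])
        show "{x. (v + ?q) x + (0 \<bullet> x + M) \<le> c} \<subseteq> {x. x \<bullet> x \<le> 2 * c}"
        proof
          fix x assume "x \<in> {x. (v + ?q) x + (0 \<bullet> x + M) \<le> c}"
          then show "x \<in> {x. x \<bullet> x \<le> 2 * c}"
            using lower[of x] by simp
        qed
      qed
    qed
    also have "w' + (\<lambda>x. (v + ?q) x + (0 \<bullet> x + M)) = (\<lambda>x. (w' + v + ?q) x + (0 \<bullet> x + M))"
      by (simp add: fun_eq_iff)
    also have "diff_op Y vs \<dots> = diff_op Y vs (w' + v + ?q)"
      using vs by (intro diff_op_affine convex_on_plus w'_convex v q)
    also have "\<dots> = diff_op Y vs (w' + v)"
    proof (rule diff_op_add_coercive[OF vs loc _ e])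
      have "(\<lambda>x. (w' + v) x - e * (x \<bullet> x)) = (\<lambda>x. (w' x - e * (x \<bullet> x)) + v x)"
        by (simp add: fun_eq_iff)
      then show "convex_on UNIV (\<lambda>x. (w' + v) x - e * (x \<bullet> x))"
        using convex_on_add[OF w' v] by simp
    qed (auto simp: q q_bounded)
    finally show ?thesis
      by simp
  qed
  define E where "E k x = (1 / real (Suc k)) * (x \<bullet> x)" for k and x :: 'a
  have E: "convex_on UNIV (E k)" for k
    unfolding E_def by (intro convex_on_sq) simp
  have E0: "cont_converges E 0"
    unfolding cont_converges_def
  proof (intro allI impI)
    fix x xs assume xs: "xs \<longlonglongrightarrow> (x::'a)"
    have "(\<lambda>k. (1 / real (Suc k)) * (xs k \<bullet> xs k)) \<longlonglongrightarrow> 0 * (x \<bullet> x)"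
      using LIMSEQ_inverse_real_of_nat by (intro tendsto_intros xs) (simp add: inverse_eq_divide)
    then show "(\<lambda>k. E k (xs k)) \<longlonglongrightarrow> 0 x"
      by (simp add: E_def)
  qed
  have lim: "(\<lambda>k. diff_op Y vs (h + E k)) \<longlonglongrightarrow> diff_op Y vs h" if h: "convex_on UNIV h" for h
  proof -
    have "cont_converges (\<lambda>k. h + E k) (h + 0)"
      by (intro cont_converges_add cont_converges_const E0 h)
    then show ?thesis
      using vs h E by (intro diff_op_cts_base convex_on_plus) auto
  qed
  have "diff_op Y vs (w + v + E k) = diff_op Y vs (w + E k)" for k
  proof -
    have "diff_op Y vs ((w + E k) + v) = diff_op Y vs (w + E k)"
      by (rule eq[of _ "1 / real (Suc k)"]) (simp_all add: E_def w)
    then show ?thesis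
      by (simp add: ac_simps)
  qed
  then show ?thesis
    using lim[OF convex_on_plus[OF w v]] lim[OF w] LIMSEQ_unique by simp
qed

end

section \<open>Piecewise affine functions in general position\<close>

definition max_affine :: "('a::euclidean_space \<times> real) set \<Rightarrow> 'a \<Rightarrow> real" where
  "max_affine F x = Max ((\<lambda>(p, b). p \<bullet> x + b) ` F)"

lemma max_affine_ge: "finite F \<Longrightarrow> (p, b) \<in> F \<Longrightarrow> p \<bullet> x + b \<le> max_affine F x"
  unfolding max_affine_def by (rule Max_ge) force+

lemma max_affine_attained:
  assumes "finite F" "F \<noteq> {}"
  obtains p b where "(p, b) \<in> F" "max_affine F x = p \<bullet> x + b"
proof -
  have "max_affine F x \<in> (\<lambda>(p, b). p \<bullet> x + b) ` F"
    unfolding max_affine_def using assms by (intro Max_in) auto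
  then show ?thesis
    using that by auto
qed

lemma convex_on_max_affine_translate:
  assumes F: "finite F" "F \<noteq> {}"
  shows "convex_on UNIV (\<lambda>x. max_affine F (x - a))"
proof (rule convex_onI)
  fix t :: real and x y assume t: "0 < t" "t < 1"
  let ?z = "(1 - t) *\<^sub>R x + t *\<^sub>R y - a"
  obtain p b where p: "(p, b) \<in> F" "max_affine F ?z = p \<bullet> ?z + b"
    using max_affine_attained[OF F] by blast
  have "?z = (1 - t) *\<^sub>R (x - a) + t *\<^sub>R (y - a)"
    by (simp add: algebra_simps)
  then have "p \<bullet> ?z + b = (1 - t) * (p \<bullet> (x - a) + b) + t * (p \<bullet> (y - a) + b)"
    by (simp add: inner_add_right algebra_simps)
  also have "\<dots> \<le> (1 - t) * max_affine F (x - a) + t * max_affine F (y - a)"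
    using t max_affine_ge[OF F(1) p(1)] by (intro add_mono mult_left_mono) auto
  finally show "max_affine F ?z \<le> (1 - t) * max_affine F (x - a) + t * max_affine F (y - a)"
    using p(2) by simp
qed auto

text \<open>Without ties between different slopes, the active piece strictly dominates all pieces of
  other slopes at the point, hence also nearby. A piece of the same slope is dominated
  everywhere.\<close>

lemma max_affine_supported:
  assumes F: "finite F" "F \<noteq> {}"
    and x: "\<And>p b p' b'. (p, b) \<in> F \<Longrightarrow> (p', b') \<in> F \<Longrightarrow> p \<noteq> p'
      \<Longrightarrow> p \<bullet> (x - a) + b \<noteq> p' \<bullet> (x - a) + b'"
  shows "\<exists>r>0. supported_affinely (\<lambda>x. max_affine F (x - a)) x r"
proof -
  obtain p b where p: "(p, b) \<in> F" "max_affine F (x - a) = p \<bullet> (x - a) + b"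
    using max_affine_attained[OF F] by blast
  have "eventually (\<lambda>y. q \<bullet> (y - a) + c \<le> p \<bullet> (y - a) + b) (nhds x)" if qc: "(q, c) \<in> F" for q c
  proof (cases "q = p")
    case True
    then show ?thesis
      using max_affine_ge[OF F(1) qc, of "x - a"] p(2) by simp
  next
    case False
    then have lt: "q \<bullet> (x - a) + c < p \<bullet> (x - a) + b"
      using max_affine_ge[OF F(1) qc, of "x - a"] p(2) x[OF qc p(1)] by simp
    have "((\<lambda>y. q \<bullet> (y - a) + c) \<longlongrightarrow> q \<bullet> (x - a) + c) (nhds x)"
      "((\<lambda>y. p \<bullet> (y - a) + b) \<longlongrightarrow> p \<bullet> (x - a) + b) (nhds x)"
      by (intro tendsto_intros filterlim_ident)+
    then have "((\<lambda>y. (p \<bullet> (y - a) + b) - (q \<bullet> (y - a) + c)) \<longlongrightarrow>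
        (p \<bullet> (x - a) + b) - (q \<bullet> (x - a) + c)) (nhds x)"
      by (rule tendsto_diff[rotated])
    then have "eventually (\<lambda>y. 0 < (p \<bullet> (y - a) + b) - (q \<bullet> (y - a) + c)) (nhds x)"
      by (rule order_tendstoD) (use lt in simp)
    then show ?thesis
      by (rule eventually_mono) simp
  qed
  then have "eventually (\<lambda>y. \<forall>qc\<in>F. fst qc \<bullet> (y - a) + snd qc \<le> p \<bullet> (y - a) + b) (nhds x)"
    using F(1) by (intro eventually_ball_finite) auto
  then obtain r where r: "r > 0" "\<And>y qc. dist y x < r \<Longrightarrow> qc \<in> F \<Longrightarrow> fst qc \<bullet> (y - a) + snd qc \<le> p \<bullet> (y - a) + b"
    unfolding eventually_nhds_metric by blast
  have "max_affine F (y - a) = p \<bullet> y + (b - p \<bullet> a)" if y: "y \<in> ball x r" for y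
  proof -
    obtain q c where q: "(q, c) \<in> F" "max_affine F (y - a) = q \<bullet> (y - a) + c"
      using max_affine_attained[OF F] by blast
    have "q \<bullet> (y - a) + c \<le> p \<bullet> (y - a) + b"
      using r(2)[of y "(q, c)"] y q(1) by (simp add: dist_commute)
    then have "max_affine F (y - a) = p \<bullet> (y - a) + b"
      using max_affine_ge[OF F(1) p(1), of "y - a"] q(2) by linarith
    then show ?thesis
      by (simp add: inner_diff_right)
  qed
  moreover have "p \<bullet> y + (b - p \<bullet> a) \<le> max_affine F (y - a)" for y
    using max_affine_ge[OF F(1) p(1), of "y - a"] by (simp add: inner_diff_right)
  ultimately show ?thesis
    using r(1) unfolding supported_affinely_def by blast
qed

text \<open>Maxima over the first tangents at a dense sequence increase to a convex function that
  equals \<open>f\<close> on a dense set, hence everywhere; monotonicity upgrades this to continuous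
  convergence.\<close>

lemma convex_max_affine_approximation:
  fixes f :: "'a::euclidean_space \<Rightarrow> real"
  assumes f: "convex_on UNIV f"
  obtains F where "\<And>k::nat. finite (F k)" "\<And>k. F k \<noteq> {}" "cont_converges (\<lambda>k. max_affine (F k)) f"
proof -
  have "\<exists>a. \<forall>y. f x + a \<bullet> (y - x) \<le> f y" for x
    using convex_subgradient[OF f] by blast
  then obtain a where a: "\<And>x y. f x + a x \<bullet> (y - x) \<le> f y"
    by metis
  obtain T :: "'a set" where T: "countable T" "T \<subseteq> UNIV" "UNIV \<subseteq> closure T"
    by (rule separable)
  have "T \<noteq> {}"
    using T(3) by auto
  define xs where "xs = from_nat_into T"
  have xs: "range xs = T"
    unfolding xs_def using range_from_nat_into[OF \<open>T \<noteq> {}\<close> T(1)] .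
  define t where "t j = (a (xs j), f (xs j) - a (xs j) \<bullet> xs j)" for j
  define F where "F k = t ` {..k}" for k :: nat
  have fin: "finite (F k)" and ne: "F k \<noteq> {}" for k
    unfolding F_def by auto
  have conv: "convex_on UNIV (max_affine (F k))" for k
    using convex_on_max_affine_translate[OF fin ne, where a = 0] by simp
  have le: "max_affine (F k) x \<le> f x" for k x
  proof -
    obtain p b where p: "(p, b) \<in> F k" "max_affine (F k) x = p \<bullet> x + b"
      using max_affine_attained[OF fin ne] by blast
    then obtain j where "(p, b) = t j"
      unfolding F_def by auto
    then show ?thesis
      using p(2) a[of "xs j" x] by (simp add: t_def inner_diff_right)
  qed
  have mono: "incseq (\<lambda>k. max_affine (F k) x)" for x
  proof (rule incseq_SucI)
    fix k
    obtain p b where p: "(p, b) \<in> F k" "max_affine (F k) x = p \<bullet> x + b"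
      using max_affine_attained[OF fin ne] by blast
    then have "(p, b) \<in> F (Suc k)"
      unfolding F_def by auto
    then show "max_affine (F k) x \<le> max_affine (F (Suc k)) x"
      using max_affine_ge[OF fin] p(2) by simp
  qed
  define G where "G x = (SUP k. max_affine (F k) x)" for x
  have lim: "(\<lambda>k. max_affine (F k) x) \<longlonglongrightarrow> G x" for x
    unfolding G_def using le by (intro LIMSEQ_incseq_SUP mono bdd_aboveI2)
  have G_convex: "convex_on UNIV G"
    using conv lim by (rule convex_on_limit)
  have G_le: "G x \<le> f x" for x
    using le by (intro LIMSEQ_le_const2[OF lim]) auto
  have "T \<subseteq> {x. G x = f x}"
  proof
    fix x assume "x \<in> T"
    then obtain j where j: "x = xs j"
      using xs by blast
    have "t j \<in> F j"
      unfolding F_def by simp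
    then have "f x \<le> max_affine (F j) x"
      using max_affine_ge[OF fin, of "fst (t j)" "snd (t j)" j x] by (simp add: t_def j)
    also have "\<dots> \<le> G x"
      using mono lim by (rule incseq_le)
    finally show "x \<in> {x. G x = f x}"
      using G_le[of x] by simp
  qed
  moreover have "closed {x. G x = f x}"
    by (intro closed_Collect_eq convex_continuous G_convex f)
  ultimately have "G = f"
    using T(3) closure_minimal by blast
  then have "cont_converges (\<lambda>k. max_affine (F k)) f"
    using lim by (intro cont_converges_incseq mono convex_continuous conv f) simp
  then show ?thesis
    using that fin ne by blast
qed

text \<open>Finitely many hyperplanes form a null set, and a ball is not null.\<close>

lemma avoid_hyperplanes:
  fixes H :: "('a::euclidean_space \<times> real) set"
  assumes H: "finite H" "\<And>p b. (p, b) \<in> H \<Longrightarrow> p \<noteq> 0" and d: "d > 0"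
  obtains a where "norm a < d" "\<And>p b. (p, b) \<in> H \<Longrightarrow> p \<bullet> a \<noteq> b"
proof -
  have "negligible (\<Union>pb\<in>H. {x. fst pb \<bullet> x = snd pb})"
    using H by (intro negligible_Union) (auto intro!: negligible_hyperplane)
  moreover have "\<not> negligible (ball (0::'a) d)"
    using d by (intro open_not_negligible) auto
  ultimately have "\<not> ball (0::'a) d \<subseteq> (\<Union>pb\<in>H. {x. fst pb \<bullet> x = snd pb})"
    using negligible_subset by blast
  then show ?thesis
    using that by force
qed

text \<open>Each family of hyperplanes is translated so that none of them contains a flat left over
  from the previous families; intersecting then lowers every dimension by at least one.\<close>

lemma generic_translates:
  fixes Hs :: "('a::euclidean_space \<times> real) set list"
  assumes "\<And>H. H \<in> set Hs \<Longrightarrow> finite H" "\<And>H p b. H \<in> set Hs \<Longrightarrow> (p, b) \<in> H \<Longrightarrow> p \<noteq> 0" "d > 0"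
  shows "\<exists>as AA. length as = length Hs \<and> (\<forall>a\<in>set as. norm a < d) \<and> finite AA
    \<and> (\<forall>A\<in>AA. affine A \<and> aff_dim A \<le> int (DIM('a)) - int (length Hs))
    \<and> {x. \<forall>i<length Hs. \<exists>(p, b)\<in>Hs ! i. p \<bullet> (x - as ! i) = b} \<subseteq> \<Union>AA"
  using assms
proof (induction Hs)
  case Nil
  show ?case
    by (rule exI[of _ "[]"], rule exI[of _ "{UNIV}"]) (simp add: aff_dim_UNIV)
next
  case (Cons H Hs)
  have "\<exists>as AA. length as = length Hs \<and> (\<forall>a\<in>set as. norm a < d) \<and> finite AA
    \<and> (\<forall>A\<in>AA. affine A \<and> aff_dim A \<le> int (DIM('a)) - int (length Hs))
    \<and> {x. \<forall>i<length Hs. \<exists>(p, b)\<in>Hs ! i. p \<bullet> (x - as ! i) = b} \<subseteq> \<Union>AA"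
    by (rule Cons.IH) (use Cons.prems in \<open>auto\<close>)
  then obtain as AA where IH: "length as = length Hs" "\<forall>a\<in>set as. norm a < d" "finite AA"
    "\<And>A. A \<in> AA \<Longrightarrow> affine A" "\<And>A. A \<in> AA \<Longrightarrow> aff_dim A \<le> int (DIM('a)) - int (length Hs)"
    "{x. \<forall>i<length Hs. \<exists>(p, b)\<in>Hs ! i. p \<bullet> (x - as ! i) = b} \<subseteq> \<Union>AA"
    by blast
  have H: "finite H" "\<And>p b. (p, b) \<in> H \<Longrightarrow> p \<noteq> 0"
    using Cons.prems by auto
  \<comment> \<open>One sample point per flat suffices: a hyperplane that misses it does not contain
    the flat.\<close>
  define q where "q A = (SOME x. x \<in> A)" for A :: "'a set"
  have q: "q A \<in> A" if "A \<noteq> {}" for A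
    unfolding q_def using that by (meson ex_in_conv someI)
  let ?K = "(\<lambda>(A, p, b). (p, p \<bullet> q A - b)) ` (AA \<times> H)"
  obtain a where a: "norm a < d" "\<And>p b. (p, b) \<in> ?K \<Longrightarrow> p \<bullet> a \<noteq> b"
    by (rule avoid_hyperplanes[of ?K d]) (use H IH(3) Cons.prems(3) in auto)
  \<comment> \<open>Empty flats are discarded because their dimension -1 could not drop
    further.\<close>
  define BB where "BB = (\<lambda>(A, p, b). A \<inter> {x. p \<bullet> x = b + p \<bullet> a}) ` ((AA - {{}}) \<times> H)"
  have "affine B \<and> aff_dim B \<le> int (DIM('a)) - int (length (H # Hs))" if "B \<in> BB" for B
  proof -
    obtain A p b where B: "B = A \<inter> {x. p \<bullet> x = b + p \<bullet> a}" and A: "A \<in> AA" "A \<noteq> {}" and pb: "(p, b) \<in> H"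
      using \<open>B \<in> BB\<close> unfolding BB_def by auto
    have "(p, p \<bullet> q A - b) \<in> ?K"
      using A(1) pb by force
    then have "p \<bullet> a \<noteq> p \<bullet> q A - b"
      by (rule a(2))
    then have nsub: "\<not> A \<subseteq> {x. p \<bullet> x = b + p \<bullet> a}"
      using q[OF A(2)] by auto
    \<comment> \<open>Covers the case of an empty intersection, whose dimension -1 must also be at
      most \<open>aff_dim A - 1\<close>.\<close>
    have "aff_dim A \<ge> 0"
      using A(2) aff_dim_negative_iff[of A] by linarith
    then have "aff_dim B \<le> aff_dim A - 1"
      unfolding B aff_dim_affine_Int_hyperplane[OF IH(4)[OF A(1)]] using nsub by auto
    moreover have "affine B"
      unfolding B by (intro affine_Int IH(4)[OF A(1)] affine_hyperplane)
    ultimately show ?thesis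
      using IH(5)[OF A(1)] by simp
  qed
  moreover have "finite BB"
    unfolding BB_def using IH(3) H(1) by auto
  moreover have "{x. \<forall>i<length (H # Hs). \<exists>(p, b)\<in>(H # Hs) ! i. p \<bullet> (x - (a # as) ! i) = b} \<subseteq> \<Union>BB"
  proof
    fix x assume "x \<in> {x. \<forall>i<length (H # Hs). \<exists>(p, b)\<in>(H # Hs) ! i. p \<bullet> (x - (a # as) ! i) = b}"
    then have "\<exists>(p, b)\<in>H. p \<bullet> (x - a) = b" "\<forall>i<length Hs. \<exists>(p, b)\<in>Hs ! i. p \<bullet> (x - as ! i) = b"
      by (simp_all add: All_less_Suc2)
    then obtain p b A where "(p, b) \<in> H" "p \<bullet> (x - a) = b" "A \<in> AA" "x \<in> A"
      using IH(6) by blast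
    then have "A \<inter> {x. p \<bullet> x = b + p \<bullet> a} \<in> BB" "x \<in> A \<inter> {x. p \<bullet> x = b + p \<bullet> a}"
      unfolding BB_def by (force simp: inner_diff_right)+
    then show "x \<in> \<Union>BB"
      by blast
  qed
  ultimately show ?case
    using IH(1,2) a(1) by (intro exI[of _ "a # as"] exI[of _ BB]) auto
qed

text \<open>The set \<open>H i\<close> encodes the hyperplanes on which two pieces of different
  slopes tie. With n + 1 families the remaining flats have dimension at most -1 and are empty, so
  every point avoids all ties of at least one function.\<close>

lemma max_affine_generic_translates:
  fixes F :: "nat \<Rightarrow> ('a::euclidean_space \<times> real) set"
  assumes F: "\<And>i. finite (F i)" "\<And>i. F i \<noteq> {}" and d: "d > 0"
  obtains a where "\<And>i. norm (a i) < d"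
    "\<And>x. \<exists>i\<le>DIM('a). \<exists>r>0. supported_affinely (\<lambda>x. max_affine (F i) (x - a i)) x r"
proof -
  define H where "H i = (\<lambda>((p, b), (p', b')). (p - p', b' - b)) ` {((p, b), (p', b')). (p, b) \<in> F i \<and> (p', b') \<in> F i \<and> p \<noteq> p'}" for i
  have finH: "finite (H i)" for i
  proof -
    have "{((p, b), (p', b')). (p, b) \<in> F i \<and> (p', b') \<in> F i \<and> p \<noteq> p'} \<subseteq> F i \<times> F i"
      by auto
    then show ?thesis
      unfolding H_def using F(1) by (intro finite_imageI) (meson finite_SigmaI finite_subset)
  qed
  have H0: "p \<noteq> 0" if "(p, b) \<in> H i" for p b i
    using that unfolding H_def by auto
  have HI: "(p - p', b' - b) \<in> H i" if "(p, b) \<in> F i" "(p', b') \<in> F i" "p \<noteq> p'" for i p b p' b'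
    using that unfolding H_def by force
  let ?n = "DIM('a)"
  let ?Hs = "map H [0..<Suc ?n]"
  obtain as AA where as: "length as = Suc ?n" "\<forall>a\<in>set as. norm a < d"
    "\<forall>A\<in>AA. affine A \<and> aff_dim A \<le> - 1"
    "{x. \<forall>i<Suc ?n. \<exists>(p, b)\<in>?Hs ! i. p \<bullet> (x - as ! i) = b} \<subseteq> \<Union>AA"
    using generic_translates[of ?Hs d] finH H0 d by fastforce
  have "A = {}" if "A \<in> AA" for A
  proof -
    have "aff_dim A \<le> - 1"
      using bspec[OF as(3) that] by blast
    then show ?thesis
      using aff_dim_negative_iff[of A] by linarith
  qed
  then have empty: "\<exists>i<Suc ?n. \<forall>(p, b)\<in>H i. p \<bullet> (x - as ! i) \<noteq> b" for x
  proof -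
    have "x \<notin> {x. \<forall>i<Suc ?n. \<exists>(p, b)\<in>?Hs ! i. p \<bullet> (x - as ! i) = b}"
      using as(4) \<open>\<And>A. A \<in> AA \<Longrightarrow> A = {}\<close> by blast
    then obtain i where i: "i < Suc ?n" "\<not> (\<exists>(p, b)\<in>?Hs ! i. p \<bullet> (x - as ! i) = b)"
      by blast
    have "?Hs ! i = H i"
      using i(1) by (simp del: upt_Suc)
    with i show ?thesis
      by (intro exI[of _ i]) auto
  qed
  define a where "a i = (if i < Suc ?n then as ! i else 0)" for i
  have "norm (a i) < d" for i
    using as(1,2) d unfolding a_def by simp
  moreover have "\<exists>i\<le>?n. \<exists>r>0. supported_affinely (\<lambda>x. max_affine (F i) (x - a i)) x r" for x
  proof -
    obtain i where i: "i < Suc ?n" "\<And>p b. (p, b) \<in> H i \<Longrightarrow> p \<bullet> (x - as ! i) \<noteq> b"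
      using empty[of x] by blast
    have "\<exists>r>0. supported_affinely (\<lambda>x. max_affine (F i) (x - a i)) x r"
    proof (rule max_affine_supported[OF F])
      fix p b p' b' assume pb: "(p, b) \<in> F i" "(p', b') \<in> F i" "p \<noteq> p'"
      have "(p - p') \<bullet> (x - as ! i) \<noteq> b' - b"
        using i(2)[OF HI[OF pb]] .
      then show "p \<bullet> (x - a i) + b \<noteq> p' \<bullet> (x - a i) + b'"
        using i(1) unfolding a_def by (auto simp: inner_diff_left)
    qed
    then show ?thesis
      using i(1) by (intro exI[of _ i]) auto
  qed
  ultimately show ?thesis
    by (rule that)
qed

lemma cont_converges_translate:
  fixes f :: "'a::real_normed_vector \<Rightarrow> real"
  assumes "cont_converges fs f" "a \<longlonglongrightarrow> 0"
  shows "cont_converges (\<lambda>k x. fs k (x - a k)) f"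
  unfolding cont_converges_def
proof (intro allI impI)
  fix x :: 'a and xs assume "xs \<longlonglongrightarrow> x"
  then have "(\<lambda>k. xs k - a k) \<longlonglongrightarrow> x - 0"
    using assms(2) by (rule tendsto_diff)
  then show "(\<lambda>k. fs k (xs k - a k)) \<longlonglongrightarrow> f x"
    using assms(1) unfolding cont_converges_def by simp
qed

text \<open>The first direction \<open>v\<close> is kept as the change of base, and the other n + 1
  are approximated. For the approximants the difference ignores \<open>v\<close> altogether, and
  this passes to the limit.\<close>

theorem (in convex_valuation) diff_op_eq_0:
  assumes fs: "length fs = DIM('a) + 2" "\<And>f. f \<in> set fs \<Longrightarrow> convex_on UNIV f" and w: "convex_on UNIV w"
  shows "diff_op Y fs w = 0"
proof -
  let ?n = "DIM('a)"
  obtain v gs where split: "fs = v # gs" "length gs = Suc ?n"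
    using fs(1) by (cases fs) auto
  have v: "convex_on UNIV v" and gs: "\<And>g. g \<in> set gs \<Longrightarrow> convex_on UNIV g"
    using fs(2) split by auto
  \<comment> \<open>The default \<open>v\<close> makes every \<open>g i\<close> convex, so the
    approximations can be chosen for all indices at once.\<close>
  define g where "g i = (if i < length gs then gs ! i else v)" for i
  have g: "convex_on UNIV (g i)" for i
    unfolding g_def using v gs by simp
  have gs_eq: "gs = map g [0..<Suc ?n]"
    by (rule nth_equalityI) (simp_all add: g_def split(2) del: upt_Suc)
  have "\<exists>F. (\<forall>k::nat. finite (F k)) \<and> (\<forall>k. F k \<noteq> {}) \<and> cont_converges (\<lambda>k. max_affine (F k)) (g i)" for i
    using convex_max_affine_approximation[OF g] by metis
  then obtain F where F: "\<And>i k::nat. finite (F i k)" "\<And>i k. F i k \<noteq> {}"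
    "\<And>i. cont_converges (\<lambda>k. max_affine (F i k)) (g i)"
    by metis
  \<comment> \<open>The translations shrink with \<open>k\<close>, so the translated approximants
    keep their limits.\<close>
  have "\<exists>a. (\<forall>i. norm (a i) < 1 / real (Suc k)) \<and>
    (\<forall>x. \<exists>i\<le>?n. \<exists>r>0. supported_affinely (\<lambda>x. max_affine (F i k) (x - a i)) x r)" for k
    by (rule max_affine_generic_translates[of "\<lambda>i. F i k" "1 / real (Suc k)"]) (use F in auto)
  then obtain a where a: "\<And>k i. norm (a k i) < 1 / real (Suc k)"
    "\<And>k x. \<exists>i\<le>?n. \<exists>r>0. supported_affinely (\<lambda>x. max_affine (F i k) (x - a k i)) x r"
    by metis
  define V where "V k i x = max_affine (F i k) (x - a k i)" for k i x
  have V: "convex_on UNIV (V k i)" for k i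
    unfolding V_def by (rule convex_on_max_affine_translate[OF F(1,2)])
  have "(\<lambda>k. a k i) \<longlonglongrightarrow> 0" for i
  proof (rule Lim_null_comparison)
    show "eventually (\<lambda>k. norm (a k i) \<le> inverse (real (Suc k))) sequentially"
      using a(1) by (intro always_eventually allI) (simp add: inverse_eq_divide less_imp_le)
  qed (rule LIMSEQ_inverse_real_of_nat)
  then have V_lim: "cont_converges (\<lambda>k. V k i) (g i)" for i
    unfolding V_def by (intro cont_converges_translate F(3))
  have lim: "(\<lambda>k. diff_op Y (map (V k) [0..<Suc ?n]) w') \<longlonglongrightarrow> diff_op Y gs w'" if "convex_on UNIV w'" for w'
    unfolding gs_eq by (rule diff_op_cts) (auto intro: V V_lim g that cont_converges_const)
  have "diff_op Y (map (V k) [0..<Suc ?n]) (w + v) = diff_op Y (map (V k) [0..<Suc ?n]) w" for k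
  proof (rule diff_op_base_independent[OF _ _ w v])
    fix x
    obtain i r where "i \<le> ?n" "r > 0" "supported_affinely (V k i) x r"
      using a(2)[of k x] unfolding V_def by blast
    then show "\<exists>v\<in>set (map (V k) [0..<Suc ?n]). \<exists>r>0. supported_affinely v x r"
      by (auto simp del: upt_Suc intro!: bexI[of _ i])
  qed (use V in auto)
  then have "diff_op Y gs (w + v) = diff_op Y gs w"
    using lim[OF convex_on_plus[OF w v]] lim[OF w] LIMSEQ_unique by simp
  then show ?thesis
    by (simp add: split(1))
qed

section \<open>The polarization of a homogeneous valuation\<close>

lemma sum_const_fun: "(\<Sum>l<j. f) = (\<lambda>x. real j * f x)" for f :: "'a \<Rightarrow> real"
  by (induction j) (simp_all add: fun_eq_iff algebra_simps)

lemma convex_on_scaled: "c \<ge> 0 \<Longrightarrow> convex_on UNIV f \<Longrightarrow> convex_on UNIV (\<lambda>x. c * f x)"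
  by (rule convex_on_cmul)

lemma cont_converges_multiple:
  assumes "cont_converges fs f"
  shows "cont_converges (\<lambda>k x. c * fs k x) (\<lambda>x. c * f x)"
  using assms unfolding cont_converges_def by (auto intro: tendsto_mult_left)

context convex_valuation
begin

text \<open>Adding a function commutes with pointwise maximum and minimum, so the identity survives
  every difference.\<close>

lemma diff_op_val:
  assumes "convex_on UNIV f" "convex_on UNIV g" "convex_on UNIV (\<lambda>x. min (f x) (g x))"
    and "\<And>h. h \<in> set hs \<Longrightarrow> convex_on UNIV h"
  shows "diff_op Y hs (\<lambda>x. max (f x) (g x)) + diff_op Y hs (\<lambda>x. min (f x) (g x))
    = diff_op Y hs f + diff_op Y hs g"
  using assms
proof (induction hs arbitrary: f g)
  case (Cons h hs)
  have mx: "(\<lambda>x. max (f x) (g x)) + h = (\<lambda>x. max ((f + h) x) ((g + h) x))"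
    and mn: "(\<lambda>x. min (f x) (g x)) + h = (\<lambda>x. min ((f + h) x) ((g + h) x))"
    by (auto simp: fun_eq_iff)
  have h: "convex_on UNIV h"
    using Cons.prems by simp
  have "convex_on UNIV (\<lambda>x. min ((f + h) x) ((g + h) x))"
    unfolding mn[symmetric] by (intro convex_on_plus Cons.prems(3) h)
  then have "diff_op Y hs (\<lambda>x. max ((f + h) x) ((g + h) x)) + diff_op Y hs (\<lambda>x. min ((f + h) x) ((g + h) x))
    = diff_op Y hs (f + h) + diff_op Y hs (g + h)"
    using Cons.prems h by (intro Cons.IH convex_on_plus) auto
  moreover have "diff_op Y hs (\<lambda>x. max (f x) (g x)) + diff_op Y hs (\<lambda>x. min (f x) (g x))
    = diff_op Y hs f + diff_op Y hs g"
    using Cons.prems by (intro Cons.IH) auto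
  ultimately show ?case
    unfolding diff_op.simps mx mn by linarith
qed (simp add: val)

text \<open>A repeated argument does not enter additively. The expansion into multiples helps,
  because nonnegative factors commute with maximum and minimum, and \<open>diff_op_val\<close>
  applies to each multiple.\<close>

lemma diff_op_replicate_val:
  assumes "convex_on UNIV f" "convex_on UNIV g" "convex_on UNIV (\<lambda>x. min (f x) (g x))"
    and "\<And>h. h \<in> set hs \<Longrightarrow> convex_on UNIV h"
  shows "diff_op Y (replicate i (\<lambda>x. max (f x) (g x)) @ hs) 0 + diff_op Y (replicate i (\<lambda>x. min (f x) (g x)) @ hs) 0
    = diff_op Y (replicate i f @ hs) 0 + diff_op Y (replicate i g @ hs) 0"
proof -
  have "diff_op Y hs (\<lambda>x. real j * max (f x) (g x)) + diff_op Y hs (\<lambda>x. real j * min (f x) (g x))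
    = diff_op Y hs (\<lambda>x. real j * f x) + diff_op Y hs (\<lambda>x. real j * g x)" for j
  proof -
    have "convex_on UNIV (\<lambda>x. min (real j * f x) (real j * g x))"
      using convex_on_scaled[OF _ assms(3), of "real j"] by (simp add: min_mult_distrib_left)
    then have "diff_op Y hs (\<lambda>x. max (real j * f x) (real j * g x)) + diff_op Y hs (\<lambda>x. min (real j * f x) (real j * g x))
      = diff_op Y hs (\<lambda>x. real j * f x) + diff_op Y hs (\<lambda>x. real j * g x)"
      using assms by (intro diff_op_val convex_on_scaled) auto
    then show ?thesis
      by (simp add: min_mult_distrib_left max_mult_distrib_left)
  qed
  then show ?thesis
    unfolding diff_op_replicate sum_const_fun add_0_left sum.distrib[symmetric] distrib_left[symmetric]
    by simp
qed

lemma diff_op_replicate_affine: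
  assumes "convex_on UNIV f" "\<And>h. h \<in> set hs \<Longrightarrow> convex_on UNIV h"
  shows "diff_op Y (replicate i (\<lambda>x. f x + (a \<bullet> x + b)) @ hs) 0 = diff_op Y (replicate i f @ hs) 0"
proof -
  have "diff_op Y hs (\<lambda>x. real j * (f x + (a \<bullet> x + b))) = diff_op Y hs (\<lambda>x. real j * f x)" for j
  proof -
    have eq: "(\<lambda>x. real j * (f x + (a \<bullet> x + b))) = (\<lambda>x. real j * f x + ((real j *\<^sub>R a) \<bullet> x + real j * b))"
      by (simp add: algebra_simps)
    show ?thesis
      unfolding eq by (intro diff_op_affine convex_on_scaled assms) auto
  qed
  then show ?thesis
    unfolding diff_op_replicate sum_const_fun add_0_left by simp
qed

lemma diff_op_replicate_cts:
  assumes "\<And>k. convex_on UNIV (fs k)" "convex_on UNIV f" "cont_converges fs f"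
    and "\<And>h. h \<in> set hs \<Longrightarrow> convex_on UNIV h"
  shows "(\<lambda>k. diff_op Y (replicate i (fs k) @ hs) 0) \<longlonglongrightarrow> diff_op Y (replicate i f @ hs) 0"
  unfolding diff_op_replicate sum_const_fun add_0_left
  using assms by (intro tendsto_intros diff_op_cts_base convex_on_scaled cont_converges_multiple) auto

end

section \<open>Homogeneity and real factors\<close>

locale homogeneous_convex_valuation = convex_valuation Y
  for Y :: "('a::euclidean_space \<Rightarrow> real) \<Rightarrow> real" +
  fixes m :: nat
  assumes hom: "convex_on UNIV f \<Longrightarrow> c > 0 \<Longrightarrow> Y (\<lambda>x. c * f x) = c ^ m * Y f"
    and m_pos: "1 \<le> m" and m_le: "m \<le> DIM('a)"

sublocale homogeneous_convex_valuation \<subseteq> homogeneous_polynomial_map "{f. convex_on UNIV f}" Y m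
proof
  show zero: "0 \<in> {f. convex_on UNIV (f :: 'a \<Rightarrow> real)}"
    by (simp add: convex_on_zero)
  show add: "f + g \<in> {f. convex_on UNIV f}" if "f \<in> {f. convex_on UNIV f}" "g \<in> {f. convex_on UNIV f}"
    for f g :: "'a \<Rightarrow> real"
    using that convex_on_plus by simp
  \<comment> \<open>Doubling the zero function changes nothing, so positive degree forces the value
    0 there; this is the case of zero copies.\<close>
  have "Y (\<lambda>x. 2 * (0 :: 'a \<Rightarrow> real) x) = 2 ^ m * Y 0"
    by (intro hom convex_on_zero) simp
  then have "(2 ^ m - 1) * Y 0 = 0"
    by (simp add: zero_fun_def left_diff_distrib)
  moreover have "(1::real) < 2 ^ m"
    using m_pos by simp
  ultimately have Y0: "Y 0 = 0"
    by simp
  show mult: "Y (\<Sum>l<j. f) = real j ^ m * Y f" if "f \<in> {f. convex_on UNIV f}" for f j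
  proof (cases "j = 0")
    case True
    then show ?thesis
      using Y0 m_pos by simp
  next
    case False
    then show ?thesis
      unfolding sum_const_fun using that by (intro hom) auto
  qed
  show "diff_op Y fs w = 0"
    if "length fs = Suc m" "set fs \<subseteq> {f. convex_on UNIV f}" "w \<in> {f. convex_on UNIV f}" for fs w
  \<comment> \<open>With this surplus the starting order is n + 2, where \<open>diff_op_eq_0\<close>
    applies.\<close>
  proof (rule diff_op_degree_le_homogeneity[of "{f. convex_on UNIV f}" Y m "DIM('a) + 1 - m"])
    show "Y (w + w) = 2 ^ m * Y w" if "w \<in> {f. convex_on UNIV f}" for w
    proof -
      have "w + w = (\<Sum>l<2::nat. w)"
        by (simp add: numeral_2_eq_2)
      then show ?thesis
        using mult[OF that, of 2] by simp
    qed
    show "diff_op Y fs w = 0"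
      if "length fs = Suc (m + (DIM('a) + 1 - m))" "set fs \<subseteq> {f. convex_on UNIV f}" "w \<in> {f. convex_on UNIV f}"
      for fs w
      using that m_le by (intro diff_op_eq_0) auto
  qed (use that zero add in auto)
qed

context homogeneous_convex_valuation
begin

text \<open>Cauchy's functional equation on the half line: additivity gives nonnegative rational
  factors, and continuity of the difference in its base gives real ones.\<close>

lemma polar_scale_Cons:
  assumes len: "Suc (length zs) = m" and zs: "set zs \<subseteq> {f. convex_on UNIV f}" and f: "convex_on UNIV f" and "c \<ge> 0"
  shows "polar ((\<lambda>x. c * f x) # zs) = c * polar (f # zs)"
proof -
  define p where "p c = polar ((\<lambda>x. c * f x) # zs)" for c
  have p_add: "p (a + b) = p a + p b" if "a \<ge> 0" "b \<ge> 0" for a b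
  proof -
    have "(\<lambda>x. (a + b) * f x) = (\<lambda>x. a * f x) + (\<lambda>x. b * f x)"
      by (simp add: fun_eq_iff algebra_simps)
    then show ?thesis
      unfolding p_def using polar_add[of "[]" zs] len zs convex_on_scaled[OF _ f] that by simp
  qed
  have p_0: "p 0 = 0"
    using p_add[of 0 0] by simp
  have p_nat: "p (real n * a) = real n * p a" if "a \<ge> 0" for n a
  proof (induction n)
    case (Suc n)
    have "p (real (Suc n) * a) = p (real n * a + a)"
      by (simp add: algebra_simps)
    also have "\<dots> = real (Suc n) * p a"
      using p_add[of "real n * a" a] that Suc by (simp add: algebra_simps)
    finally show ?case .
  qed (simp add: p_0)
  have p_rat: "p (real n / real (Suc k)) = real n / real (Suc k) * p 1" for n k
  proof -
    have "p 1 = real (Suc k) * p (1 / real (Suc k))"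
      using p_nat[of "1 / real (Suc k)" "Suc k"] by simp
    then have "p (1 / real (Suc k)) = p 1 / real (Suc k)"
      by (simp add: field_simps)
    then show ?thesis
      using p_nat[of "1 / real (Suc k)" n] by simp
  qed
  define r where "r k = real (nat \<lfloor>c * real (Suc k)\<rfloor>) / real (Suc k)" for k
  have r0: "r k \<ge> 0" for k
    unfolding r_def by simp
  have "r \<longlonglongrightarrow> c"
  proof (rule LIMSEQ_I)
    fix e :: real assume "e > 0"
    then obtain K where K: "1 / real (Suc K) < e"
      using reals_Archimedean[of e] by (auto simp: inverse_eq_divide)
    have "norm (r k - c) < e" if "k \<ge> K" for k
    proof -
      have fl: "real (nat \<lfloor>c * real (Suc k)\<rfloor>) = of_int \<lfloor>c * real (Suc k)\<rfloor>"
        using \<open>c \<ge> 0\<close> by simp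
      have "of_int \<lfloor>c * real (Suc k)\<rfloor> \<le> c * real (Suc k)" "c * real (Suc k) < of_int \<lfloor>c * real (Suc k)\<rfloor> + 1"
        by linarith+
      then have "\<bar>of_int \<lfloor>c * real (Suc k)\<rfloor> - c * real (Suc k)\<bar> \<le> 1"
        by linarith
      moreover have "r k - c = (of_int \<lfloor>c * real (Suc k)\<rfloor> - c * real (Suc k)) / real (Suc k)"
        unfolding r_def fl by (simp add: diff_divide_distrib del: of_nat_Suc)
      ultimately have "norm (r k - c) \<le> 1 / real (Suc k)"
        by (simp add: abs_divide divide_right_mono del: of_nat_Suc)
      also have "\<dots> \<le> 1 / real (Suc K)"
        using that by (intro divide_left_mono) auto
      finally show ?thesis
        using K by linarith
    qed
    then show "\<exists>no. \<forall>n\<ge>no. norm (r n - c) < e"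
      by blast
  qed
  have "cont_converges (\<lambda>k x. r k * f x) (\<lambda>x. c * f x)"
    unfolding cont_converges_def
  proof (intro allI impI)
    fix x xs assume "xs \<longlonglongrightarrow> (x::'a)"
    then have "(\<lambda>k. f (xs k)) \<longlonglongrightarrow> f x"
      using continuous_on_tendsto_compose[OF convex_continuous[OF f]] by auto
    with \<open>r \<longlonglongrightarrow> c\<close> show "(\<lambda>k. r k * f (xs k)) \<longlonglongrightarrow> c * f x"
      by (rule tendsto_mult)
  qed
  \<comment> \<open>The first argument of \<open>polar\<close> acts only through the base of the
    remaining differences, so continuity in the base is enough.\<close>
  then have "(\<lambda>k. diff_op Y zs (\<lambda>x. r k * f x)) \<longlonglongrightarrow> diff_op Y zs (\<lambda>x. c * f x)"
    using zs f r0 \<open>c \<ge> 0\<close> by (intro diff_op_cts_base convex_on_scaled) auto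
  then have "(\<lambda>k. p (r k)) \<longlonglongrightarrow> p c"
    unfolding p_def polar_def diff_op.simps add_0_left by (intro tendsto_intros) auto
  moreover have "(\<lambda>k. p (r k)) \<longlonglongrightarrow> c * p 1"
    unfolding r_def p_rat using \<open>r \<longlonglongrightarrow> c\<close> unfolding r_def by (intro tendsto_intros)
  ultimately have "p c = c * p 1"
    by (rule LIMSEQ_unique)
  then show ?thesis
    unfolding p_def by simp
qed

lemma polar_scale:
  assumes "length xs + length ys + 1 = m" "convex_on UNIV f" "c \<ge> 0"
    and "set xs \<subseteq> {f. convex_on UNIV f}" "set ys \<subseteq> {f. convex_on UNIV f}"
  shows "polar (xs @ (\<lambda>x. c * f x) # ys) = c * polar (xs @ f # ys)"
  using polar_scale_Cons[of "xs @ ys" f c] assms unfolding polar_def diff_op_append_Cons by simp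

lemma polar_scale_replicate:
  assumes "n + length ys = m" "convex_on UNIV f" "c \<ge> 0" "set ys \<subseteq> {f. convex_on UNIV f}"
  shows "polar (replicate n (\<lambda>x. c * f x) @ ys) = c ^ n * polar (replicate n f @ ys)"
  using assms
proof (induction n arbitrary: ys)
  case (Suc n)
  have "set (replicate n (\<lambda>x. c * f x)) \<subseteq> {f. convex_on UNIV f}"
    using convex_on_scaled[OF Suc.prems(3,2)] by auto
  then have "polar (replicate (Suc n) (\<lambda>x. c * f x) @ ys) = c * polar (f # replicate n (\<lambda>x. c * f x) @ ys)"
    using polar_scale[of "[]" "replicate n (\<lambda>x. c * f x) @ ys" f c] Suc.prems by simp
  also have "polar (f # replicate n (\<lambda>x. c * f x) @ ys) = polar (replicate n (\<lambda>x. c * f x) @ f # ys)"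
    by (rule polar_mset) simp
  also have "\<dots> = c ^ n * polar (replicate n f @ f # ys)"
    using Suc.prems by (intro Suc.IH) auto
  also have "polar (replicate n f @ f # ys) = polar (replicate (Suc n) f @ ys)"
    by (rule polar_mset) simp
  finally show ?case
    by simp
qed simp

lemma polar_scale_repeat_args:
  assumes "(\<Sum>j=1..k. i j) + length ys = m" "\<And>j. j \<in> {1..k} \<Longrightarrow> convex_on UNIV (f j) \<and> 0 \<le> c j"
    and "set ys \<subseteq> {f. convex_on UNIV f}"
  shows "polar (repeat_args k i (\<lambda>j x. c j * f j x) @ ys) = (\<Prod>j=1..k. c j ^ i j) * polar (repeat_args k i f @ ys)"
  using assms
proof (induction k arbitrary: ys)
  case 0
  then show ?case
    by (simp add: repeat_args_def)
next
  case (Suc k)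
  let ?n = "i (Suc k)" and ?g = "f (Suc k)" and ?c = "c (Suc k)"
  have g: "convex_on UNIV ?g" "?c \<ge> 0"
    using Suc.prems(2)[of "Suc k"] by auto
  have args: "set (repeat_args k i f) \<subseteq> {f. convex_on UNIV f}"
    using set_repeat_args[of k i f] Suc.prems(2) by force
  have "polar (repeat_args (Suc k) i (\<lambda>j x. c j * f j x) @ ys)
      = polar (repeat_args k i (\<lambda>j x. c j * f j x) @ replicate ?n (\<lambda>x. ?c * ?g x) @ ys)"
    by (simp add: repeat_args_Suc)
  also have "\<dots> = (\<Prod>j=1..k. c j ^ i j) * polar (repeat_args k i f @ replicate ?n (\<lambda>x. ?c * ?g x) @ ys)"
    using Suc.prems convex_on_scaled[OF g(2,1)] by (intro Suc.IH) auto
  also have "polar (repeat_args k i f @ replicate ?n (\<lambda>x. ?c * ?g x) @ ys)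
      = polar (replicate ?n (\<lambda>x. ?c * ?g x) @ repeat_args k i f @ ys)"
    by (rule polar_mset) simp
  also have "\<dots> = ?c ^ ?n * polar (replicate ?n ?g @ repeat_args k i f @ ys)"
    using Suc.prems args g by (intro polar_scale_replicate) (auto simp: length_repeat_args)
  also have "polar (replicate ?n ?g @ repeat_args k i f @ ys) = polar (repeat_args (Suc k) i f @ ys)"
    by (rule polar_mset) (simp add: repeat_args_Suc)
  finally show ?case
    by simp
qed

lemma polar_expansion:
  assumes f: "\<And>j. j \<in> {1..k} \<Longrightarrow> convex_on UNIV (f j) \<and> 0 \<le> c j"
  shows "Y (\<Sum>j=1..k. (\<lambda>x. c j * f j x))
    = (\<Sum>i\<in>multi_indices k m. multinomial m k i * (\<Prod>j=1..k. c j ^ i j) * polar (repeat_args k i f))"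
proof -
  let ?F = "\<lambda>j x. c j * f j x"
  have F: "?F j \<in> {f. convex_on UNIV f}" if "j \<in> {1..k}" for j
    using f[OF that] convex_on_scaled by blast
  have "convex_on UNIV (\<Sum>j=1..k. ?F j)"
    using F by (intro convex_on_sum_fun) auto
  then have "Y (\<Sum>j=1..k. ?F j) = polar (replicate m (\<Sum>j=1..k. ?F j) @ [])"
    using polar_diagonal by simp
  also have "\<dots> = (\<Sum>i\<in>multi_indices k m. multinomial m k i * polar (repeat_args k i ?F @ []))"
    using F by (intro polar_multinomial) auto
  also have "\<dots> = (\<Sum>i\<in>multi_indices k m. multinomial m k i * ((\<Prod>j=1..k. c j ^ i j) * polar (repeat_args k i f @ [])))"
  proof (intro sum.cong refl arg_cong2[of _ _ _ _ "(*)"])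
    fix i assume "i \<in> multi_indices k m"
    then have "(\<Sum>j=1..k. i j) = m"
      by (simp add: mem_multi_indices_iff)
    then show "polar (repeat_args k i ?F @ []) = (\<Prod>j=1..k. c j ^ i j) * polar (repeat_args k i f @ [])"
      using f by (intro polar_scale_repeat_args) auto
  qed
  finally show ?thesis
    by (simp add: mult.assoc)
qed

end

section \<open>Return to super-coercive functions\<close>

lemma epi_mult_eq_dual:
  assumes "u \<in> Conv_sc" "0 \<le> c"
  shows "epi_mult c u = dual (\<lambda>x. c * rdual u x)"
  using epi_mult_dual[OF assms(2), of "rdual u"] unfolding dual_rdual[OF assms(1)] .

text \<open>Conjugation swaps maximum and minimum, under which the valuation identity is symmetric.
  An affine summand is split into a linear part, which translates the conjugate, and a
  constant.\<close>

lemma convex_valuation_dual: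
  fixes Z :: "('a::euclidean_space \<Rightarrow> ereal) \<Rightarrow> real"
  assumes val: "valuation_on Conv_sc Z" and cts: "epi_continuous_on Conv_sc Z"
    and inv: "epi_translation_invariant_on Conv_sc Z"
  shows "convex_valuation (\<lambda>f. Z (dual f))"
proof
  fix f g :: "'a \<Rightarrow> real"
  assume f: "convex_on UNIV f" and g: "convex_on UNIV g" and mn: "convex_on UNIV (\<lambda>x. min (f x) (g x))"
  have eq: "dual (\<lambda>x. min (f x) (g x)) = (\<lambda>y. max (dual f y) (dual g y))"
    "dual (\<lambda>x. max (f x) (g x)) = (\<lambda>y. min (dual f y) (dual g y))"
    using dual_min dual_max[OF f g mn] by blast+
  have "(\<lambda>y. max (dual f y) (dual g y)) \<in> Conv_sc" "(\<lambda>y. min (dual f y) (dual g y)) \<in> Conv_sc"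
    using dual_in_Conv_sc[OF mn] dual_in_Conv_sc[OF convex_on_pointwise_max[OF f g]] by (simp_all add: eq)
  then have "Z (\<lambda>y. max (dual f y) (dual g y)) + Z (\<lambda>y. min (dual f y) (dual g y)) = Z (dual f) + Z (dual g)"
    using val dual_in_Conv_sc[OF f] dual_in_Conv_sc[OF g] unfolding valuation_on_def by blast
  then show "Z (dual (\<lambda>x. max (f x) (g x))) + Z (dual (\<lambda>x. min (f x) (g x))) = Z (dual f) + Z (dual g)"
    unfolding eq by linarith
next
  fix f :: "'a \<Rightarrow> real" and a b assume f: "convex_on UNIV f"
  let ?h = "\<lambda>x. f x + a \<bullet> x"
  have h: "convex_on UNIV ?h"
    using convex_on_add_affine[OF f, of a 0] by simp
  have tr: "dual ?h = (\<lambda>x. dual f (x - a))"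
    by (rule ext) (rule dual_translate[symmetric])
  have "(\<lambda>x. f x + (a \<bullet> x + b)) = (\<lambda>x. ?h x - (- b))"
    by (simp add: fun_eq_iff)
  then have "dual (\<lambda>x. f x + (a \<bullet> x + b)) = (\<lambda>x. dual ?h x + ereal (- b))"
    using dual_add_const[of ?h _ "- b"] by auto
  then have "Z (dual (\<lambda>x. f x + (a \<bullet> x + b))) = Z (dual ?h)"
    using inv dual_in_Conv_sc[OF h] unfolding epi_translation_invariant_on_def by simp
  also have "\<dots> = Z (dual f)"
    unfolding tr using inv dual_in_Conv_sc[OF f] unfolding epi_translation_invariant_on_def by blast
  finally show "Z (dual (\<lambda>x. f x + (a \<bullet> x + b))) = Z (dual f)" .
next
  fix fs and f :: "'a \<Rightarrow> real"
  assume fs: "\<And>k. convex_on UNIV (fs k)" and f: "convex_on UNIV f" and conv: "cont_converges fs f"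
  have "(\<forall>k. dual (fs k) \<in> Conv_sc) \<and> dual f \<in> Conv_sc \<and> epi_converges (\<lambda>k. dual (fs k)) (dual f)"
    using dual_in_Conv_sc[OF fs] dual_in_Conv_sc[OF f] epi_converges_dual[OF fs f conv] by blast
  then show "(\<lambda>k. Z (dual (fs k))) \<longlonglongrightarrow> Z (dual f)"
    by (rule cts[unfolded epi_continuous_on_def, rule_format])
qed

lemma inf_conv_fam_cong:
  "(\<And>j. j \<in> {1..k} \<Longrightarrow> us j = vs j) \<Longrightarrow> inf_conv_fam k us = inf_conv_fam k vs"
  unfolding inf_conv_fam_def by (intro ext arg_cong[of _ _ Inf] Collect_cong ex_cong1) (auto intro!: sum.cong)

theorem theorem21:
  fixes Z :: "(real ^ 'n \<Rightarrow> ereal) \<Rightarrow> real" and m :: nat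
  assumes "valuation_on Conv_sc Z"
    and "epi_continuous_on Conv_sc Z"
    and "epi_translation_invariant_on Conv_sc Z"
    and "m \<in> {1..CARD('n)}"
    and "epi_homogeneous_on Conv_sc (real m) Z"
  shows "\<exists>Zbar :: (real ^ 'n \<Rightarrow> ereal) list \<Rightarrow> real.
    symmetric_on Conv_sc m Zbar \<and>
    (\<forall>(k::nat) us (c::nat \<Rightarrow> real).
       (\<forall>j\<in>{1..k}. us j \<in> Conv_sc \<and> 0 \<le> c j) \<longrightarrow>
       Z (inf_conv_fam k (\<lambda>j. epi_mult (c j) (us j))) =
         (\<Sum>i\<in>multi_indices k m.
            multinomial m k i * (\<Prod>j=1..k. c j ^ i j) * Zbar (repeat_args k i us))) \<and>
    epi_additive_each m Zbar \<and>
    (\<forall>i\<in>{1..m}. \<forall>vs. length vs = m - i \<and> set vs \<subseteq> Conv_sc \<longrightarrow>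
       epi_continuous_on Conv_sc (\<lambda>u. Zbar (replicate i u @ vs)) \<and>
       epi_translation_invariant_on Conv_sc (\<lambda>u. Zbar (replicate i u @ vs)) \<and>
       valuation_on Conv_sc (\<lambda>u. Zbar (replicate i u @ vs)) \<and>
       epi_homogeneous_on Conv_sc (real i) (\<lambda>u. Zbar (replicate i u @ vs)))"
proof -
  interpret convex_valuation "\<lambda>f. Z (dual f)"
    using assms(1-3) by (rule convex_valuation_dual)
  interpret homogeneous_convex_valuation "\<lambda>f. Z (dual f)" m
  proof
    fix f :: "real ^ 'n \<Rightarrow> real" and c :: real assume "convex_on UNIV f" "c > 0"
    then have "Z (epi_mult c (dual f)) = c powr real m * Z (dual f)"
      using assms(5) dual_in_Conv_sc unfolding epi_homogeneous_on_def by blast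
    then show "Z (dual (\<lambda>x. c * f x)) = c ^ m * Z (dual f)"
      using \<open>c > 0\<close> by (simp add: epi_mult_dual powr_realpow)
  qed (use assms(4) in auto)
  define Zbar where "Zbar us = polar (map rdual us)" for us
  have rdual_epi_mult: "rdual (epi_mult c u) = (\<lambda>x. c * rdual u x)"
    if "u \<in> Conv_sc" "c \<ge> 0" for u :: "real ^ 'n \<Rightarrow> ereal" and c
  proof -
    have "convex_on UNIV (\<lambda>x. c * rdual u x)"
      using that by (intro convex_on_scaled convex_on_rdual)
    then show ?thesis
      unfolding epi_mult_eq_dual[OF that] by (rule rdual_dual)
  qed
  have convex_map: "set (map rdual vs) \<subseteq> {f. convex_on UNIV f}" if "set vs \<subseteq> Conv_sc"
    for vs :: "(real ^ 'n \<Rightarrow> ereal) list"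
    using that convex_on_rdual by auto
  have sym: "symmetric_on Conv_sc m Zbar"
    unfolding symmetric_on_def Zbar_def by (auto intro!: polar_mset)
  have exp: "Z (inf_conv_fam k (\<lambda>j. epi_mult (c j) (us j))) =
      (\<Sum>i\<in>multi_indices k m. multinomial m k i * (\<Prod>j=1..k. c j ^ i j) * Zbar (repeat_args k i us))"
    if *: "\<forall>j\<in>{1..k}. us j \<in> Conv_sc \<and> 0 \<le> c j" for k us and c :: "nat \<Rightarrow> real"
  proof -
    let ?F = "\<lambda>j x. c j * rdual (us j) x"
    have "inf_conv_fam k (\<lambda>j. epi_mult (c j) (us j)) = inf_conv_fam k (\<lambda>j. dual (?F j))"
    proof (rule inf_conv_fam_cong)
      fix j assume "j \<in> {1..k}"
      then show "epi_mult (c j) (us j) = dual (?F j)"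
        using * by (simp add: epi_mult_eq_dual)
    qed
    also have "\<dots> = dual (\<Sum>j=1..k. ?F j)"
      using * by (intro inf_conv_fam_dual convex_on_scaled convex_on_rdual) auto
    finally have "Z (inf_conv_fam k (\<lambda>j. epi_mult (c j) (us j))) = Z (dual (\<Sum>j=1..k. ?F j))"
      by simp
    also have "\<dots> = (\<Sum>i\<in>multi_indices k m.
        multinomial m k i * (\<Prod>j=1..k. c j ^ i j) * polar (repeat_args k i (\<lambda>j. rdual (us j))))"
      using * by (intro polar_expansion) (auto intro: convex_on_rdual)
    finally show ?thesis
      unfolding Zbar_def map_repeat_args .
  qed
  have add: "epi_additive_each m Zbar"
    unfolding epi_additive_each_def epi_additive_def
  proof (intro allI impI ballI)
    fix us :: "(real ^ 'n \<Rightarrow> ereal) list" and j and a b :: real and u v :: "real ^ 'n \<Rightarrow> ereal"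
    assume us: "length us = m \<and> set us \<subseteq> Conv_sc" and j: "j < m" and a: "0 < a" and b: "0 < b"
      and u: "u \<in> Conv_sc" and v: "v \<in> Conv_sc"
    let ?xs = "map rdual (take j us)" and ?ys = "map rdual (drop (Suc j) us)"
    let ?f = "\<lambda>x. a * rdual u x" and ?g = "\<lambda>x. b * rdual v x"
    have upd: "Zbar (us[j := w]) = polar (?xs @ rdual w # ?ys)" for w
      using us j unfolding Zbar_def by (simp add: upd_conv_take_nth_drop)
    have C: "set ?xs \<subseteq> {f. convex_on UNIV f}" "set ?ys \<subseteq> {f. convex_on UNIV f}"
      using us by (auto intro!: convex_on_rdual dest!: in_set_takeD in_set_dropD)
    have len: "length ?xs + length ?ys + 1 = m"
      using us j by simp
    have fg: "convex_on UNIV ?f" "convex_on UNIV ?g"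
      using u v a b by (auto intro: convex_on_scaled convex_on_rdual)
    have "inf_conv (epi_mult a u) (epi_mult b v) = inf_conv (dual ?f) (dual ?g)"
      using a b u v by (simp add: epi_mult_eq_dual)
    then have "rdual (inf_conv (epi_mult a u) (epi_mult b v)) = ?f + ?g"
      using inf_conv_dual[OF fg] rdual_dual[OF convex_on_plus[OF fg]] by simp
    then have "Zbar (us[j := inf_conv (epi_mult a u) (epi_mult b v)]) = polar (?xs @ (?f + ?g) # ?ys)"
      by (simp only: upd)
    also have "\<dots> = polar (?xs @ ?f # ?ys) + polar (?xs @ ?g # ?ys)"
      using fg by (intro polar_add len C) auto
    also have "\<dots> = a * polar (?xs @ rdual u # ?ys) + b * polar (?xs @ rdual v # ?ys)"
      using a b u v by (intro arg_cong2[of _ _ _ _ "(+)"] polar_scale len C) (auto intro: convex_on_rdual)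
    finally show "Zbar (us[j := inf_conv (epi_mult a u) (epi_mult b v)]) = a * Zbar (us[j := u]) + b * Zbar (us[j := v])"
      by (simp only: upd)
  qed
  have "epi_continuous_on Conv_sc (\<lambda>u. Zbar (replicate i u @ vs)) \<and>
       epi_translation_invariant_on Conv_sc (\<lambda>u. Zbar (replicate i u @ vs)) \<and>
       valuation_on Conv_sc (\<lambda>u. Zbar (replicate i u @ vs)) \<and>
       epi_homogeneous_on Conv_sc (real i) (\<lambda>u. Zbar (replicate i u @ vs))"
    if i: "i \<in> {1..m}" and vs: "length vs = m - i" "set vs \<subseteq> Conv_sc" for i vs
  proof -
    let ?hs = "map rdual vs"
    have hs: "\<And>h. h \<in> set ?hs \<Longrightarrow> convex_on UNIV h"
      using convex_map[OF vs(2)] by blast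
    have Zb: "Zbar (replicate i u @ vs) = diff_op (\<lambda>f. Z (dual f)) (replicate i (rdual u) @ ?hs) 0 / fact m" for u
      unfolding Zbar_def polar_def by simp
    have "epi_continuous_on Conv_sc (\<lambda>u. Zbar (replicate i u @ vs))"
      unfolding epi_continuous_on_def Zb
    proof (intro allI impI tendsto_divide tendsto_const)
      fix us and u :: "real ^ 'n \<Rightarrow> ereal"
      assume us: "(\<forall>k. us k \<in> Conv_sc) \<and> u \<in> Conv_sc \<and> epi_converges us u"
      then have "cont_converges (\<lambda>k. rdual (us k)) (rdual u)"
        by (intro cont_converges_rdual) auto
      then show "(\<lambda>k. diff_op (\<lambda>f. Z (dual f)) (replicate i (rdual (us k)) @ ?hs) 0)
          \<longlonglongrightarrow> diff_op (\<lambda>f. Z (dual f)) (replicate i (rdual u) @ ?hs) 0"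
        using us hs by (intro diff_op_replicate_cts) (auto intro: convex_on_rdual)
    qed simp
    moreover have "epi_translation_invariant_on Conv_sc (\<lambda>u. Zbar (replicate i u @ vs))"
      unfolding epi_translation_invariant_on_def
    proof (intro ballI conjI allI)
      fix u :: "real ^ 'n \<Rightarrow> ereal" assume u: "u \<in> Conv_sc"
      let ?f = "rdual u"
      have f: "convex_on UNIV ?f"
        by (rule convex_on_rdual[OF u])
      fix y
      have "(\<lambda>x. u (x - y)) = (\<lambda>x. dual ?f (x - y))"
        by (simp only: dual_rdual[OF u])
      also have "\<dots> = dual (\<lambda>x. ?f x + (y \<bullet> x + 0))"
        by (rule ext) (simp add: dual_translate)
      finally have "(\<lambda>x. u (x - y)) = dual (\<lambda>x. ?f x + (y \<bullet> x + 0))" .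
      then have "rdual (\<lambda>x. u (x - y)) = (\<lambda>x. ?f x + (y \<bullet> x + 0))"
        by (simp only: rdual_dual[OF convex_on_add_affine[OF f]])
      then show "Zbar (replicate i (\<lambda>x. u (x - y)) @ vs) = Zbar (replicate i u @ vs)"
        by (simp only: Zb diff_op_replicate_affine[OF f hs])
    next
      fix u :: "real ^ 'n \<Rightarrow> ereal" assume u: "u \<in> Conv_sc"
      let ?f = "rdual u"
      have f: "convex_on UNIV ?f"
        by (rule convex_on_rdual[OF u])
      fix \<alpha>
      have "(\<lambda>x. u x + ereal \<alpha>) = (\<lambda>x. dual ?f x + ereal \<alpha>)"
        by (simp only: dual_rdual[OF u])
      also have "\<dots> = dual (\<lambda>x. ?f x + (0 \<bullet> x + - \<alpha>))"
        by (rule ext) (simp add: dual_add_const)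
      finally have "(\<lambda>x. u x + ereal \<alpha>) = dual (\<lambda>x. ?f x + (0 \<bullet> x + - \<alpha>))" .
      then have "rdual (\<lambda>x. u x + ereal \<alpha>) = (\<lambda>x. ?f x + (0 \<bullet> x + - \<alpha>))"
        by (simp only: rdual_dual[OF convex_on_add_affine[OF f]])
      then show "Zbar (replicate i (\<lambda>x. u x + ereal \<alpha>) @ vs) = Zbar (replicate i u @ vs)"
        by (simp only: Zb diff_op_replicate_affine[OF f hs])
    qed
    moreover have "valuation_on Conv_sc (\<lambda>u. Zbar (replicate i u @ vs))"
      unfolding valuation_on_def
    proof (intro ballI impI)
      fix u v :: "real ^ 'n \<Rightarrow> ereal" assume u: "u \<in> Conv_sc" and v: "v \<in> Conv_sc"
        and mm: "(\<lambda>x. max (u x) (v x)) \<in> Conv_sc \<and> (\<lambda>x. min (u x) (v x)) \<in> Conv_sc"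
      have mx: "rdual (\<lambda>x. max (u x) (v x)) = (\<lambda>y. min (rdual u y) (rdual v y))"
        and mn: "rdual (\<lambda>x. min (u x) (v x)) = (\<lambda>y. max (rdual u y) (rdual v y))"
        using rdual_max[OF u v] rdual_min[OF u v] mm by blast+
      have "convex_on UNIV (\<lambda>y. min (rdual u y) (rdual v y))"
        using convex_on_rdual mm unfolding mx[symmetric] by blast
      from diff_op_replicate_val[OF convex_on_rdual[OF u] convex_on_rdual[OF v] this hs]
      show "Zbar (replicate i (\<lambda>x. max (u x) (v x)) @ vs) + Zbar (replicate i (\<lambda>x. min (u x) (v x)) @ vs)
        = Zbar (replicate i u @ vs) + Zbar (replicate i v @ vs)"
        \<comment> \<open>Maximum and minimum have changed places on the dual side, so only the
          order of the summands differs.\<close>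
        unfolding Zb mx mn add_divide_distrib[symmetric] by (simp only: add.commute)
    qed
    moreover have "epi_homogeneous_on Conv_sc (real i) (\<lambda>u. Zbar (replicate i u @ vs))"
      unfolding epi_homogeneous_on_def
    proof (intro ballI allI impI)
      fix u :: "real ^ 'n \<Rightarrow> ereal" and c :: real assume u: "u \<in> Conv_sc" and c: "0 < c"
      have "polar (replicate i (\<lambda>x. c * rdual u x) @ ?hs) = c ^ i * polar (replicate i (rdual u) @ ?hs)"
        using i vs c by (intro polar_scale_replicate convex_map convex_on_rdual u) auto
      then show "Zbar (replicate i (epi_mult c u) @ vs) = c powr real i * Zbar (replicate i u @ vs)"
        using c u unfolding Zbar_def by (simp add: rdual_epi_mult powr_realpow)
    qed
    ultimately show ?thesis
      by blast
  qed
  with sym exp add show ?thesis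
    by (intro exI[of _ Zbar]) blast
qed

end
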